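(* For every $n\in\mathbb{N}$, $a \in \mathbb{Z}^+$ and $b \in \mathbb{N}$, there is a polynomial-time reduction from $\Sigma_{2n+1}$-SAT to the $(n,a,b)$-resilience problem. Moreover, the planning scenario produced by the reduction is always a $1$-simple progressing planning scenario whose traces contain only facts of bounded size.
   Context: $\Sigma_{2n+1}$-SAT is the set of true quantified Boolean formulas $\exists \bar v_1\forall \bar v_2\exists\bar v_3\cdots\forall\bar v_{2n}\exists\bar v_{2n+1}\,\varphi$, where $\varphi$ is a propositional formula in 3-CNF. Timed multiset rewriting (MSR). Fix a finite typed first-order signature containing a 0-ary predicate $\mathit{Time}$. Ground terms are built from constants, function symbols and a countably infinite supply of ground constants. A (timestamped) fact is $F@t$, where $F$ is an atomic formula over ground terms and $t\in\mathbb{N}$. The size of a fact is the number of signature symbols occurring in it. A configuration is a finite multiset of timestamped facts containing exactly one $\mathit{Time}@t$; this $t$ is the global time. The $\mathit{Tick}$ rule is $\mathit{Time}@T\to\mathit{Time}@(T+1)$. An instantaneous rule has the form $\mathit{Time}@T,\mathcal{W},F_1@T_1,\dots,F_n@T_n\mid\mathcal{C}\to\mathit{Time}@T,\mathcal{W},Q_1@(T+D_1),\dots,Q_m@(T+D_m)$. Here $\mathcal{W}$ is the side condition, the guard $\mathcal{C}$ is a set of constraints $T_1>T_2\pm N$ or $T_1=T_2\pm N$, the $F_i$ are consumed and the $Q_j$ are created. A rule is applied via a ground substitution $\sigma$ that maps the precondition's variables to values in the configuration and maps postcondition-only variables injectively to fresh constants. Applicability requires the instantiated precondition to be a sub-multiset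 of the configuration and the guard to hold. A trace is a sequence of configurations linked by rule applications. An instantaneous rule is progressing if (i) $n=m$; (ii) $\mathcal{C}$ contains $T\ge T_i$ for all consumed $F_i@T_i$; and (iii) some $D_j\ge1$. Predicates other than $\mathit{Time}$ are partitioned into goal, critical and system predicates; planning facts use goal or critical predicates. A goal (resp. critical) specification is a finite set of pairs $\langle\mathcal{S}_j,\mathcal{C}_j\rangle$. Each $\mathcal{S}_j$ is a multiset of atomic formulas $F@T$ with at least one goal (resp. critical) predicate, and each $\mathcal{C}_j$ is a set of time constraints. A configuration $\mathcal{S}$ is goal (resp. critical) if, for some $j$, some ground substitution $\sigma$ gives $\mathcal{S}_j\sigma\subseteq\mathcal{S}$ with $\mathcal{C}_j\sigma$ true. A trace is compliant if none of its configurations is critical. System rules are $\mathit{Tick}$ and instantaneous rules not consuming or creating planning facts. Update rules are instantaneous rules of one of two kinds: system update rules, in which planning facts occur only in the side condition; or goal update rules, which consume or create at least one goal fact and in which critical facts occur only in the side condition. A planning scenario $A=(\mathcal{R},\mathcal{GS},\mathcal{CS},\mathcal{E},\mathcal{S}_0)$ consists of system rules, a goal specification, a critical specification, update rules, and an initial configuration. It is progressing (PPS) if all instantaneous rules in $\mathcal{R}\cup\mathcal{E}$ are progressing. It is $\eta$-simple if each pair in $\mathcal{CS}$ has fewer than $\eta$ variables. $(n,a,b)$-resilience is defined by recursion on $n$. Let $t_0$ be the global time of $\mathcal{S}_0$. - A trace is $(0,a,b)$-resilient w.r.t. $A$ if it is a compliant trace of $\mathcal{R}$-rules from $\mathcal{S}_0$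 to a goal configuration with at most $a+b$ $\mathit{Tick}$ applications. - For $n>0$, a trace $\tau$ is $(n,a,b)$-resilient if it is $(0,a,b)$-resilient and the following holds. For every update rule $r\in\mathcal{E}$ and every configuration $\mathcal{S}_i$ of $\tau$ with $d_i=t_i-t_0\le a$ and $\mathcal{S}_i\to_r\mathcal{S}'_{i+1}$, there is a trace of $\mathcal{R}$-rules from $\mathcal{S}'_{i+1}$ to a goal configuration that is $(n-1,a-d_i,b)$-resilient w.r.t. $(\mathcal{R},\mathcal{GS},\mathcal{CS},\mathcal{E},\mathcal{S}'_{i+1})$. The $(n,a,b)$-resilience problem asks whether such a trace exists for a given planning scenario $A$. *)

theory Defs
  imports "HOL-Library.Multiset" "HOL-Computational_Algebra.Polynomial"
begin

section \<open>Polynomial-time reductions\<close>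

subsection \<open>Deterministic multi-tape Turing machines\<close>

text \<open>
  Tape symbols and states are natural numbers; the symbol 0 is the blank. Tapes are infinite in both
  directions. The initial state is 0, and a machine halts when it reaches the state
  \<open>num_states M\<close>, which has no outgoing transitions.
\<close>

datatype move = MoveLeft | Stay | MoveRight

type_synonym tape = "(int \<Rightarrow> nat) \<times> int"

record turing_machine =
  num_tapes :: nat
  num_symbols :: nat
  num_states :: nat
  trans :: "nat \<Rightarrow> nat list \<Rightarrow> nat \<times> (nat \<times> move) list"

definition wf_tm :: "turing_machine \<Rightarrow> bool" where
  "wf_tm M \<longleftrightarrow> num_tapes M \<ge> 1 \<and>
     (\<forall>q xs. q < num_states M \<and> length xs = num_tapes M \<and> set xs \<subseteq> {..<num_symbols M} \<longrightarrow>
        fst (trans M q xs) \<le> num_states M \<and>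
        length (snd (trans M q xs)) = num_tapes M \<and>
        fst ` set (snd (trans M q xs)) \<subseteq> {..<num_symbols M})"

fun shift :: "move \<Rightarrow> int" where
  "shift MoveLeft = - 1"
| "shift Stay = 0"
| "shift MoveRight = 1"

fun act_tape :: "nat \<times> move \<Rightarrow> tape \<Rightarrow> tape" where
  "act_tape (x, d) (c, h) = (c(h := x), h + shift d)"

fun tm_step :: "turing_machine \<Rightarrow> nat \<times> tape list \<Rightarrow> nat \<times> tape list" where
  "tm_step M (q, ts) =
     (if q < num_states M
      then let (q', as) = trans M q (map (\<lambda>(c, h). c h) ts) in (q', map2 act_tape as ts)
      else (q, ts))"

definition word_content :: "nat list \<Rightarrow> int \<Rightarrow> nat" where
  "word_content w i = (if 0 \<le> i \<and> i < int (length w) then w ! nat i else 0)"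

text \<open>The input is written on the first tape; the output is read off the last tape.\<close>

definition tm_init :: "turing_machine \<Rightarrow> nat list \<Rightarrow> nat \<times> tape list" where
  "tm_init M w = (0, (word_content w, 0) # replicate (num_tapes M - 1) (\<lambda>_. 0, 0))"

definition tm_computes_within :: "turing_machine \<Rightarrow> nat list \<Rightarrow> nat list \<Rightarrow> nat \<Rightarrow> bool" where
  "tm_computes_within M w u t \<longleftrightarrow>
     (let (q, ts) = (tm_step M ^^ t) (tm_init M w)
      in q = num_states M \<and> fst (last ts) = word_content u)"

definition poly_time_computable ::
    "('i \<Rightarrow> nat list) \<Rightarrow> ('o \<Rightarrow> nat list) \<Rightarrow> 'i set \<Rightarrow> ('i \<Rightarrow> 'o) \<Rightarrow> bool" where
  "poly_time_computable enc\<^sub>1 enc\<^sub>2 D f \<longleftrightarrow>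
     (\<exists>M (p :: nat poly). wf_tm M \<and>
        (\<forall>x\<in>D. set (enc\<^sub>1 x) \<subseteq> {0<..<num_symbols M} \<and>
               tm_computes_within M (enc\<^sub>1 x) (enc\<^sub>2 (f x)) (poly p (length (enc\<^sub>1 x)))))"

text \<open>
  Here \<open>D\<^sub>1\<close>, \<open>D\<^sub>2\<close> are the sets of instances of two decision problems, and \<open>Y\<^sub>1\<close>, \<open>Y\<^sub>2\<close> the sets
  of their positive instances.
\<close>

definition poly_time_reduction ::
    "('i \<Rightarrow> nat list) \<Rightarrow> 'i set \<Rightarrow> 'i set \<Rightarrow> ('o \<Rightarrow> nat list) \<Rightarrow> 'o set \<Rightarrow> 'o set \<Rightarrow> ('i \<Rightarrow> 'o) \<Rightarrow> bool"
  where
  "poly_time_reduction enc\<^sub>1 D\<^sub>1 Y\<^sub>1 enc\<^sub>2 D\<^sub>2 Y\<^sub>2 f \<longleftrightarrow>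
     poly_time_computable enc\<^sub>1 enc\<^sub>2 D\<^sub>1 f \<and>
     (\<forall>x\<in>D\<^sub>1. f x \<in> D\<^sub>2 \<and> (x \<in> Y\<^sub>1 \<longleftrightarrow> f x \<in> Y\<^sub>2))"

subsection \<open>Encoding of instances as words\<close>

text \<open>
  Syntactic objects are turned into nested lists of numbers, which are serialised over the alphabet
  \<open>{1, 2, 3, 4, 5}\<close>: numbers are written in binary (1 and 2 are the binary digits, least significant
  digit first, and 3 marks the end of a number); 4 and 5 are the opening and the closing bracket.
\<close>

datatype sexp = Num nat | Lst "sexp list"

fun binary :: "nat \<Rightarrow> nat list" where
  "binary n = (if n = 0 then [] else (if even n then 1 else 2) # binary (n div 2))"

declare binary.simps [simp del]

fun serialize :: "sexp \<Rightarrow> nat list" where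
  "serialize (Num n) = binary n @ [3]"
| "serialize (Lst xs) = 4 # concat (map serialize xs) @ [5]"

definition sexp_int :: "int \<Rightarrow> sexp" where
  "sexp_int z = Lst [Num (if z < 0 then 1 else 0), Num (nat \<bar>z\<bar>)]"

definition sexp_list :: "('a \<Rightarrow> sexp) \<Rightarrow> 'a list \<Rightarrow> sexp" where
  "sexp_list f xs = Lst (map f xs)"

section \<open>Quantified Boolean formulas\<close>

text \<open>
  A literal is a sign together with a variable. A formula is given by the blocks of its
  quantifier prefix, which alternate and start with an existential one, and by its matrix in 3-CNF.
\<close>

type_synonym literal = "bool \<times> nat"
type_synonym clause = "literal \<times> literal \<times> literal"

record qbf =
  blocks :: "nat list list"
  matrix :: "clause list"

fun clause_lits :: "clause \<Rightarrow> literal set" where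
  "clause_lits (l1, l2, l3) = {l1, l2, l3}"

definition sigma_formula :: "nat \<Rightarrow> qbf \<Rightarrow> bool" where
  "sigma_formula k \<phi> \<longleftrightarrow> length (blocks \<phi>) = k \<and> distinct (concat (blocks \<phi>)) \<and>
     (\<forall>c\<in>set (matrix \<phi>). snd ` clause_lits c \<subseteq> set (concat (blocks \<phi>)))"

definition matrix_true :: "clause list \<Rightarrow> (nat \<Rightarrow> bool) \<Rightarrow> bool" where
  "matrix_true cs \<alpha> \<longleftrightarrow> (\<forall>c\<in>set cs. \<exists>(s, v)\<in>clause_lits c. \<alpha> v = s)"

fun prefix_true :: "bool \<Rightarrow> nat list list \<Rightarrow> ((nat \<Rightarrow> bool) \<Rightarrow> bool) \<Rightarrow> (nat \<Rightarrow> bool) \<Rightarrow> bool" where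
  "prefix_true ex [] P \<alpha> = P \<alpha>"
| "prefix_true ex (vs # bs) P \<alpha> =
     (if ex then \<exists>\<beta>. prefix_true False bs P (override_on \<alpha> \<beta> (set vs))
      else \<forall>\<beta>. prefix_true True bs P (override_on \<alpha> \<beta> (set vs)))"

text \<open>The assignment we start from is irrelevant, as all variables are quantified.\<close>

definition qbf_true :: "qbf \<Rightarrow> bool" where
  "qbf_true \<phi> \<longleftrightarrow> prefix_true True (blocks \<phi>) (matrix_true (matrix \<phi>)) (\<lambda>_. False)"

definition Sigma_SAT :: "nat \<Rightarrow> qbf set" where
  "Sigma_SAT k = {\<phi>. sigma_formula k \<phi> \<and> qbf_true \<phi>}"

fun sexp_literal :: "literal \<Rightarrow> sexp" where
  "sexp_literal (s, v) = Lst [Num (if s then 1 else 0), Num v]"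

fun sexp_clause :: "clause \<Rightarrow> sexp" where
  "sexp_clause (l1, l2, l3) = Lst [sexp_literal l1, sexp_literal l2, sexp_literal l3]"

definition enc_qbf :: "qbf \<Rightarrow> nat list" where
  "enc_qbf \<phi> = serialize (Lst [sexp_list (sexp_list Num) (blocks \<phi>), sexp_list sexp_clause (matrix \<phi>)])"

section \<open>Timed multiset rewriting\<close>

subsection \<open>Signatures, terms and facts\<close>

text \<open>
  Sorts and function symbols are natural numbers, and so are the predicate symbols other than
  \<open>Time\<close>. A signature gives the argument sorts and the result sort of its function symbols
  (constants being 0-ary function symbols) and the argument sorts of its predicates. Each sort has an
  infinite supply of ground constants \<open>Cst s i\<close> outside the signature.
\<close>

datatype pred_symbol = Time | Pred nat
datatype pred_kind = Goal | Critical | System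

record signature =
  sorts :: "nat set"
  funs :: "nat \<Rightarrow> (nat list \<times> nat) option"
  preds :: "nat \<Rightarrow> nat list option"
  kind :: "nat \<Rightarrow> pred_kind"

definition wf_signature :: "signature \<Rightarrow> bool" where
  "wf_signature Sg \<longleftrightarrow> finite (sorts Sg) \<and> finite (dom (funs Sg)) \<and> finite (dom (preds Sg)) \<and>
     (\<forall>(ss, s)\<in>ran (funs Sg). set ss \<subseteq> sorts Sg \<and> s \<in> sorts Sg) \<and>
     (\<forall>ss\<in>ran (preds Sg). set ss \<subseteq> sorts Sg)"

text \<open>The first argument of \<open>Var\<close> and \<open>Cst\<close> is the sort.\<close>

datatype trm = Var nat nat | Cst nat nat | App nat "trm list"
datatype atom = Atom pred_symbol "trm list"

fun has_sort :: "signature \<Rightarrow> trm \<Rightarrow> nat \<Rightarrow> bool" where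
  "has_sort Sg (Var s x) s' \<longleftrightarrow> s = s' \<and> s \<in> sorts Sg"
| "has_sort Sg (Cst s i) s' \<longleftrightarrow> s = s' \<and> s \<in> sorts Sg"
| "has_sort Sg (App f ts) s' \<longleftrightarrow>
     (case funs Sg f of None \<Rightarrow> False | Some (ss, s) \<Rightarrow> s = s' \<and> list_all2 (has_sort Sg) ts ss)"

fun wf_atom :: "signature \<Rightarrow> atom \<Rightarrow> bool" where
  "wf_atom Sg (Atom Time ts) \<longleftrightarrow> ts = []"
| "wf_atom Sg (Atom (Pred q) ts) \<longleftrightarrow>
     (case preds Sg q of None \<Rightarrow> False | Some ss \<Rightarrow> list_all2 (has_sort Sg) ts ss)"

fun trm_vars :: "trm \<Rightarrow> (nat \<times> nat) set" where
  "trm_vars (Var s x) = {(s, x)}"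
| "trm_vars (Cst s i) = {}"
| "trm_vars (App f ts) = (\<Union>t\<in>set ts. trm_vars t)"

fun trm_csts :: "trm \<Rightarrow> (nat \<times> nat) set" where
  "trm_csts (Var s x) = {}"
| "trm_csts (Cst s i) = {(s, i)}"
| "trm_csts (App f ts) = (\<Union>t\<in>set ts. trm_csts t)"

fun trm_size :: "trm \<Rightarrow> nat" where
  "trm_size (Var s x) = 1"
| "trm_size (Cst s i) = 1"
| "trm_size (App f ts) = 1 + (\<Sum>t\<leftarrow>ts. trm_size t)"

fun trm_subst :: "(nat \<times> nat \<Rightarrow> trm) \<Rightarrow> trm \<Rightarrow> trm" where
  "trm_subst \<sigma> (Var s x) = \<sigma> (s, x)"
| "trm_subst \<sigma> (Cst s i) = Cst s i"
| "trm_subst \<sigma> (App f ts) = App f (map (trm_subst \<sigma>) ts)"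

fun atom_pred :: "atom \<Rightarrow> pred_symbol" where
  "atom_pred (Atom p ts) = p"

fun atom_vars :: "atom \<Rightarrow> (nat \<times> nat) set" where
  "atom_vars (Atom p ts) = (\<Union>t\<in>set ts. trm_vars t)"

fun atom_csts :: "atom \<Rightarrow> (nat \<times> nat) set" where
  "atom_csts (Atom p ts) = (\<Union>t\<in>set ts. trm_csts t)"

fun atom_size :: "atom \<Rightarrow> nat" where
  "atom_size (Atom p ts) = 1 + (\<Sum>t\<leftarrow>ts. trm_size t)"

fun atom_subst :: "(nat \<times> nat \<Rightarrow> trm) \<Rightarrow> atom \<Rightarrow> atom" where
  "atom_subst \<sigma> (Atom p ts) = Atom p (map (trm_subst \<sigma>) ts)"

definition ground_subst :: "signature \<Rightarrow> (nat \<times> nat \<Rightarrow> trm) \<Rightarrow> bool" where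
  "ground_subst Sg \<sigma> \<longleftrightarrow>
     (\<forall>s\<in>sorts Sg. \<forall>x. trm_vars (\<sigma> (s, x)) = {} \<and> has_sort Sg (\<sigma> (s, x)) s)"

definition goal_atom :: "signature \<Rightarrow> atom \<Rightarrow> bool" where
  "goal_atom Sg F \<longleftrightarrow> (\<exists>q. atom_pred F = Pred q \<and> kind Sg q = Goal)"

definition critical_atom :: "signature \<Rightarrow> atom \<Rightarrow> bool" where
  "critical_atom Sg F \<longleftrightarrow> (\<exists>q. atom_pred F = Pred q \<and> kind Sg q = Critical)"

definition planning_atom :: "signature \<Rightarrow> atom \<Rightarrow> bool" where
  "planning_atom Sg F \<longleftrightarrow> goal_atom Sg F \<or> critical_atom Sg F"

subsection \<open>Configurations\<close>

type_synonym config = "(atom \<times> nat) multiset"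

definition wf_config :: "signature \<Rightarrow> config \<Rightarrow> bool" where
  "wf_config Sg S \<longleftrightarrow> (\<forall>(F, t)\<in>#S. wf_atom Sg F \<and> atom_vars F = {}) \<and>
     size {#Ft \<in># S. atom_pred (fst Ft) = Time#} = 1"

definition global_time :: "config \<Rightarrow> nat" where
  "global_time S = (THE t. (Atom Time [], t) \<in># S)"

definition config_csts :: "config \<Rightarrow> (nat \<times> nat) set" where
  "config_csts S = (\<Union>(F, t)\<in>set_mset S. atom_csts F)"

subsection \<open>Time constraints and patterns\<close>

text \<open>
  Time variables are natural numbers. The constraints below stand for \<open>T > U + N\<close> and \<open>T = U + N\<close>,
  where \<open>N\<close> is an integer; \<open>T \<ge> U\<close> is expressed as \<open>T > U - 1\<close>.
\<close>

datatype time_constraint = Later nat nat int | Same nat nat int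

fun constraint_holds :: "(nat \<Rightarrow> nat) \<Rightarrow> time_constraint \<Rightarrow> bool" where
  "constraint_holds \<theta> (Later T U N) \<longleftrightarrow> int (\<theta> T) > int (\<theta> U) + N"
| "constraint_holds \<theta> (Same T U N) \<longleftrightarrow> int (\<theta> T) = int (\<theta> U) + N"

fun constraint_vars :: "time_constraint \<Rightarrow> nat set" where
  "constraint_vars (Later T U N) = {T, U}"
| "constraint_vars (Same T U N) = {T, U}"

abbreviation not_before :: "nat \<Rightarrow> nat \<Rightarrow> time_constraint" where
  "not_before T U \<equiv> Later T U (- 1)"

text \<open>
  A pattern is an atomic formula with a time variable. The finite multisets and finite sets
  occurring in rules, specifications and scenarios are given by lists, so that they can be encoded
  as words.
\<close>

type_synonym pat = "atom \<times> nat"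

definition pats_subst :: "(nat \<times> nat \<Rightarrow> trm) \<Rightarrow> (nat \<Rightarrow> nat) \<Rightarrow> pat list \<Rightarrow> config" where
  "pats_subst \<sigma> \<theta> ps = mset (map (\<lambda>(F, T). (atom_subst \<sigma> F, \<theta> T)) ps)"

subsection \<open>Rules\<close>

text \<open>The time variable \<open>T\<close> of the fact \<open>Time@T\<close> in an instantaneous rule is \<open>rule_now\<close>.\<close>

record irule =
  rule_now :: nat
  rule_side :: "pat list"
  rule_consumed :: "pat list"
  rule_guard :: "time_constraint list"
  rule_created :: "(atom \<times> nat) list"

definition rule_pre :: "irule \<Rightarrow> pat list" where
  "rule_pre r = (Atom Time [], rule_now r) # rule_side r @ rule_consumed r"

definition rule_atoms :: "irule \<Rightarrow> atom set" where
  "rule_atoms r = fst ` (set (rule_side r) \<union> set (rule_consumed r) \<union> set (rule_created r))"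

definition wf_rule :: "signature \<Rightarrow> irule \<Rightarrow> bool" where
  "wf_rule Sg r \<longleftrightarrow> (\<forall>F\<in>rule_atoms r. wf_atom Sg F \<and> atom_pred F \<noteq> Time) \<and>
     (\<forall>c\<in>set (rule_guard r). constraint_vars c \<subseteq> snd ` set (rule_pre r))"

definition fresh_vars :: "irule \<Rightarrow> (nat \<times> nat) set" where
  "fresh_vars r =
     (\<Union>F\<in>fst ` set (rule_created r). atom_vars F) - (\<Union>F\<in>fst ` set (rule_pre r). atom_vars F)"

definition fresh_subst :: "irule \<Rightarrow> config \<Rightarrow> (nat \<times> nat \<Rightarrow> trm) \<Rightarrow> bool" where
  "fresh_subst r S \<sigma> \<longleftrightarrow> inj_on \<sigma> (fresh_vars r) \<and>
     (\<forall>(s, x)\<in>fresh_vars r. \<exists>i. \<sigma> (s, x) = Cst s i \<and>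
        (s, i) \<notin> config_csts S \<and> (s, i) \<notin> (\<Union>F\<in>rule_atoms r. atom_csts F))"

definition apply_rule :: "signature \<Rightarrow> irule \<Rightarrow> config \<Rightarrow> config \<Rightarrow> bool" where
  "apply_rule Sg r S S' \<longleftrightarrow>
     (\<exists>\<sigma> \<theta>. ground_subst Sg \<sigma> \<and> fresh_subst r S \<sigma> \<and>
        pats_subst \<sigma> \<theta> (rule_pre r) \<subseteq># S \<and>
        (\<forall>c\<in>set (rule_guard r). constraint_holds \<theta> c) \<and>
        S' = S - pats_subst \<sigma> \<theta> (rule_consumed r) +
             mset (map (\<lambda>(Q, D). (atom_subst \<sigma> Q, \<theta> (rule_now r) + D)) (rule_created r)))"

definition apply_tick :: "config \<Rightarrow> config \<Rightarrow> bool" where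
  "apply_tick S S' \<longleftrightarrow>
     (\<exists>t. (Atom Time [], t) \<in># S \<and> S' = S - {#(Atom Time [], t)#} + {#(Atom Time [], t + 1)#})"

definition progressing_rule :: "irule \<Rightarrow> bool" where
  "progressing_rule r \<longleftrightarrow> length (rule_consumed r) = length (rule_created r) \<and>
     (\<forall>(F, U)\<in>set (rule_consumed r). not_before (rule_now r) U \<in> set (rule_guard r)) \<and>
     (\<exists>(Q, D)\<in>set (rule_created r). D \<ge> 1)"

subsection \<open>Traces\<close>

text \<open>
  A trace consists of its first configuration and the list of its steps, each of them with the
  resulting configuration. \<open>Tick\<close> is always available; \<open>R\<close> is the set of instantaneous rules.
\<close>

datatype action = Tick | Inst irule
type_synonym trace = "config \<times> (action \<times> config) list"

fun step :: "signature \<Rightarrow> irule set \<Rightarrow> action \<Rightarrow> config \<Rightarrow> config \<Rightarrow> bool" where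
  "step Sg R Tick S S' \<longleftrightarrow> apply_tick S S'"
| "step Sg R (Inst r) S S' \<longleftrightarrow> r \<in> R \<and> apply_rule Sg r S S'"

fun linked :: "signature \<Rightarrow> irule set \<Rightarrow> config \<Rightarrow> (action \<times> config) list \<Rightarrow> bool" where
  "linked Sg R S [] \<longleftrightarrow> True"
| "linked Sg R S ((\<alpha>, S') # ss) \<longleftrightarrow> step Sg R \<alpha> S S' \<and> linked Sg R S' ss"

definition trace_from :: "signature \<Rightarrow> irule set \<Rightarrow> config \<Rightarrow> trace \<Rightarrow> bool" where
  "trace_from Sg R S \<tau> \<longleftrightarrow> fst \<tau> = S \<and> linked Sg R (fst \<tau>) (snd \<tau>)"

definition trace_configs :: "trace \<Rightarrow> config list" where
  "trace_configs \<tau> = fst \<tau> # map snd (snd \<tau>)"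

definition num_ticks :: "trace \<Rightarrow> nat" where
  "num_ticks \<tau> = length (filter (\<lambda>(\<alpha>, S). \<alpha> = Tick) (snd \<tau>))"

section \<open>Planning scenarios\<close>

type_synonym spec = "(pat list \<times> time_constraint list) list"

text \<open>\<open>Tick\<close> is implicitly one of the system rules.\<close>

record scenario =
  system_rules :: "irule list"
  goal_spec :: spec
  critical_spec :: spec
  update_rules :: "irule list"
  init_config :: "(atom \<times> nat) list"

definition matches_spec :: "signature \<Rightarrow> spec \<Rightarrow> config \<Rightarrow> bool" where
  "matches_spec Sg sp S \<longleftrightarrow>
     (\<exists>(ps, cs)\<in>set sp. \<exists>\<sigma> \<theta>. ground_subst Sg \<sigma> \<and> pats_subst \<sigma> \<theta> ps \<subseteq># S \<and>
        (\<forall>c\<in>set cs. constraint_holds \<theta> c))"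

definition goal_config :: "signature \<Rightarrow> scenario \<Rightarrow> config \<Rightarrow> bool" where
  "goal_config Sg A S \<longleftrightarrow> matches_spec Sg (goal_spec A) S"

definition critical_config :: "signature \<Rightarrow> scenario \<Rightarrow> config \<Rightarrow> bool" where
  "critical_config Sg A S \<longleftrightarrow> matches_spec Sg (critical_spec A) S"

definition compliant :: "signature \<Rightarrow> scenario \<Rightarrow> trace \<Rightarrow> bool" where
  "compliant Sg A \<tau> \<longleftrightarrow> (\<forall>S\<in>set (trace_configs \<tau>). \<not> critical_config Sg A S)"

definition wf_spec :: "signature \<Rightarrow> (atom \<Rightarrow> bool) \<Rightarrow> spec \<Rightarrow> bool" where
  "wf_spec Sg K sp \<longleftrightarrow>
     (\<forall>(ps, cs)\<in>set sp. (\<forall>(F, T)\<in>set ps. wf_atom Sg F) \<and> (\<exists>(F, T)\<in>set ps. K F) \<and>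
        (\<forall>c\<in>set cs. constraint_vars c \<subseteq> snd ` set ps))"

definition changed_atoms :: "irule \<Rightarrow> atom set" where
  "changed_atoms r = fst ` (set (rule_consumed r) \<union> set (rule_created r))"

definition system_rule :: "signature \<Rightarrow> irule \<Rightarrow> bool" where
  "system_rule Sg r \<longleftrightarrow> wf_rule Sg r \<and> (\<forall>F\<in>changed_atoms r. \<not> planning_atom Sg F)"

definition system_update_rule :: "signature \<Rightarrow> irule \<Rightarrow> bool" where
  "system_update_rule Sg r \<longleftrightarrow> wf_rule Sg r \<and> (\<forall>F\<in>changed_atoms r. \<not> planning_atom Sg F)"

definition goal_update_rule :: "signature \<Rightarrow> irule \<Rightarrow> bool" where
  "goal_update_rule Sg r \<longleftrightarrow> wf_rule Sg r \<and>
     (\<exists>F\<in>changed_atoms r. goal_atom Sg F) \<and> (\<forall>F\<in>changed_atoms r. \<not> critical_atom Sg F)"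

definition planning_scenario :: "signature \<Rightarrow> scenario \<Rightarrow> bool" where
  "planning_scenario Sg A \<longleftrightarrow>
     (\<forall>r\<in>set (system_rules A). system_rule Sg r) \<and>
     wf_spec Sg (goal_atom Sg) (goal_spec A) \<and>
     wf_spec Sg (critical_atom Sg) (critical_spec A) \<and>
     (\<forall>r\<in>set (update_rules A). system_update_rule Sg r \<or> goal_update_rule Sg r) \<and>
     wf_config Sg (mset (init_config A))"

definition progressing_scenario :: "signature \<Rightarrow> scenario \<Rightarrow> bool" where
  "progressing_scenario Sg A \<longleftrightarrow> planning_scenario Sg A \<and>
     (\<forall>r\<in>set (system_rules A) \<union> set (update_rules A). progressing_rule r)"

text \<open>Both the term variables and the time variables of a pair are counted.\<close>

definition num_vars :: "pat list \<times> time_constraint list \<Rightarrow> nat" where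
  "num_vars = (\<lambda>(ps, cs). card (\<Union>F\<in>fst ` set ps. atom_vars F) +
                          card (snd ` set ps \<union> (\<Union>c\<in>set cs. constraint_vars c)))"

definition simple_scenario :: "nat \<Rightarrow> scenario \<Rightarrow> bool" where
  "simple_scenario \<eta> A \<longleftrightarrow> (\<forall>p\<in>set (critical_spec A). num_vars p < \<eta>)"

definition facts_bounded :: "signature \<Rightarrow> nat \<Rightarrow> scenario \<Rightarrow> bool" where
  "facts_bounded Sg k A \<longleftrightarrow>
     (\<forall>\<tau>. trace_from Sg (set (system_rules A) \<union> set (update_rules A)) (mset (init_config A)) \<tau> \<longrightarrow>
        (\<forall>S\<in>set (trace_configs \<tau>). \<forall>(F, t)\<in>#S. atom_size F \<le> k))"

subsection \<open>Resilience\<close>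

text \<open>
  \<open>resilient Sg A n a b S \<tau>\<close> means that \<open>\<tau>\<close> is \<open>(n,a,b)\<close>-resilient with respect to the scenario
  obtained from \<open>A\<close> by replacing its initial configuration with \<open>S\<close>.
\<close>

fun resilient :: "signature \<Rightarrow> scenario \<Rightarrow> nat \<Rightarrow> nat \<Rightarrow> nat \<Rightarrow> config \<Rightarrow> trace \<Rightarrow> bool" where
  "resilient Sg A 0 a b S \<tau> \<longleftrightarrow>
     trace_from Sg (set (system_rules A)) S \<tau> \<and> compliant Sg A \<tau> \<and>
     goal_config Sg A (last (trace_configs \<tau>)) \<and> num_ticks \<tau> \<le> a + b"
| "resilient Sg A (Suc n) a b S \<tau> \<longleftrightarrow>
     resilient Sg A 0 a b S \<tau> \<and>
     (\<forall>r\<in>set (update_rules A). \<forall>S\<^sub>i\<in>set (trace_configs \<tau>). \<forall>S'.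
        global_time S\<^sub>i - global_time S \<le> a \<and> apply_rule Sg r S\<^sub>i S' \<longrightarrow>
        (\<exists>\<tau>'. resilient Sg A n (a - (global_time S\<^sub>i - global_time S)) b S' \<tau>'))"

definition resilience_problem :: "signature \<Rightarrow> nat \<Rightarrow> nat \<Rightarrow> nat \<Rightarrow> scenario set" where
  "resilience_problem Sg n a b =
     {A. planning_scenario Sg A \<and> (\<exists>\<tau>. resilient Sg A n a b (mset (init_config A)) \<tau>)}"

subsection \<open>Encoding of scenarios\<close>

fun sexp_trm :: "trm \<Rightarrow> sexp" where
  "sexp_trm (Var s x) = Lst [Num 0, Num s, Num x]"
| "sexp_trm (Cst s i) = Lst [Num 1, Num s, Num i]"
| "sexp_trm (App f ts) = Lst [Num 2, Num f, Lst (map sexp_trm ts)]"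

fun sexp_atom :: "atom \<Rightarrow> sexp" where
  "sexp_atom (Atom Time ts) = Lst [Num 0, sexp_list sexp_trm ts]"
| "sexp_atom (Atom (Pred q) ts) = Lst [Num 1, Num q, sexp_list sexp_trm ts]"

fun sexp_timed :: "atom \<times> nat \<Rightarrow> sexp" where
  "sexp_timed (F, t) = Lst [sexp_atom F, Num t]"

fun sexp_constraint :: "time_constraint \<Rightarrow> sexp" where
  "sexp_constraint (Later T U N) = Lst [Num 0, Num T, Num U, sexp_int N]"
| "sexp_constraint (Same T U N) = Lst [Num 1, Num T, Num U, sexp_int N]"

definition sexp_rule :: "irule \<Rightarrow> sexp" where
  "sexp_rule r = Lst
     [Num (rule_now r), sexp_list sexp_timed (rule_side r), sexp_list sexp_timed (rule_consumed r),
      sexp_list sexp_constraint (rule_guard r), sexp_list sexp_timed (rule_created r)]"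

definition sexp_spec :: "spec \<Rightarrow> sexp" where
  "sexp_spec = sexp_list (\<lambda>(ps, cs). Lst [sexp_list sexp_timed ps, sexp_list sexp_constraint cs])"

definition enc_scenario :: "scenario \<Rightarrow> nat list" where
  "enc_scenario A = serialize (Lst
     [sexp_list sexp_rule (system_rules A), sexp_spec (goal_spec A), sexp_spec (critical_spec A),
      sexp_list sexp_rule (update_rules A), sexp_list sexp_timed (init_config A)])"

section \<open>The encodings are injective\<close>

lemma set_binary: "set (binary n) \<subseteq> {1, 2}"
  by (induction n rule: binary.induct) (subst binary.simps, auto)

lemma binary_inject: "binary m = binary n \<Longrightarrow> m = n"
proof (induction m arbitrary: n rule: binary.induct)
  case (1 m)
  show ?case
  proof (cases "m = 0 \<or> n = 0")
    case True
    then show ?thesis using "1.prems" by (auto simp: binary.simps[of m] binary.simps[of n] split: if_splits)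
  next
    case False
    then have "even m = even n" "binary (m div 2) = binary (n div 2)"
      using "1.prems" by (auto simp: binary.simps[of m] binary.simps[of n] split: if_splits)
    then show ?thesis using "1.IH"[of "n div 2"] False
      by (metis dvd_mult_div_cancel odd_two_times_div_two_succ)
  qed
qed

lemma binary_append_inject:
  "binary m @ 3 # u = binary n @ 3 # v \<Longrightarrow> m = n \<and> u = v"
proof -
  assume *: "binary m @ 3 # u = binary n @ 3 # v"
  have "\<forall>x\<in>set (binary m). x \<noteq> 3" "\<forall>x\<in>set (binary n). x \<noteq> 3"
    using set_binary[of m] set_binary[of n] by auto
  then have "takeWhile (\<lambda>x. x \<noteq> 3) (binary m @ 3 # u) = binary m"
    "takeWhile (\<lambda>x. x \<noteq> 3) (binary n @ 3 # v) = binary n"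
    by (simp_all add: takeWhile_append)
  with * have "binary m = binary n" "u = v" by auto
  then show ?thesis using binary_inject by auto
qed

lemma hd_serialize: "\<exists>x w. serialize s = x # w \<and> x \<noteq> 5 \<and> (x = 4 \<longleftrightarrow> (\<exists>xs. s = Lst xs))"
proof (cases s)
  case (Num n)
  have "set (binary n @ [3]) \<subseteq> {1,2,3}" using set_binary[of n] by auto
  moreover obtain x w where "binary n @ [3] = x # w" by (cases "binary n @ [3]") auto
  ultimately show ?thesis using Num by auto
qed auto

lemma serialize_append_inject: "serialize s @ u = serialize t @ v \<Longrightarrow> s = t \<and> u = v"
proof (induction s arbitrary: t u v)
  case (Num n)
  obtain m where t: "t = Num m"
    using Num.prems hd_serialize[of "Num n"] hd_serialize[of t]
    by (metis append_Cons list.inject sexp.exhaust sexp.distinct(1))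
  then show ?case using Num.prems by (auto dest: binary_append_inject)
next
  case (Lst xs)
  obtain ys where t: "t = Lst ys"
    using Lst.prems hd_serialize[of "Lst xs"] hd_serialize[of t] by (metis append_Cons list.inject)
  have "concat (map serialize xs) @ 5 # u = concat (map serialize ys) @ 5 # v \<Longrightarrow> xs = ys \<and> u = v"
    using Lst.IH
  proof (induction xs arbitrary: ys)
    case Nil
    then show ?case using hd_serialize[of "hd ys"] by (cases ys) auto
  next
    case (Cons x xs)
    show ?case
    proof (cases ys)
      case Nil
      then show ?thesis using Cons.prems hd_serialize[of x] by auto
    next
      case (Cons y zs)
      with Cons.prems(1) have "serialize x @ (concat (map serialize xs) @ 5 # u) =
          serialize y @ (concat (map serialize zs) @ 5 # v)"
        by simp
      from Cons.prems(2)[OF _ this]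
      have "x = y" and rest: "concat (map serialize xs) @ 5 # u = concat (map serialize zs) @ 5 # v"
        by simp_all
      moreover have "xs = zs \<and> u = v"
        by (rule Cons.IH[OF rest]) (rule Cons.prems(2), simp_all)
      ultimately show ?thesis using Cons by simp
    qed
  qed
  then show ?case using Lst.prems t by auto
qed

lemma inj_serialize: "inj serialize"
  using serialize_append_inject[of _ "[]" _ "[]"] by (auto intro: injI)

lemma inj_sexp_list: "inj f \<Longrightarrow> inj (sexp_list f)"
  unfolding sexp_list_def by (rule injI) (simp add: inj_def inj_map_eq_map)

lemma sexp_literal_inject: "sexp_literal l = sexp_literal l' \<longleftrightarrow> l = l'"
  by (cases l; cases l') auto

lemma inj_sexp_clause: "inj sexp_clause"
proof (rule injI)
  fix c c' assume *: "sexp_clause c = sexp_clause c'"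
  obtain k1 k2 k3 l1 l2 l3 where "c = (k1, k2, k3)" "c' = (l1, l2, l3)"
    by (metis prod.exhaust)
  then show "c = c'" using * by (simp only: sexp_clause.simps sexp_literal_inject sexp.inject list.inject)
qed

lemma inj_Num: "inj Num" by (rule injI) auto

lemma inj_enc_qbf: "inj enc_qbf"
  unfolding enc_qbf_def
  by (rule injI)
    (auto simp del: serialize.simps dest!: injD[OF inj_serialize]
      injD[OF inj_sexp_list[OF inj_sexp_clause]] injD[OF inj_sexp_list[OF inj_sexp_list[OF inj_Num]]])

lemma sexp_trm_inj: "sexp_trm s = sexp_trm t \<Longrightarrow> s = t"
proof (induction s arbitrary: t)
  case (App f ts)
  then obtain ts' where t: "t = App f ts'" and *: "map sexp_trm ts = map sexp_trm ts'"
    by (cases t) simp_all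
  from * App.IH have "ts = ts'" by (rule list.inj_map_strong[rotated])
  with t show ?case by simp
qed (case_tac t; simp)+

lemma inj_sexp_trm: "inj sexp_trm" by (rule injI) (rule sexp_trm_inj)

lemma inj_sexp_atom: "inj sexp_atom"
  by (rule injI) (auto elim!: sexp_atom.elims dest!: injD[OF inj_sexp_list[OF inj_sexp_trm]])

lemma inj_sexp_timed: "inj sexp_timed"
  by (rule injI) (auto dest: injD[OF inj_sexp_atom])

lemma inj_sexp_int: "inj sexp_int"
  by (rule injI) (auto simp: sexp_int_def split: if_splits)

lemma inj_sexp_constraint: "inj sexp_constraint"
  by (rule injI) (auto elim!: sexp_constraint.elims dest: injD[OF inj_sexp_int])

lemmas inj_lists = injD[OF inj_sexp_list[OF inj_sexp_timed]] injD[OF inj_sexp_list[OF inj_sexp_constraint]]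

lemma inj_sexp_rule: "inj sexp_rule"
  by (rule injI) (auto simp: sexp_rule_def dest!: inj_lists)

lemma inj_sexp_spec: "inj sexp_spec"
  unfolding sexp_spec_def by (rule inj_sexp_list, rule injI) (auto dest!: inj_lists)

lemma inj_enc_scenario: "inj enc_scenario"
  unfolding enc_scenario_def
  by (rule injI) (auto simp del: serialize.simps dest!: injD[OF inj_serialize] inj_lists
      injD[OF inj_sexp_spec] injD[OF inj_sexp_list[OF inj_sexp_rule]])

end

theory Submission
  imports Defs
begin

text \<open>
  A configuration holds, for every variable of an existential block, a token that system rules can
  trade for a value; for every variable of a universal block it holds both possible choices, and the
  \<open>i\<close>-th update rule picks one choice for all the variables of the \<open>i\<close>-th universal block at once, while
  advancing a phase counter. In phase \<open>i < n\<close> the goal is to have set the next existential block; in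
  phase \<open>n\<close> it is to have marked every clause as satisfied. So a resilient trace is a strategy
  of the existential player. A tick never helps: goals require the global time to equal
  the timestamp of the phase counter, so that the last configuration of a trace that reaches a goal is
  always open to an update, whatever \<open>a\<close> and \<open>b\<close> are.

  Variables and clauses are represented by themselves (a clause is a fact with six arguments), so no
  counters are needed to write the scenario down: it is the concatenation of the outputs of a bounded number
  of passes over the input, each of which a finite control performs when it may copy the number it is
  reading.
\<close>

section \<open>Two-tape transducers\<close>

text \<open>The signature is a parameter of the resilience problem, so a single one has to serve all
  formulas. Hence variables, truth values and phases are ground constants, which are in unlimited
  supply, and the bound 7 on the size of facts is one predicate plus the six arguments of a clause.
  The delicate point is the order of the choices, because an update may strike at every
  configuration of a trace and not only at the last one. Truth of the formula is extracted from
  updates at last configurations alone: there the goal of the phase has forced the existential block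
  to be written down before the universal block is chosen. Conversely, an early update gains the
  opponent nothing: the values of the block can be fixed before the trace begins, the tokens still
  pending survive the update, and they can be traded later for the very same values. On the side of
  the computation, the number of passes depends on \<open>n\<close> only and each pass takes linear
  time.\<close>

type_synonym 'q transducer = "'q \<Rightarrow> nat \<Rightarrow> 'q option \<times> move \<times> nat option"

fun emit :: "nat option \<Rightarrow> nat list" where
  "emit None = []"
| "emit (Some x) = [x]"

fun tstep :: "'q transducer \<Rightarrow> nat list \<Rightarrow> 'q option \<times> int \<times> nat list \<Rightarrow> 'q option \<times> int \<times> nat list" where
  "tstep \<delta> w (None, h, u) = (None, h, u)"
| "tstep \<delta> w (Some q, h, u) =
     (case \<delta> q (word_content w h) of (q', d, x) \<Rightarrow> (q', h + shift d, u @ emit x))"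

text \<open>The symbol read on the first tape is written back, so the input stays intact. The head
  of the second tape moves exactly when it writes and thus always stands just behind the
  output.\<close>

definition transducer_tm :: "nat \<Rightarrow> nat \<Rightarrow> ('q option \<Rightarrow> nat) \<Rightarrow> (nat \<Rightarrow> 'q) \<Rightarrow> 'q transducer \<Rightarrow> turing_machine" where
  "transducer_tm N m enc dec \<delta> = \<lparr>num_tapes = 2, num_symbols = N, num_states = m,
     trans = \<lambda>i xs. case \<delta> (dec i) (xs ! 0) of (q, d, x) \<Rightarrow>
       (enc q, [(xs ! 0, d), case x of None \<Rightarrow> (xs ! 1, Stay) | Some y \<Rightarrow> (y, MoveRight)])\<rparr>"

lemma word_content_snoc: "(word_content u)(int (length u) := y) = word_content (u @ [y])"
  by (rule ext) (auto simp: word_content_def nth_append)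

text \<open>The machine model prescribes 0 as the initial state, so an arbitrary numbering of
  \<open>Q\<close> is composed with a transposition.\<close>

lemma ex_enumeration:
  assumes "finite Q" "q\<^sub>0 \<in> Q"
  shows "\<exists>e. bij_betw e Q {..<card Q} \<and> e q\<^sub>0 = 0"
proof -
  obtain e where e: "bij_betw e Q {0..<card Q}"
    using ex_bij_betw_finite_nat[OF assms(1)] by blast
  have lt: "e q\<^sub>0 < card Q" using e assms(2) by (auto dest: bij_betwE)
  let ?t = "\<lambda>x. if x = e q\<^sub>0 then 0 else if x = 0 then e q\<^sub>0 else x"
  have "bij_betw ?t {..<card Q} {..<card Q}"
    by (rule bij_betw_byWitness[where f' = ?t]) (use lt in auto)
  then have "bij_betw (?t \<circ> e) Q {..<card Q}"
    using e by (auto intro: bij_betw_trans simp: lessThan_atLeast0)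
  then show ?thesis by (intro exI[of _ "?t \<circ> e"]) simp
qed

text \<open>A step-by-step simulation. The machine must have halted when inspected at step
  \<open>poly p (length (enc\<^sub>1 x))\<close>; since a halted configuration is a fixed point, an
  earlier halt is good enough.\<close>

lemma transducer_poly_time:
  fixes \<delta> :: "'q transducer" and p :: "nat poly"
  assumes fin: "finite Q" and q0: "q\<^sub>0 \<in> Q"
    and closed: "\<And>q x q' d y. q \<in> Q \<Longrightarrow> x < N \<Longrightarrow> \<delta> q x = (q', d, y) \<Longrightarrow>
        set_option q' \<subseteq> Q \<and> set_option y \<subseteq> {..<N}"
    and run: "\<And>x. x \<in> D \<Longrightarrow> set (enc\<^sub>1 x) \<subseteq> {0<..<N} \<and>
        (\<exists>t \<le> poly p (length (enc\<^sub>1 x)). \<exists>h.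
           (tstep \<delta> (enc\<^sub>1 x) ^^ t) (Some q\<^sub>0, 0, []) = (None, h, enc\<^sub>2 (f x)))"
    and N: "N > 0"
  shows "poly_time_computable enc\<^sub>1 enc\<^sub>2 D f"
proof -
  obtain e where e: "bij_betw e Q {..<card Q}" and e0: "e q\<^sub>0 = 0"
    using ex_enumeration[OF fin q0] by blast
  define enc where "enc = case_option (card Q) e"
  define dec where "dec = inv_into Q e"
  define M where "M = transducer_tm N (card Q) enc dec \<delta>"
  have dec_e: "dec (e q) = q" if "q \<in> Q" for q
    using e that by (simp add: dec_def bij_betw_inv_into_left)
  have dec_Q: "dec i \<in> Q" if "i < card Q" for i
    using bij_betw_inv_into[OF e] that unfolding dec_def by (auto dest: bij_betwE)
  have e_lt: "e q < card Q" if "q \<in> Q" for q using e that by (auto dest: bij_betwE)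
  have wf: "wf_tm M"
    unfolding wf_tm_def
  proof (intro conjI allI impI)
    show "1 \<le> num_tapes M" by (simp add: M_def transducer_tm_def)
    fix i xs
    assume *: "i < num_states M \<and> length xs = num_tapes M \<and> set xs \<subseteq> {..<num_symbols M}"
    then have i: "dec i \<in> Q" and len: "length xs = 2" and xs: "set xs \<subseteq> {..<N}"
      using dec_Q by (simp_all add: M_def transducer_tm_def)
    have x0: "xs ! 0 < N" and x1: "xs ! 1 < N" using len xs by (auto simp: subset_iff)
    obtain q' d y where eq: "\<delta> (dec i) (xs ! 0) = (q', d, y)" by (metis prod_cases3)
    from closed[OF i x0 eq] have cl: "set_option q' \<subseteq> Q" "set_option y \<subseteq> {..<N}" by auto
    show "fst (trans M i xs) \<le> num_states M"
      using cl e_lt by (cases q') (auto simp: M_def transducer_tm_def eq enc_def less_imp_le)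
    show "length (snd (trans M i xs)) = num_tapes M"
      by (simp add: M_def transducer_tm_def eq)
    show "fst ` set (snd (trans M i xs)) \<subseteq> {..<num_symbols M}"
      using cl x0 x1 by (cases y) (auto simp: M_def transducer_tm_def eq)
  qed
  \<comment> \<open>The simulation relation as a function: halting becomes the state
    \<open>card Q\<close>, and the position of the output head is the length of the output.\<close>
  define \<Phi> where "\<Phi> w = (\<lambda>(q, h, u). (enc q, [(word_content w, h), (word_content u, int (length u))]))" for w
  have step: "tm_step M (\<Phi> w c) = \<Phi> w (tstep \<delta> w c) \<and> set_option (fst (tstep \<delta> w c)) \<subseteq> Q"
    if w: "set w \<subseteq> {0<..<N}" and c: "set_option (fst c) \<subseteq> Q" for w c
  proof -
    obtain q h u where c_eq: "c = (q, h, u)" by (metis prod_cases3)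
    show ?thesis
    proof (cases q)
      case None
      then show ?thesis by (simp add: c_eq \<Phi>_def enc_def M_def transducer_tm_def)
    next
      case (Some q1)
      with c c_eq have q1: "q1 \<in> Q" by simp
      have sym: "word_content w h < N"
      proof (cases "0 \<le> h \<and> h < int (length w)")
        case True
        then have "w ! nat h \<in> set w" by (intro nth_mem) linarith
        with w True show ?thesis by (auto simp: word_content_def subset_iff)
      qed (use N in \<open>auto simp: word_content_def\<close>)
      obtain q' d y where eq: "\<delta> q1 (word_content w h) = (q', d, y)" by (metis prod_cases3)
      have cl: "set_option q' \<subseteq> Q" using closed[OF q1 sym eq] by simp
      show ?thesis using cl e_lt[OF q1] dec_e[OF q1]
        by (cases y) (simp_all add: c_eq Some \<Phi>_def enc_def M_def transducer_tm_def eq word_content_snoc)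
    qed
  qed
  have sim: "(tm_step M ^^ t) (\<Phi> w c) = \<Phi> w ((tstep \<delta> w ^^ t) c) \<and>
      set_option (fst ((tstep \<delta> w ^^ t) c)) \<subseteq> Q"
    if "set w \<subseteq> {0<..<N}" "set_option (fst c) \<subseteq> Q" for w c t
    by (induction t) (use that step in simp_all)
  have init: "tm_init M w = \<Phi> w (Some q\<^sub>0, 0, [])" for w
    by (simp add: tm_init_def \<Phi>_def enc_def e0 M_def transducer_tm_def numeral_2_eq_2 word_content_def fun_eq_iff)
  have "set (enc\<^sub>1 x) \<subseteq> {0<..<num_symbols M} \<and>
      tm_computes_within M (enc\<^sub>1 x) (enc\<^sub>2 (f x)) (poly p (length (enc\<^sub>1 x)))" if x: "x \<in> D" for x
  proof -
    let ?w = "enc\<^sub>1 x" and ?T = "poly p (length (enc\<^sub>1 x))"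
    from run[OF x] obtain t h where w: "set ?w \<subseteq> {0<..<N}" and t: "t \<le> ?T"
      and th: "(tstep \<delta> ?w ^^ t) (Some q\<^sub>0, 0, []) = (None, h, enc\<^sub>2 (f x))" by blast
    have halt: "(tstep \<delta> ?w ^^ s) (None, h, enc\<^sub>2 (f x)) = (None, h, enc\<^sub>2 (f x))" for s
      by (induction s) simp_all
    have "(tstep \<delta> ?w ^^ ((?T - t) + t)) (Some q\<^sub>0, 0, []) = (None, h, enc\<^sub>2 (f x))"
      unfolding funpow_add by (simp add: th halt)
    with t have "(tstep \<delta> ?w ^^ ?T) (Some q\<^sub>0, 0, []) = (None, h, enc\<^sub>2 (f x))" by simp
    with sim[OF w, of "(Some q\<^sub>0, 0, [])" ?T] q0
    have "(tm_step M ^^ ?T) (tm_init M ?w) = \<Phi> ?w (None, h, enc\<^sub>2 (f x))"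
      by (simp add: init)
    with w show ?thesis
      by (simp add: tm_computes_within_def \<Phi>_def enc_def M_def transducer_tm_def)
  qed
  then show ?thesis unfolding poly_time_computable_def using wf by blast
qed

section \<open>Multi-pass rewriting of an encoded formula\<close>

text \<open>An upper bound instead of an exact number of steps, so that costs can be rounded up when
  runs are composed.\<close>

definition reaches :: "('c \<Rightarrow> 'c) \<Rightarrow> nat \<Rightarrow> 'c \<Rightarrow> 'c \<Rightarrow> bool" where
  "reaches s T c c' \<longleftrightarrow> (\<exists>t\<le>T. (s ^^ t) c = c')"

lemma reaches_trans: "reaches s T c c' \<Longrightarrow> reaches s T' c' c'' \<Longrightarrow> reaches s (T + T') c c''"
proof -
  assume "reaches s T c c'" "reaches s T' c' c''"
  then obtain t t' where "t \<le> T" "t' \<le> T'" "(s ^^ t) c = c'" "(s ^^ t') c' = c''"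
    by (auto simp: reaches_def)
  then have "(s ^^ (t' + t)) c = c''" "t' + t \<le> T + T'" by (simp_all add: funpow_add)
  then show ?thesis unfolding reaches_def by blast
qed

lemma reaches_mono: "reaches s T c c' \<Longrightarrow> T \<le> T' \<Longrightarrow> reaches s T' c c'"
  unfolding reaches_def using le_trans by blast

lemma reaches_refl: "reaches s T c c"
  unfolding reaches_def by (rule exI[of _ 0]) simp

lemma reaches_step: "s c = c' \<Longrightarrow> reaches s T c' c'' \<Longrightarrow> reaches s (Suc T) c c''"
  using reaches_trans[of s 1 c c' T c''] unfolding reaches_def
  by (metis Suc_le_mono funpow_Suc_right o_apply)

text \<open>\<open>Copy\<close> stands for the digits of the number that is being read.\<close>

datatype item = Sym nat | Copy

fun expand :: "nat list \<Rightarrow> item list \<Rightarrow> nat list" where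
  "expand bs [] = []"
| "expand bs (Sym x # r) = x # expand bs r"
| "expand bs (Copy # r) = bs @ expand bs r"

lemma expand_append: "expand bs (r @ r') = expand bs r @ expand bs r'"
  by (induction bs r rule: expand.induct) simp_all

lemma expand_Sym: "expand bs (map Sym xs) = xs"
  by (induction xs) simp_all

text \<open>A template saying what to print at each event of one scan of the formula.
  \<open>on_var\<close> receives the index of the quantifier block; \<open>on_arg\<close> serves the
  sign and the variable of a literal alike.\<close>

record pass =
  pass_begin :: "nat list"
  on_var :: "nat \<Rightarrow> item list"
  clause_begin :: "nat list"
  on_arg :: "item list"
  clause_end :: "nat list"
  pass_end :: "nat list"

text \<open>The order in which the encoding of a clause lists its numbers: signs at even positions,
  variables at odd ones. The same six numbers become the arguments of a clause fact.\<close>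

definition clause_nums :: "clause \<Rightarrow> nat list" where
  "clause_nums = (\<lambda>((s1, v1), (s2, v2), (s3, v3)). [of_bool s1, v1, of_bool s2, v2, of_bool s3, v3])"

fun blocks_out :: "pass \<Rightarrow> nat \<Rightarrow> nat list list \<Rightarrow> nat list" where
  "blocks_out P j [] = []"
| "blocks_out P j (vs # bs) =
     concat (map (\<lambda>v. expand (binary v) (on_var P j)) vs) @ blocks_out P (Suc j) bs"

definition clause_out :: "pass \<Rightarrow> clause \<Rightarrow> nat list" where
  "clause_out P c =
     clause_begin P @ concat (map (\<lambda>x. expand (binary x) (on_arg P)) (clause_nums c)) @ clause_end P"

definition pass_out :: "pass \<Rightarrow> qbf \<Rightarrow> nat list" where
  "pass_out P \<phi> = pass_begin P @ blocks_out P 0 (blocks \<phi>) @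
     concat (map (clause_out P) (matrix \<phi>)) @ pass_end P"

text \<open>
  The control keeps the number \<open>p\<close> of the pass, the bracket depth \<open>d\<close> and the number \<open>j\<close> of
  quantifier blocks read so far. As the number \<open>k\<close> of blocks is fixed, \<open>j = k\<close> tells the matrix from
  the prefix. The numbers of the prefix are at depth 3 and those of the matrix at depth 4.
\<close>

datatype ctrl =
  Read nat nat nat
| Exec nat nat nat "item list"
| Back nat nat nat "item list"
| Rewind nat

locale pass_machine =
  fixes ps :: "pass list" and k :: nat
begin

definition open_items :: "nat \<Rightarrow> nat \<Rightarrow> nat \<Rightarrow> item list" where
  "open_items p d j = (if d = 0 then map Sym (pass_begin (ps ! p))
     else if d = 2 \<and> j = k then map Sym (clause_begin (ps ! p)) else [])"

definition close_items :: "nat \<Rightarrow> nat \<Rightarrow> nat \<Rightarrow> item list" where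
  "close_items p d j = (if d = 1 then map Sym (pass_end (ps ! p))
     else if d = 3 \<and> j = k then map Sym (clause_end (ps ! p)) else [])"

definition num_items :: "nat \<Rightarrow> nat \<Rightarrow> nat \<Rightarrow> item list" where
  "num_items p d j = (if d = 3 then on_var (ps ! p) j else if d = 4 then on_arg (ps ! p) else [])"

text \<open>The cap \<open>min 5\<close> only keeps the control finite; encoded formulas have depth
  at most 4. A program is executed with the head at the first symbol of the token:
  \<open>Copy\<close> sweeps over the digits and \<open>Back\<close> returns. Once the program is
  empty, \<open>Exec\<close> skips the token. The blank behind the input triggers the rewind, and
  the blank before it starts the next pass or halts.\<close>

fun ctrl_step :: "ctrl transducer" where
  "ctrl_step (Read p d j) x =
     (if x = 0 then (Some (Rewind p), MoveLeft, None)
      else if x = 4 then (Some (Exec p (min 5 (Suc d)) j (open_items p d j)), Stay, None)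
      else if x = 5 then
        (Some (Exec p (d - 1) (if d = 3 \<and> j < k then Suc j else j) (close_items p d j)), Stay, None)
      else (Some (Exec p d j (num_items p d j)), Stay, None))"
| "ctrl_step (Exec p d j []) x =
     (Some (if x = 1 \<or> x = 2 then Exec p d j [] else Read p d j), MoveRight, None)"
| "ctrl_step (Exec p d j (Sym s # r)) x = (Some (Exec p d j r), Stay, Some s)"
| "ctrl_step (Exec p d j (Copy # r)) x =
     (if x = 1 \<or> x = 2 then (Some (Exec p d j (Copy # r)), MoveRight, Some x)
      else (Some (Back p d j r), MoveLeft, None))"
| "ctrl_step (Back p d j r) x =
     (if x = 1 \<or> x = 2 then (Some (Back p d j r), MoveLeft, None)
      else (Some (Exec p d j r), MoveRight, None))"
| "ctrl_step (Rewind p) x =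
     (if x \<noteq> 0 then (Some (Rewind p), MoveLeft, None)
      else (if Suc p < length ps then Some (Read (Suc p) 0 0) else None, MoveRight, None))"

definition items :: "item list set" where
  "items = (\<Union>p\<in>{..<length ps}. \<Union>d\<in>{..5}. \<Union>j\<in>{..k}.
     {open_items p d j, close_items p d j, num_items p d j})"

definition bound :: nat where
  "bound = Max (length ` items)"

definition digits :: "nat list \<Rightarrow> bool" where
  "digits bs \<longleftrightarrow> set bs \<subseteq> {1, 2}"

text \<open>What \<open>Back\<close> needs in order to stop at the first digit of the current
  number: the symbol before it is no digit. For an empty prefix that symbol is the blank to the left
  of the input.\<close>

definition separated :: "nat list \<Rightarrow> bool" where
  "separated u \<longleftrightarrow> u = [] \<or> last u \<in> {3, 4, 5}"

abbreviation run :: "nat list \<Rightarrow> nat \<Rightarrow> ctrl option \<times> int \<times> nat list \<Rightarrow> ctrl option \<times> int \<times> nat list \<Rightarrow> bool" where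
  "run w \<equiv> reaches (tstep ctrl_step w)"

lemma word_content_append: "word_content (u @ x # v) (int (length u)) = x"
  by (simp add: word_content_def)

lemma finite_items: "finite items"
  by (simp add: items_def)

lemma length_items:
  assumes "p < length ps" "d \<le> 5" "j \<le> k"
  shows "length (open_items p d j) \<le> bound" "length (close_items p d j) \<le> bound"
    "length (num_items p d j) \<le> bound"
  unfolding bound_def using assms finite_items by (auto intro!: Max_ge simp: items_def)

section \<open>Executing programs on a single input token\<close>

lemma run_syms: "run w (length s) (Some (Exec p d j (map Sym s)), h, out) (Some (Exec p d j []), h, out @ s)"
proof (induction s arbitrary: out)
  case (Cons x s)
  have "run w (Suc (length s)) (Some (Exec p d j (map Sym (x # s))), h, out)
    (Some (Exec p d j []), h, (out @ [x]) @ s)"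
    by (rule reaches_step[OF _ Cons.IH]) simp
  then show ?case by simp
qed (simp add: reaches_refl)

lemma run_digits:
  assumes "digits bs" "w = u @ bs @ v"
  shows "run w (length bs) (Some (Exec p d j (Copy # r)), int (length u), out)
    (Some (Exec p d j (Copy # r)), int (length (u @ bs)), out @ bs)"
  using assms
proof (induction bs arbitrary: u out)
  case (Cons b bs)
  have "run w (length bs) (Some (Exec p d j (Copy # r)), int (length (u @ [b])), out @ [b])
    (Some (Exec p d j (Copy # r)), int (length ((u @ [b]) @ bs)), (out @ [b]) @ bs)"
    by (rule Cons.IH) (use Cons.prems in \<open>auto simp: digits_def\<close>)
  then have "run w (Suc (length bs)) (Some (Exec p d j (Copy # r)), int (length u), out)
    (Some (Exec p d j (Copy # r)), int (length ((u @ [b]) @ bs)), (out @ [b]) @ bs)"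
    by (rule reaches_step[rotated])
      (use Cons.prems in \<open>auto simp: digits_def word_content_append\<close>)
  then show ?case by simp
qed (simp add: reaches_refl)

text \<open>The head starts on the last digit, or on the symbol before the number if there are no
  digits, as for 0. Reverse induction follows its way to the left.\<close>

lemma run_back:
  assumes "digits bs" "separated u" "w = u @ bs @ x # v"
  shows "run w (Suc (length bs)) (Some (Back p d j r), int (length (u @ bs)) - 1, out)
    (Some (Exec p d j r), int (length u), out)"
  using assms
proof (induction bs arbitrary: x v rule: rev_induct)
  case Nil
  have "word_content w (int (length u) - 1) \<notin> {1, 2}"
  proof (cases u rule: rev_cases)
    case (snoc u' y)
    then show ?thesis using Nil word_content_append[of u' y "x # v"] by (auto simp: separated_def)
  qed (simp add: word_content_def)
  then show ?case
    by (intro reaches_step[OF _ reaches_refl]) (auto split: if_splits)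
next
  case (snoc b bs)
  have "run w (Suc (length bs)) (Some (Back p d j r), int (length (u @ bs)) - 1, out)
    (Some (Exec p d j r), int (length u), out)"
    by (rule snoc.IH[of b "x # v"]) (use snoc.prems in \<open>auto simp: digits_def\<close>)
  then have "run w (Suc (Suc (length bs))) (Some (Back p d j r), int (length (u @ bs)), out)
    (Some (Exec p d j r), int (length u), out)"
    by (rule reaches_step[rotated])
      (use snoc.prems word_content_append[of "u @ bs" b "x # v"] in \<open>auto simp: digits_def\<close>)
  then show ?case by simp
qed

text \<open>Each \<open>Copy\<close> costs one sweep to the right and one back, hence the factor 2.
  The head returns to its starting point, so every item finds the same digits.\<close>

lemma run_items:
  assumes "digits bs" "separated u" "w = u @ bs @ 3 # v"
  shows "run w ((2 * length bs + 3) * length r) (Some (Exec p d j r), int (length u), out)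
    (Some (Exec p d j []), int (length u), out @ expand bs r)"
proof (induction r arbitrary: out)
  case (Cons i r)
  let ?T = "(2 * length bs + 3) * length r"
  show ?case
  proof (cases i)
    case (Sym s)
    have "run w (Suc ?T) (Some (Exec p d j (i # r)), int (length u), out)
      (Some (Exec p d j []), int (length u), (out @ [s]) @ expand bs r)"
      by (rule reaches_step[OF _ Cons.IH]) (simp add: Sym)
    then have "run w ((2 * length bs + 3) * length (i # r)) (Some (Exec p d j (i # r)), int (length u), out)
      (Some (Exec p d j []), int (length u), (out @ [s]) @ expand bs r)"
      by (rule reaches_mono) simp
    then show ?thesis by (simp add: Sym)
  next
    case Copy
    have 1: "run w (length bs) (Some (Exec p d j (Copy # r)), int (length u), out)
      (Some (Exec p d j (Copy # r)), int (length (u @ bs)), out @ bs)"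
      by (rule run_digits) (use assms in auto)
    have 2: "run w (Suc (Suc (length bs))) (Some (Exec p d j (Copy # r)), int (length (u @ bs)), out @ bs)
      (Some (Exec p d j r), int (length u), out @ bs)"
      by (rule reaches_step[OF _ run_back[OF assms]])
        (use assms word_content_append[of "u @ bs" 3 v] in auto)
    have "run w ((2 * length bs + 3) * length (i # r)) (Some (Exec p d j (Copy # r)), int (length u), out)
      (Some (Exec p d j []), int (length u), (out @ bs) @ expand bs r)"
      by (rule reaches_mono[OF reaches_trans[OF reaches_trans[OF 1 2] Cons.IH]]) simp
    then show ?thesis by (simp add: Copy)
  qed
qed (simp add: reaches_refl)

lemma run_skip:
  assumes "digits bs" "w = u @ bs @ x # v" "x \<notin> {1, 2}"
  shows "run w (Suc (length bs)) (Some (Exec p d j []), int (length u), out)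
    (Some (Read p d j), int (length (u @ bs @ [x])), out)"
  using assms
proof (induction bs arbitrary: u)
  case Nil
  then show ?case
    by (intro reaches_step[OF _ reaches_refl]) (auto simp: word_content_append)
next
  case (Cons b bs)
  have "run w (Suc (length bs)) (Some (Exec p d j []), int (length (u @ [b])), out)
    (Some (Read p d j), int (length ((u @ [b]) @ bs @ [x])), out)"
    by (rule Cons.IH) (use Cons.prems in \<open>auto simp: digits_def\<close>)
  then have "run w (Suc (Suc (length bs))) (Some (Exec p d j []), int (length u), out)
    (Some (Read p d j), int (length ((u @ [b]) @ bs @ [x])), out)"
    by (rule reaches_step[rotated])
      (use Cons.prems in \<open>auto simp: digits_def word_content_append\<close>)
  then show ?case by simp
qed

section \<open>Compositional description of a scan of the input\<close>

definition cost :: nat where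
  "cost = 3 * bound + 2"

text \<open>A Hoare-style triple for a segment \<open>s\<close> of the input, valid in every context
  whose left part is separated. As \<open>s\<close> itself is separated and the time bound is linear
  in its length, triples for adjacent segments compose and their bounds add up.\<close>

definition reads :: "nat \<Rightarrow> nat \<times> nat \<Rightarrow> nat list \<Rightarrow> nat \<times> nat \<Rightarrow> nat list \<Rightarrow> bool" where
  "reads p = (\<lambda>(d, j) s (d', j') o'. separated s \<and>
     (\<forall>u v out. separated u \<longrightarrow>
        run (u @ s @ v) (cost * length s) (Some (Read p d j), int (length u), out)
          (Some (Read p d' j'), int (length (u @ s)), out @ o')))"

lemma readsI:
  assumes "separated s"
    and "\<And>u v out. separated u \<Longrightarrow> run (u @ s @ v) (cost * length s)
      (Some (Read p d j), int (length u), out) (Some (Read p d' j'), int (length (u @ s)), out @ o')"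
  shows "reads p (d, j) s (d', j') o'"
  using assms by (simp add: reads_def)

lemma readsD:
  assumes "reads p (d, j) s (d', j') o'" "separated u"
  shows "run (u @ s @ v) (cost * length s)
      (Some (Read p d j), int (length u), out) (Some (Read p d' j'), int (length (u @ s)), out @ o')"
  using assms by (simp add: reads_def)

lemma separated_Nil: "separated []"
  by (simp add: separated_def)

lemma separated_append: "separated u \<Longrightarrow> separated s \<Longrightarrow> separated (u @ s)"
  by (auto simp: separated_def last_append)

lemma reads_Nil: "reads p c [] c []"
proof -
  obtain d j where "c = (d, j)" by (metis surj_pair)
  then show ?thesis by (auto intro!: readsI simp: reaches_refl separated_Nil)
qed

lemma reads_append:
  assumes "reads p c s c' o1" "reads p c' s' c'' o2"
  shows "reads p c (s @ s') c'' (o1 @ o2)"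
proof -
  obtain d j d' j' d'' j'' where c: "c = (d, j)" "c' = (d', j')" "c'' = (d'', j'')"
    by (metis surj_pair)
  have sep: "separated s" "separated s'" using assms by (auto simp: reads_def c)
  have "run (u @ (s @ s') @ v) (cost * length (s @ s')) (Some (Read p d j), int (length u), out)
      (Some (Read p d'' j''), int (length (u @ (s @ s'))), out @ (o1 @ o2))" if "separated u" for u v out
  proof -
    have "run (u @ s @ (s' @ v)) (cost * length s) (Some (Read p d j), int (length u), out)
        (Some (Read p d' j'), int (length (u @ s)), out @ o1)"
      by (rule readsD[OF assms(1)[unfolded c] that])
    moreover have "run ((u @ s) @ s' @ v) (cost * length s') (Some (Read p d' j'), int (length (u @ s)), out @ o1)
        (Some (Read p d'' j''), int (length ((u @ s) @ s')), (out @ o1) @ o2)"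
      by (rule readsD[OF assms(2)[unfolded c] separated_append[OF that sep(1)]])
    ultimately show ?thesis
      by (simp only: append_assoc) (drule (1) reaches_trans, simp add: algebra_simps)
  qed
  then show ?thesis unfolding c by (intro readsI separated_append sep)
qed

lemma reads_concat:
  assumes "\<And>x. x \<in> set xs \<Longrightarrow> reads p c (f x) c (g x)"
  shows "reads p c (concat (map f xs)) c (concat (map g xs))"
  using assms by (induction xs) (auto intro: reads_Nil reads_append)

lemma reads_bracket:
  assumes "p < length ps" "d \<le> 5" "j \<le> k" "x = 4 \<or> x = 5"
    and step: "ctrl_step (Read p d j) x = (Some (Exec p d' j' (map Sym s)), Stay, None)"
    and s: "length s \<le> bound"
  shows "reads p (d, j) [x] (d', j') s"
proof -
  have "run (u @ [x] @ v) (cost * length [x]) (Some (Read p d j), int (length u), out)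
    (Some (Read p d' j'), int (length (u @ [x])), out @ s)" for u v out
  proof -
    let ?w = "u @ [x] @ v"
    have 1: "run ?w (Suc (length s)) (Some (Read p d j), int (length u), out)
        (Some (Exec p d' j' []), int (length u), out @ s)"
      by (rule reaches_step[OF _ run_syms]) (use step in \<open>simp add: word_content_append\<close>)
    have 2: "run ?w (Suc (length ([]::nat list))) (Some (Exec p d' j' []), int (length u), out @ s)
        (Some (Read p d' j'), int (length (u @ [] @ [x])), out @ s)"
      by (rule run_skip) (use assms(4) in \<open>auto simp: digits_def\<close>)
    show ?thesis
      by (rule reaches_mono[OF reaches_trans[OF 1 2[simplified append_Nil]]]) (use s in \<open>simp add: cost_def\<close>)
  qed
  then show ?thesis by (intro readsI) (use assms(4) in \<open>auto simp: separated_def\<close>)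
qed

lemma reads_open:
  assumes "p < length ps" "d < 5" "j \<le> k" "open_items p d j = map Sym s"
  shows "reads p (d, j) [4] (Suc d, j) s"
  by (rule reads_bracket) (use assms length_items(1)[of p d j] in auto)

text \<open>Here \<open>d\<close> is the depth after the bracket, so \<open>d = 2\<close> is the
  test \<open>d = 3\<close> of the control. The block counter advances at the end of a block and
  stands still in the matrix, where the same bracket ends a clause.\<close>

lemma reads_close:
  assumes "p < length ps" "d < 5" "j \<le> k" "close_items p (Suc d) j = map Sym s"
  shows "reads p (Suc d, j) [5] (d, if d = 2 \<and> j < k then Suc j else j) s"
  by (rule reads_bracket) (use assms length_items(2)[of p "Suc d" j] in auto)

lemma digits_binary: "digits (binary x)"
  using set_binary by (simp add: digits_def)

lemma reads_num:
  assumes "p < length ps" "d \<le> 5" "j \<le> k"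
  shows "reads p (d, j) (binary x @ [3]) (d, j) (expand (binary x) (num_items p d j))"
proof -
  let ?bs = "binary x" and ?r = "num_items p d j"
  have "run (u @ (?bs @ [3]) @ v) (cost * length (?bs @ [3])) (Some (Read p d j), int (length u), out)
    (Some (Read p d j), int (length (u @ (?bs @ [3]))), out @ expand ?bs ?r)" if u: "separated u" for u v out
  proof -
    let ?w = "u @ ?bs @ 3 # v"
    have start: "word_content ?w (int (length u)) \<in> {1, 2, 3}"
    proof (cases ?bs)
      case Nil
      then show ?thesis using word_content_append[of u 3 v] by simp
    next
      case (Cons b bs)
      then show ?thesis using word_content_append[of u b "bs @ 3 # v"] digits_binary[of x] by (auto simp: digits_def)
    qed
    have 1: "run ?w (Suc ((2 * length ?bs + 3) * length ?r)) (Some (Read p d j), int (length u), out)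
        (Some (Exec p d j []), int (length u), out @ expand ?bs ?r)"
      by (rule reaches_step[OF _ run_items[OF digits_binary u]]) (use start in auto)
    have 2: "run ?w (Suc (length ?bs)) (Some (Exec p d j []), int (length u), out @ expand ?bs ?r)
        (Some (Read p d j), int (length (u @ ?bs @ [3])), out @ expand ?bs ?r)"
      by (rule run_skip[OF digits_binary]) auto
    \<comment> \<open>The origin of \<open>cost\<close>: with \<open>l\<close> digits,
      \<open>2 * l + 3 \<le> 3 * (l + 1)\<close> pays for the items and
      \<open>l + 2 \<le> 2 * (l + 1)\<close> for the remaining steps.\<close>
    have "(2 * length ?bs + 3) * length ?r \<le> (3 * length ?bs + 3) * bound"
      using length_items(3)[OF assms] by (intro mult_mono) auto
    then have "Suc ((2 * length ?bs + 3) * length ?r) + Suc (length ?bs) \<le> cost * length (?bs @ [3])"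
      by (simp add: cost_def algebra_simps)
    from reaches_mono[OF reaches_trans[OF 1 2] this] show ?thesis by simp
  qed
  then show ?thesis by (intro readsI) (simp_all add: separated_def)
qed

lemma reads_block:
  assumes "p < length ps" "j < k"
  shows "reads p (2, j) (serialize (sexp_list Num vs)) (2, Suc j)
    (concat (map (\<lambda>v. expand (binary v) (on_var (ps ! p) j)) vs))"
proof -
  have 1: "reads p (2, j) [4] (3, j) []"
    using reads_open[of p 2 j "[]"] assms by (simp add: open_items_def)
  have 2: "reads p (3, j) (concat (map (\<lambda>v. binary v @ [3]) vs)) (3, j)
      (concat (map (\<lambda>v. expand (binary v) (on_var (ps ! p) j)) vs))"
    by (rule reads_concat) (use assms reads_num[of p 3 j] in \<open>simp add: num_items_def\<close>)
  have 3: "reads p (3, j) [5] (2, Suc j) []"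
    using reads_close[of p 2 j "[]"] assms by (simp add: close_items_def)
  from reads_append[OF 1 reads_append[OF 2 3]] show ?thesis
    by (simp add: sexp_list_def comp_def)
qed

lemma reads_blocks:
  assumes "p < length ps" "j + length bs = k"
  shows "reads p (2, j) (concat (map (\<lambda>b. serialize (sexp_list Num b)) bs)) (2, k) (blocks_out (ps ! p) j bs)"
  using assms
proof (induction bs arbitrary: j)
  case (Cons b bs)
  then show ?case using reads_append[OF reads_block Cons.IH[of "Suc j"]] by simp
qed (simp add: reads_Nil)

lemma reads_literal:
  assumes "p < length ps"
  shows "reads p (3, k) (serialize (sexp_literal (s, v))) (3, k)
    (expand (binary (of_bool s)) (on_arg (ps ! p)) @ expand (binary v) (on_arg (ps ! p)))"
proof -
  have 1: "reads p (3, k) [4] (4, k) []"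
    using reads_open[of p 3 k "[]"] assms by (simp add: open_items_def)
  have 2: "reads p (4, k) (binary x @ [3]) (4, k) (expand (binary x) (on_arg (ps ! p)))" for x
    using reads_num[of p 4 k x] assms by (simp add: num_items_def)
  have 3: "reads p (4, k) [5] (3, k) []"
    using reads_close[of p 3 k "[]"] assms by (simp add: close_items_def)
  have "of_bool s = (if s then 1 else 0 :: nat)" by simp
  with reads_append[OF 1 reads_append[OF 2[of "of_bool s"] reads_append[OF 2[of v] 3]]] show ?thesis
    by (cases s) simp_all
qed

lemma reads_clause:
  assumes "p < length ps"
  shows "reads p (2, k) (serialize (sexp_clause c)) (2, k) (clause_out (ps ! p) c)"
proof -
  obtain s1 v1 s2 v2 s3 v3 where c: "c = ((s1, v1), (s2, v2), (s3, v3))"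
    by (metis prod.exhaust)
  have 1: "reads p (2, k) [4] (3, k) (clause_begin (ps ! p))"
    using reads_open[of p 2 k "clause_begin (ps ! p)"] assms by (simp add: open_items_def)
  have 2: "reads p (3, k) [5] (2, k) (clause_end (ps ! p))"
    using reads_close[of p 2 k "clause_end (ps ! p)"] assms by (simp add: close_items_def)
  show ?thesis
    using reads_append[OF 1 reads_append[OF reads_literal[OF assms, of s1 v1]
        reads_append[OF reads_literal[OF assms, of s2 v2]
        reads_append[OF reads_literal[OF assms, of s3 v3] 2]]]]
    by (simp add: c clause_out_def clause_nums_def del: sexp_literal.simps)
qed

lemma reads_formula:
  assumes "p < length ps" "length (blocks \<phi>) = k" "k > 0"
  shows "reads p (0, 0) (enc_qbf \<phi>) (0, k) (pass_out (ps ! p) \<phi>)"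
proof -
  have 1: "reads p (0, 0) [4] (1, 0) (pass_begin (ps ! p))"
    using reads_open[of p 0 0 "pass_begin (ps ! p)"] assms by (simp add: open_items_def)
  have 2: "reads p (1, j) [4] (2, j) []" if "j \<le> k" for j
    using reads_open[of p 1 j "[]"] assms that by (simp add: open_items_def numeral_2_eq_2)
  have 3: "reads p (2, k) [5] (1, k) []"
    using reads_close[of p 1 k "[]"] assms by (simp add: close_items_def numeral_2_eq_2)
  have 4: "reads p (2, k) (concat (map (\<lambda>c. serialize (sexp_clause c)) (matrix \<phi>))) (2, k)
      (concat (map (clause_out (ps ! p)) (matrix \<phi>)))"
    by (rule reads_concat) (use assms reads_clause in auto)
  have 5: "reads p (1, k) [5] (0, k) (pass_end (ps ! p))"
    using reads_close[of p 0 k "pass_end (ps ! p)"] assms by (simp add: close_items_def)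
  have "0 + length (blocks \<phi>) = k" using assms by simp
  from reads_append[OF 1 reads_append[OF 2[of 0] reads_append[OF reads_blocks[OF assms(1) this]
        reads_append[OF 3 reads_append[OF 2[of k] reads_append[OF 4 reads_append[OF 3 5]]]]]]]
  show ?thesis
    by (simp add: enc_qbf_def pass_out_def sexp_list_def[of "sexp_list Num"] sexp_list_def[of sexp_clause] comp_def)
qed

text \<open>The head is at \<open>i - 1\<close>, so that \<open>i = 0\<close> means the blank at
  position -1, where the rewind ends. Blanks are the only end markers, hence the input must not
  contain 0.\<close>

lemma run_rewind:
  assumes "0 \<notin> set w" "i \<le> length w"
  shows "run w (Suc i) (Some (Rewind p), int i - 1, out)
    (if Suc p < length ps then Some (Read (Suc p) 0 0) else None, 0, out)"
  using assms(2)
proof (induction i)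
  case 0
  show ?case by (intro reaches_step[OF _ reaches_refl]) (simp add: word_content_def)
next
  case (Suc i)
  then have "word_content w (int i) \<in> set w" by (simp add: word_content_def)
  with assms(1) have "word_content w (int i) \<noteq> 0" by metis
  with Suc show ?case by (intro reaches_step[OF _ Suc.IH]) auto
qed

lemma run_pass:
  assumes "p < length ps" "length (blocks \<phi>) = k" "k > 0" and w: "0 \<notin> set (enc_qbf \<phi>)"
  shows "run (enc_qbf \<phi>) (Suc cost * length (enc_qbf \<phi>) + 2) (Some (Read p 0 0), 0, out)
    (if Suc p < length ps then Some (Read (Suc p) 0 0) else None, 0, out @ pass_out (ps ! p) \<phi>)"
proof -
  let ?w = "enc_qbf \<phi>"
  have 1: "run ?w (cost * length ?w) (Some (Read p 0 0), 0, out)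
      (Some (Read p 0 k), int (length ?w), out @ pass_out (ps ! p) \<phi>)"
    using readsD[OF reads_formula[OF assms(1-3)] separated_Nil, of "[]" out] by simp
  have 2: "run ?w (Suc (Suc (length ?w))) (Some (Read p 0 k), int (length ?w), out @ pass_out (ps ! p) \<phi>)
      (if Suc p < length ps then Some (Read (Suc p) 0 0) else None, 0, out @ pass_out (ps ! p) \<phi>)"
    by (rule reaches_step[OF _ run_rewind[OF w order_refl]]) (simp add: word_content_def)
  show ?thesis by (rule reaches_mono[OF reaches_trans[OF 1 2]]) simp
qed

lemma run_passes:
  assumes "length (blocks \<phi>) = k" "k > 0" "0 \<notin> set (enc_qbf \<phi>)" "p < length ps"
  shows "run (enc_qbf \<phi>) ((length ps - p) * (Suc cost * length (enc_qbf \<phi>) + 2)) (Some (Read p 0 0), 0, out)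
    (None, 0, out @ concat (map (\<lambda>P. pass_out P \<phi>) (drop p ps)))"
  using assms(4)
proof (induction "length ps - p" arbitrary: p out)
  case (Suc m)
  let ?T = "Suc cost * length (enc_qbf \<phi>) + 2"
  note pass = run_pass[OF Suc.prems assms(1-3), of out]
  have drop: "drop p ps = ps ! p # drop (Suc p) ps" using Suc.prems by (simp add: Cons_nth_drop_Suc)
  show ?case
  proof (cases "Suc p < length ps")
    case True
    have "run (enc_qbf \<phi>) ((length ps - Suc p) * ?T)
        (Some (Read (Suc p) 0 0), 0, out @ pass_out (ps ! p) \<phi>)
        (None, 0, (out @ pass_out (ps ! p) \<phi>) @ concat (map (\<lambda>P. pass_out P \<phi>) (drop (Suc p) ps)))"
      by (rule Suc.hyps) (use Suc.hyps(2) True in auto)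
    from reaches_trans[OF pass[unfolded if_P[OF True]] this]
    have "run (enc_qbf \<phi>) (?T + (length ps - Suc p) * ?T) (Some (Read p 0 0), 0, out)
        (None, 0, (out @ pass_out (ps ! p) \<phi>) @ concat (map (\<lambda>P. pass_out P \<phi>) (drop (Suc p) ps)))"
      .
    moreover have "?T + (length ps - Suc p) * ?T = (length ps - p) * ?T"
    proof -
      have "length ps - p = Suc (length ps - Suc p)" using True by simp
      then show ?thesis by simp
    qed
    ultimately show ?thesis by (simp add: drop)
  next
    case False
    with Suc.prems have eq: "Suc p = length ps" by simp
    then have "length ps - p = 1" by simp
    with pass eq show ?thesis by (simp add: drop)
  qed
qed simp

text \<open>The control stores the part of a program that is still to be executed. All lists up to
  the maximal length form a finite set that contains the item lists and is closed under
  tails.\<close>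

definition programs :: "item list set" where
  "programs = {r. set r \<subseteq> insert Copy (Sym ` {..<6}) \<and> length r \<le> bound}"

fun valid :: "ctrl \<Rightarrow> bool" where
  "valid (Read p d j) \<longleftrightarrow> p < length ps \<and> d \<le> 5 \<and> j \<le> k"
| "valid (Exec p d j r) \<longleftrightarrow> p < length ps \<and> d \<le> 5 \<and> j \<le> k \<and> r \<in> programs"
| "valid (Back p d j r) \<longleftrightarrow> p < length ps \<and> d \<le> 5 \<and> j \<le> k \<and> r \<in> programs"
| "valid (Rewind p) \<longleftrightarrow> p < length ps"

lemma finite_valid: "finite {q. valid q}"
proof -
  have "finite programs"
    unfolding programs_def by (rule finite_lists_length_le) simp
  moreover have "{q. valid q} \<subseteq>
      (\<lambda>(p, d, j). Read p d j) ` ({..<length ps} \<times> {..5} \<times> {..k}) \<union>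
      (\<lambda>(p, d, j, r). Exec p d j r) ` ({..<length ps} \<times> {..5} \<times> {..k} \<times> programs) \<union>
      (\<lambda>(p, d, j, r). Back p d j r) ` ({..<length ps} \<times> {..5} \<times> {..k} \<times> programs) \<union>
      Rewind ` {..<length ps}" (is "_ \<subseteq> ?S")
  proof
    fix q assume "q \<in> {q. valid q}"
    then show "q \<in> ?S" by (cases q) (auto simp: image_iff)
  qed
  ultimately show ?thesis by (auto elim: finite_subset)
qed

lemma ctrl_step_closed:
  assumes "\<And>r. r \<in> items \<Longrightarrow> set r \<subseteq> insert Copy (Sym ` {..<6})"
    and q: "valid q" and x: "x < 6" and step: "ctrl_step q x = (q', m, y)"
  shows "set_option q' \<subseteq> {q. valid q} \<and> set_option y \<subseteq> {..<6}"
proof -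
  have ok: "r \<in> programs" if "r \<in> items" for r
    unfolding bound_def programs_def using assms(1)[OF that] that finite_items by (auto intro: Max_ge)
  have it: "open_items p d j \<in> programs" "close_items p d j \<in> programs" "num_items p d j \<in> programs"
    if "p < length ps" "d \<le> 5" "j \<le> k" for p d j
    by (rule ok, use that in \<open>auto simp: items_def\<close>)+
  have tl: "r \<in> programs" if "i # r \<in> programs" for i r
    using that by (simp add: programs_def)
  have head: "s < 6" if "Sym s # r \<in> programs" for s r
    using that by (auto simp: programs_def)
  show ?thesis
  proof (cases q)
    case (Read p d j)
    then show ?thesis using q step it by (auto split: if_splits)
  next
    case (Exec p d j r)
    show ?thesis
    proof (cases r)
      case Nil
      then show ?thesis using Exec q step by (auto split: if_splits)
    next
      case (Cons i r')
      then show ?thesis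
        using Exec q step tl[of i r'] head[of _ r'] x by (cases i) (auto split: if_splits)
    qed
  next
    case (Back p d j r)
    then show ?thesis using q step by (auto split: if_splits)
  next
    case (Rewind p)
    then show ?thesis using q step by (auto split: if_splits)
  qed
qed

end

lemma set_serialize: "set (serialize s) \<subseteq> {0<..<6}"
proof (induction s)
  case (Num x)
  then show ?case using set_binary[of x] by auto
qed auto

text \<open>Each pass costs \<open>Suc cost\<close> per input symbol, one of these steps being for
  the rewind, plus 2. Neither \<open>cost\<close> nor the number of passes depends on the formula,
  so the polynomial is linear.\<close>

theorem passes_poly_time:
  assumes "ps \<noteq> []" "k > 0"
    and "\<And>r. r \<in> pass_machine.items ps k \<Longrightarrow> set r \<subseteq> insert Copy (Sym ` {..<6})"
    and "\<And>\<phi>. sigma_formula k \<phi> \<Longrightarrow> enc (f \<phi>) = concat (map (\<lambda>P. pass_out P \<phi>) ps)"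
  shows "poly_time_computable enc_qbf enc {\<phi>. sigma_formula k \<phi>} f"
proof (rule transducer_poly_time)
  interpret pass_machine ps k .
  let ?p = "[:length ps * 2, length ps * Suc cost:]"
  show "finite {q. valid q}" by (rule finite_valid)
  show "Read 0 0 0 \<in> {q. valid q}" using assms by simp
  show "set_option q' \<subseteq> {q. valid q} \<and> set_option y \<subseteq> {..<6}"
    if "q \<in> {q. valid q}" "x < 6" "ctrl_step q x = (q', d, y)" for q x q' d y
    using ctrl_step_closed[OF assms(3) _ that(2,3)] that(1) by blast
  show "set (enc_qbf \<phi>) \<subseteq> {0<..<6} \<and> (\<exists>t\<le>poly ?p (length (enc_qbf \<phi>)). \<exists>h.
      (tstep ctrl_step (enc_qbf \<phi>) ^^ t) (Some (Read 0 0 0), 0, []) = (None, h, enc (f \<phi>)))"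
    if \<phi>: "\<phi> \<in> {\<phi>. sigma_formula k \<phi>}" for \<phi>
  proof
    show w: "set (enc_qbf \<phi>) \<subseteq> {0<..<6}" unfolding enc_qbf_def by (rule set_serialize)
    have "run (enc_qbf \<phi>) ((length ps - 0) * (Suc cost * length (enc_qbf \<phi>) + 2)) (Some (Read 0 0 0), 0, [])
        (None, 0, [] @ concat (map (\<lambda>P. pass_out P \<phi>) (drop 0 ps)))"
      by (rule run_passes) (use \<phi> w assms in \<open>auto simp: sigma_formula_def\<close>)
    moreover have "(length ps - 0) * (Suc cost * length (enc_qbf \<phi>) + 2) = poly ?p (length (enc_qbf \<phi>))"
      by (simp add: algebra_simps)
    moreover have "enc (f \<phi>) = concat (map (\<lambda>P. pass_out P \<phi>) ps)" using assms(4) \<phi> by blast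
    ultimately show "\<exists>t\<le>poly ?p (length (enc_qbf \<phi>)). \<exists>h.
        (tstep ctrl_step (enc_qbf \<phi>) ^^ t) (Some (Read 0 0 0), 0, []) = (None, h, enc (f \<phi>))"
      unfolding reaches_def by (metis append_Nil drop0)
  qed
qed simp

section \<open>The planning scenario of a formula\<close>

text \<open>Independent of the formula and even of \<open>n\<close>. Without function symbols all
  arguments have size 1. The phase, predicate 0, is the only goal predicate, which makes the updates
  goal update rules.\<close>

definition sig :: signature where
  "sig = \<lparr>sorts = {0}, funs = (\<lambda>_. None),
     preds = map_of [(0, [0]), (2, [0]), (3, [0]), (4, [0, 0]), (5, [0, 0]),
       (6, replicate 6 0), (7, replicate 6 0)],
     kind = (\<lambda>q. if q = 0 then Goal else System)\<rparr>"

abbreviation "vr \<equiv> Var 0"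
abbreviation "cst \<equiv> Cst 0"
text \<open>Truth values are the constants 0 and 1, which are also the codes of signs; so a sign can
  be matched against a value directly.\<close>

abbreviation "tv b \<equiv> Cst 0 (of_bool b)"

abbreviation "now_atom \<equiv> Atom Time []"
abbreviation "phase i \<equiv> Atom (Pred 0) [cst i]"
abbreviation "fuel i \<equiv> Atom (Pred 2) [cst i]"
abbreviation "unset x \<equiv> Atom (Pred 3) [x]"
abbreviation "opt x y \<equiv> Atom (Pred 4) [x, y]"
abbreviation "val x y \<equiv> Atom (Pred 5) [x, y]"
abbreviation "todo ts \<equiv> Atom (Pred 6) ts"
abbreviation "sat ts \<equiv> Atom (Pred 7) ts"

text \<open>
  Time variable 0 stands for the global time, and everything happens at time 0: values and marks get
  the timestamp 1 only because a progressing rule must create some fact in the future.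
\<close>

definition set_rule :: "bool \<Rightarrow> irule" where
  "set_rule b = \<lparr>rule_now = 0, rule_side = [], rule_consumed = [(unset (vr 0), 0)],
     rule_guard = [not_before 0 0], rule_created = [(val (vr 0) (tv b), 1)]\<rparr>"

text \<open>The \<open>j\<close>-th literal is true if its variable, argument
  \<open>2 * j + 1\<close>, has its sign, argument \<open>2 * j\<close>, as value. Sharing the rule
  variables between the clause and the value expresses this for all clauses at once. The value gets
  a time variable of its own, as its stamp differs from that of the clause. The guard is trivially
  true; it is listed because progressing rules require it.\<close>

definition check_rule :: "nat \<Rightarrow> irule" where
  "check_rule j = \<lparr>rule_now = 0, rule_side = [(val (vr (2 * j + 1)) (vr (2 * j)), 1)],
     rule_consumed = [(todo (map vr [0..<6]), 0)], rule_guard = [not_before 0 0],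
     rule_created = [(sat (map vr [0..<6]), 1)]\<rparr>"

definition sys_rules :: "irule list" where
  "sys_rules = [set_rule False, set_rule True, check_rule 0, check_rule 1, check_rule 2]"

text \<open>
  The fuel is what makes the rule progressing when its block is empty: the phase has to stay at the
  current time.
\<close>

definition update_rule :: "qbf \<Rightarrow> nat \<Rightarrow> irule" where
  "update_rule \<phi> i = \<lparr>rule_now = 0, rule_side = [],
     rule_consumed = (phase i, 0) # (fuel i, 0) #
       map (\<lambda>x. (opt (cst x) (vr x), 0)) (blocks \<phi> ! (2 * i + 1)),
     rule_guard = [not_before 0 0],
     rule_created = (phase (i + 1), 0) # (fuel i, 1) #
       map (\<lambda>x. (val (cst x) (vr x), 1)) (blocks \<phi> ! (2 * i + 1))\<rparr>"

text \<open>Values are matched by variables: the block has to be set, no matter how.\<close>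

definition stage_goal :: "qbf \<Rightarrow> nat \<Rightarrow> pat list \<times> time_constraint list" where
  "stage_goal \<phi> i = ((now_atom, 0) # (phase i, 0) #
     map (\<lambda>x. (val (cst x) (vr x), 1)) (blocks \<phi> ! (2 * i)), [])"

definition final_goal :: "nat \<Rightarrow> qbf \<Rightarrow> pat list \<times> time_constraint list" where
  "final_goal n \<phi> = ((now_atom, 0) # (phase n, 0) #
     map (\<lambda>c. (sat (map cst (clause_nums c)), 1)) (matrix \<phi>), [])"

definition selected_vars :: "(nat \<Rightarrow> bool) \<Rightarrow> qbf \<Rightarrow> nat list" where
  "selected_vars P \<phi> = concat (map (\<lambda>j. if P j then blocks \<phi> ! j else []) [0..<length (blocks \<phi>)])"

text \<open>The order is that of the encoded formula, prefix before matrix, and the two options of a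
  variable are adjacent. This lets two passes print the whole list.\<close>

definition start :: "nat \<Rightarrow> qbf \<Rightarrow> (atom \<times> nat) list" where
  "start n \<phi> = [(now_atom, 0), (phase 0, 0)] @ map (\<lambda>i. (fuel i, 0)) [0..<n] @
     map (\<lambda>x. (unset (cst x), 0)) (selected_vars even \<phi>) @
     concat (map (\<lambda>x. [(opt (cst x) (tv False), 0), (opt (cst x) (tv True), 0)])
       (selected_vars odd \<phi>)) @
     map (\<lambda>c. (todo (map cst (clause_nums c)), 0)) (matrix \<phi>)"

definition qbf_scenario :: "nat \<Rightarrow> qbf \<Rightarrow> scenario" where
  "qbf_scenario n \<phi> = \<lparr>system_rules = sys_rules,
     goal_spec = map (stage_goal \<phi>) [0..<n] @ [final_goal n \<phi>],
     critical_spec = [], update_rules = map (update_rule \<phi>) [0..<n], init_config = start n \<phi>\<rparr>"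

lemma qbf_scenario_simps [simp]:
  "system_rules (qbf_scenario n \<phi>) = sys_rules"
  "goal_spec (qbf_scenario n \<phi>) = map (stage_goal \<phi>) [0..<n] @ [final_goal n \<phi>]"
  "critical_spec (qbf_scenario n \<phi>) = []"
  "update_rules (qbf_scenario n \<phi>) = map (update_rule \<phi>) [0..<n]"
  "init_config (qbf_scenario n \<phi>) = start n \<phi>"
  by (simp_all add: qbf_scenario_def)

lemma sig_simps [simp]:
  "sorts sig = {0}" "funs sig f = None" "kind sig q = (if q = 0 then Goal else System)"
  by (simp_all add: sig_def)

lemma preds_sig:
  "preds sig 0 = Some [0]" "preds sig 2 = Some [0]" "preds sig 3 = Some [0]" "preds sig 4 = Some [0, 0]"
  "preds sig 5 = Some [0, 0]" "preds sig 6 = Some (replicate 6 0)" "preds sig 7 = Some (replicate 6 0)"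
  by (simp_all add: sig_def)

lemma preds_sig_Some: "preds sig q = Some ss \<Longrightarrow> length ss \<le> 6 \<and> set ss \<subseteq> {0}"
  by (auto simp: sig_def split: if_splits)

lemma wf_sig: "wf_signature sig"
proof -
  have "finite (dom (preds sig))" by (simp add: sig_def finite_dom_map_of)
  moreover have "\<forall>ss\<in>ran (preds sig). set ss \<subseteq> sorts sig"
    using preds_sig_Some by (auto simp: ran_def)
  moreover have "funs sig = Map.empty" by auto
  ultimately show ?thesis by (simp add: wf_signature_def)
qed

subsection \<open>Well-formedness\<close>

lemma wf_lits: "list_all2 (has_sort sig) (map cst (clause_nums c)) (replicate 6 0)"
  by (auto simp: clause_nums_def list_all2_conv_all_nth nth_Cons split: nat.splits prod.splits)

lemma wf_atoms:
  "wf_atom sig (phase i)" "wf_atom sig (fuel i)" "has_sort sig x 0 \<Longrightarrow> wf_atom sig (unset x)"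
  "has_sort sig x 0 \<Longrightarrow> has_sort sig y 0 \<Longrightarrow> wf_atom sig (opt x y)"
  "has_sort sig x 0 \<Longrightarrow> has_sort sig y 0 \<Longrightarrow> wf_atom sig (val x y)"
  "list_all2 (has_sort sig) ts (replicate 6 0) \<Longrightarrow> wf_atom sig (todo ts)"
  "list_all2 (has_sort sig) ts (replicate 6 0) \<Longrightarrow> wf_atom sig (sat ts)"
  by (simp_all add: preds_sig del: replicate.simps)

lemma wf_vars: "list_all2 (has_sort sig) (map vr [0..<6]) (replicate 6 0)"
  by (simp add: list_all2_conv_all_nth)

lemma system_rule_sys: "r \<in> set sys_rules \<Longrightarrow> system_rule sig r \<and> progressing_rule r"
  by (auto simp: sys_rules_def set_rule_def check_rule_def system_rule_def wf_rule_def rule_atoms_def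
      rule_pre_def changed_atoms_def planning_atom_def goal_atom_def critical_atom_def
      progressing_rule_def wf_atoms wf_vars simp del: wf_atom.simps upt_Suc)

lemma update_rule_wf: "goal_update_rule sig (update_rule \<phi> i) \<and> progressing_rule (update_rule \<phi> i)"
  by (auto simp: update_rule_def goal_update_rule_def wf_rule_def rule_atoms_def
      rule_pre_def changed_atoms_def planning_atom_def goal_atom_def critical_atom_def
      progressing_rule_def wf_atoms simp del: wf_atom.simps)

lemma start_wf: "(F, t) \<in> set (start n \<phi>) \<Longrightarrow> wf_atom sig F \<and> atom_vars F = {}"
  by (auto simp: start_def wf_atoms wf_lits simp del: wf_atom.simps(2))

lemma wf_config_start: "wf_config sig (mset (start n \<phi>))"
proof -
  have "{#f \<in># mset (start n \<phi>). atom_pred (fst f) = Time#} = {#(now_atom, 0)#}"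
    by (auto simp: start_def filter_mset_eq_conv simp flip: mset_filter)
  then show ?thesis using start_wf by (auto simp: wf_config_def)
qed

lemma progressing_scen: "progressing_scenario sig (qbf_scenario n \<phi>)"
proof -
  have "wf_spec sig (goal_atom sig) (goal_spec (qbf_scenario n \<phi>))"
    by (auto simp: wf_spec_def stage_goal_def final_goal_def goal_atom_def wf_atoms wf_lits
        simp del: wf_atom.simps(2))
  moreover have "wf_spec sig (critical_atom sig) (critical_spec (qbf_scenario n \<phi>))"
    by (simp add: wf_spec_def)
  ultimately show ?thesis
    using system_rule_sys update_rule_wf wf_config_start
    by (auto simp: progressing_scenario_def planning_scenario_def)
qed

lemma simple_scen: "simple_scenario 1 (qbf_scenario n \<phi>)"
  by (simp add: simple_scenario_def)

lemma has_sort_size: "has_sort sig t s \<Longrightarrow> trm_size t = 1"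
  by (cases t) auto

lemma wf_atom_size:
  assumes "wf_atom sig F"
  shows "atom_size F \<le> 7"
proof (cases F)
  case (Atom p ts)
  show ?thesis
  proof (cases p)
    case Time
    then show ?thesis using assms Atom by simp
  next
    case (Pred q)
    then obtain ss where ss: "preds sig q = Some ss" "list_all2 (has_sort sig) ts ss"
      using assms Atom by (auto split: option.splits)
    then have "\<forall>t\<in>set ts. trm_size t = 1"
      using has_sort_size by (fastforce simp: list_all2_conv_all_nth in_set_conv_nth)
    then have "(\<Sum>t\<leftarrow>ts. trm_size t) = length ts" by (induction ts) auto
    moreover have "length ts \<le> 6" using ss preds_sig_Some by (auto dest: list_all2_lengthD)
    ultimately show ?thesis by (simp add: Atom)
  qed
qed

lemma wf_atom_subst:
  assumes "wf_atom sig F" "ground_subst sig \<sigma>"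
  shows "wf_atom sig (atom_subst \<sigma> F)"
proof (cases F)
  case (Atom p ts)
  have "has_sort sig (trm_subst \<sigma> t) s" if "has_sort sig t s" for t s
    using that assms(2) by (cases t) (auto simp: ground_subst_def)
  then show ?thesis using assms(1) Atom
    by (cases p) (auto simp: list_all2_conv_all_nth split: option.splits)
qed

lemma apply_rule_wf:
  assumes "apply_rule sig r S S'" "wf_rule sig r" "\<forall>(F, t)\<in>#S. wf_atom sig F"
  shows "\<forall>(F, t)\<in>#S'. wf_atom sig F"
proof -
  obtain \<sigma> \<theta> where \<sigma>: "ground_subst sig \<sigma>" and S': "S' = S - pats_subst \<sigma> \<theta> (rule_consumed r) +
      mset (map (\<lambda>(Q, D). (atom_subst \<sigma> Q, \<theta> (rule_now r) + D)) (rule_created r))"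
    using assms(1) by (auto simp: apply_rule_def)
  have "wf_atom sig F" if "(F, D) \<in> set (rule_created r)" for F D
    using assms(2) that by (force simp: wf_rule_def rule_atoms_def)
  then show ?thesis using assms(3) \<sigma> unfolding S'
    by (auto dest!: in_diffD intro!: wf_atom_subst)
qed

lemma linked_wf:
  assumes "linked sig R S ss" "\<And>r. r \<in> R \<Longrightarrow> wf_rule sig r" "\<forall>(F, t)\<in>#S. wf_atom sig F"
    and "T \<in> set (S # map snd ss)"
  shows "\<forall>(F, t)\<in>#T. wf_atom sig F"
  using assms(1,3,4)
proof (induction ss arbitrary: S)
  case (Cons x ss)
  obtain \<alpha> S' where x: "x = (\<alpha>, S')" by (cases x)
  have "\<forall>(F, t)\<in>#S'. wf_atom sig F"
  proof (cases \<alpha>)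
    case Tick
    then show ?thesis using Cons.prems(1,2) by (auto simp: x apply_tick_def dest!: in_diffD)
  next
    case (Inst r)
    then show ?thesis using Cons.prems(1,2) apply_rule_wf[of r S S'] assms(2) by (simp add: x)
  qed
  then show ?case using Cons.IH[of S'] Cons.prems by (auto simp: x)
qed simp

lemma facts_bounded_scen: "facts_bounded sig 7 (qbf_scenario n \<phi>)"
proof -
  have wf: "wf_rule sig r" if "r \<in> set sys_rules \<union> set (map (update_rule \<phi>) [0..<n])" for r
    using that system_rule_sys update_rule_wf by (auto simp: system_rule_def goal_update_rule_def)
  have "\<forall>(F, t)\<in>#mset (start n \<phi>). wf_atom sig F" using start_wf by auto
  then show ?thesis
    using linked_wf[OF _ wf] wf_atom_size
    by (fastforce simp: facts_bounded_def trace_from_def trace_configs_def)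
qed

section \<open>Transitions\<close>

lemma ground_subst_sig: "(\<And>x. \<exists>y. \<sigma> (0, x) = cst y) \<Longrightarrow> ground_subst sig \<sigma>"
  unfolding ground_subst_def by (metis has_sort.simps(2) insertI1 sig_simps(1) singletonD trm_vars.simps(2))

lemma mset_subset_distinct: "distinct xs \<Longrightarrow> set xs \<subseteq> set_mset S \<Longrightarrow> mset xs \<subseteq># S"
  by (metis finite_set_mset mset_set_set mset_set_set_mset_msubset subset_imp_msubset_mset_set subset_mset.order_trans)

text \<open>Ticks and system rules replace exactly one fact each, so one preservation lemma about
  exchanges covers them all.\<close>

definition exchange :: "atom \<times> nat \<Rightarrow> atom \<times> nat \<Rightarrow> config \<Rightarrow> config \<Rightarrow> bool" where
  "exchange a b S S' \<longleftrightarrow> a \<in># S \<and> S' = S - {#a#} + {#b#}"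

lemma fresh_subst_sys: "r \<in> set sys_rules \<Longrightarrow> fresh_subst r S \<sigma>"
proof -
  assume "r \<in> set sys_rules"
  then have "fresh_vars r = {}"
    by (auto simp: sys_rules_def set_rule_def check_rule_def fresh_vars_def rule_pre_def)
  then show ?thesis by (simp add: fresh_subst_def)
qed

text \<open>Keeps only what the invariant needs; that the replaced token carries the current time is
  forgotten.\<close>

lemma sys_step_cases:
  assumes "step sig (set sys_rules) \<alpha> S S'"
  obtains (tick) t where "\<alpha> = Tick" "exchange (now_atom, t) (now_atom, t + 1) S S'"
    | (set) x t b where "exchange (unset x, t) (val x (tv b), t + 1) S S'"
    | (check) ts t j t' where "exchange (todo ts, t) (sat ts, t + 1) S S'" "length ts = 6" "j < 3"
        "(val (ts ! (2 * j + 1)) (ts ! (2 * j)), t') \<in># S"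
proof (cases \<alpha>)
  case Tick
  with assms tick show ?thesis by (auto simp: apply_tick_def exchange_def)
next
  case (Inst r)
  then obtain \<sigma> \<theta> where r: "r \<in> set sys_rules" and pre: "pats_subst \<sigma> \<theta> (rule_pre r) \<subseteq># S"
    and S': "S' = S - pats_subst \<sigma> \<theta> (rule_consumed r) +
        mset (map (\<lambda>(Q, D). (atom_subst \<sigma> Q, \<theta> (rule_now r) + D)) (rule_created r))"
    using assms by (auto simp: apply_rule_def)
  have mem: "x \<in># pats_subst \<sigma> \<theta> (rule_pre r) \<Longrightarrow> x \<in># S" for x
    using pre by (rule mset_subset_eqD)
  have "(\<exists>b. r = set_rule b) \<or> (\<exists>j<3. r = check_rule j)"
    using r unfolding sys_rules_def
    by (simp add: all_simps ex_simps) (metis One_nat_def numeral_3_eq_3 less_Suc_eq numeral_2_eq_2 zero_less_Suc)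
  then show ?thesis
  proof (elim disjE exE conjE)
    fix b assume r: "r = set_rule b"
    have "(unset (\<sigma> (0, 0)), \<theta> 0) \<in># S"
      by (rule mem) (simp add: r set_rule_def rule_pre_def pats_subst_def)
    moreover have "S' = S - {#(unset (\<sigma> (0, 0)), \<theta> 0)#} + {#(val (\<sigma> (0, 0)) (tv b), \<theta> 0 + 1)#}"
      using S' by (simp add: r set_rule_def pats_subst_def)
    ultimately show ?thesis using set[of "\<sigma> (0, 0)" "\<theta> 0" b] by (simp add: exchange_def)
  next
    fix j :: nat assume j: "j < 3" and r: "r = check_rule j"
    let ?ts = "map (\<lambda>i. \<sigma> (0, i)) [0..<6]"
    have ts: "map (trm_subst \<sigma> \<circ> vr) [0..<6] = ?ts" by (simp add: comp_def)
    have "(todo ?ts, \<theta> 0) \<in># S"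
      by (rule mem) (simp add: r check_rule_def rule_pre_def pats_subst_def ts del: upt_Suc)
    moreover have "S' = S - {#(todo ?ts, \<theta> 0)#} + {#(sat ?ts, \<theta> 0 + 1)#}"
      using S' by (simp add: r check_rule_def pats_subst_def ts del: upt_Suc)
    moreover have "(val (?ts ! (2 * j + 1)) (?ts ! (2 * j)), \<theta> 1) \<in># S"
      by (rule mem) (use j in \<open>simp add: r check_rule_def rule_pre_def pats_subst_def del: upt_Suc\<close>)
    ultimately show ?thesis using check[of ?ts "\<theta> 0" j "\<theta> 1"] j by (simp add: exchange_def del: upt_Suc)
  qed
qed

lemma set_stepI:
  assumes "(now_atom, t) \<in># S" "(unset (cst x), t) \<in># S"
  shows "step sig (set sys_rules) (Inst (set_rule b)) S (S - {#(unset (cst x), t)#} + {#(val (cst x) (tv b), t + 1)#})"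
proof -
  have r: "set_rule b \<in> set sys_rules" by (cases b) (auto simp: sys_rules_def)
  have "mset [(now_atom, t), (unset (cst x), t)] \<subseteq># S"
    by (rule mset_subset_distinct) (use assms in auto)
  then have "apply_rule sig (set_rule b) S (S - {#(unset (cst x), t)#} + {#(val (cst x) (tv b), t + 1)#})"
    unfolding apply_rule_def
    by (intro exI[of _ "\<lambda>_. cst x"] exI[of _ "\<lambda>_. t"])
      (use fresh_subst_sys[OF r] in \<open>simp add: ground_subst_sig set_rule_def rule_pre_def pats_subst_def\<close>)
  with r show ?thesis by simp
qed

lemma check_stepI:
  assumes "(now_atom, t) \<in># S" "(todo (map cst vs), t) \<in># S" "length vs = 6" "j < 3"
    and "(val (cst (vs ! (2 * j + 1))) (cst (vs ! (2 * j))), t') \<in># S"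
  shows "step sig (set sys_rules) (Inst (check_rule j)) S
    (S - {#(todo (map cst vs), t)#} + {#(sat (map cst vs), t + 1)#})"
proof -
  have r: "check_rule j \<in> set sys_rules"
    using assms(4) by (auto simp: sys_rules_def less_Suc_eq numeral_3_eq_3 numeral_2_eq_2)
  \<comment> \<open>A ground substitution is total. For \<open>i \<ge> 6\<close> the number
    \<open>vs ! i\<close> is unspecified, but its constant is still a ground term.\<close>
  let ?\<sigma> = "\<lambda>(s :: nat, i). cst (vs ! i)" and ?\<theta> = "\<lambda>T::nat. if T = 0 then t else t'"
  have vs: "map (trm_subst ?\<sigma> \<circ> vr) [0..<6] = map cst vs"
    using assms(3) by (auto intro: nth_equalityI)
  have "mset [(now_atom, t), (val (cst (vs ! (2 * j + 1))) (cst (vs ! (2 * j))), t'), (todo (map cst vs), t)] \<subseteq># S"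
    by (rule mset_subset_distinct) (use assms in auto)
  then have "apply_rule sig (check_rule j) S (S - {#(todo (map cst vs), t)#} + {#(sat (map cst vs), t + 1)#})"
    unfolding apply_rule_def
    by (intro exI[of _ ?\<sigma>] exI[of _ ?\<theta>])
      (use fresh_subst_sys[OF r] in
        \<open>simp add: ground_subst_sig check_rule_def rule_pre_def pats_subst_def vs del: upt_Suc\<close>)
  with r show ?thesis by simp
qed

definition consumed :: "qbf \<Rightarrow> nat \<Rightarrow> nat \<Rightarrow> (nat \<Rightarrow> trm) \<Rightarrow> config" where
  "consumed \<phi> i t Y = {#(phase i, t), (fuel i, t)#} +
     mset (map (\<lambda>x. (opt (cst x) (Y x), t)) (blocks \<phi> ! (2 * i + 1)))"

definition created :: "qbf \<Rightarrow> nat \<Rightarrow> nat \<Rightarrow> (nat \<Rightarrow> trm) \<Rightarrow> config" where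
  "created \<phi> i t Y = {#(phase (i + 1), t), (fuel i, t + 1)#} +
     mset (map (\<lambda>x. (val (cst x) (Y x), t + 1)) (blocks \<phi> ! (2 * i + 1)))"

lemma update_cases:
  assumes "apply_rule sig (update_rule \<phi> i) S S'"
  obtains t Y where "(now_atom, t) \<in># S" "consumed \<phi> i t Y \<subseteq># S" "S' = S - consumed \<phi> i t Y + created \<phi> i t Y"
proof -
  obtain \<sigma> \<theta> where pre: "pats_subst \<sigma> \<theta> (rule_pre (update_rule \<phi> i)) \<subseteq># S"
    and S': "S' = S - pats_subst \<sigma> \<theta> (rule_consumed (update_rule \<phi> i)) +
        mset (map (\<lambda>(Q, D). (atom_subst \<sigma> Q, \<theta> 0 + D)) (rule_created (update_rule \<phi> i)))"
    using assms by (auto simp: apply_rule_def update_rule_def)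
  let ?Y = "\<lambda>x. \<sigma> (0, x)"
  have 1: "pats_subst \<sigma> \<theta> (rule_consumed (update_rule \<phi> i)) = consumed \<phi> i (\<theta> 0) ?Y"
    by (simp add: update_rule_def pats_subst_def consumed_def comp_def)
  have 2: "mset (map (\<lambda>(Q, D). (atom_subst \<sigma> Q, \<theta> 0 + D)) (rule_created (update_rule \<phi> i))) =
      created \<phi> i (\<theta> 0) ?Y"
    by (simp add: update_rule_def created_def comp_def)
  have 3: "pats_subst \<sigma> \<theta> (rule_pre (update_rule \<phi> i)) = {#(now_atom, \<theta> 0)#} + consumed \<phi> i (\<theta> 0) ?Y"
    by (simp add: update_rule_def rule_pre_def pats_subst_def consumed_def comp_def)
  show ?thesis
  proof (rule that)
    show "(now_atom, \<theta> 0) \<in># S" using pre unfolding 3 by (rule mset_subset_eqD) simp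
    show "consumed \<phi> i (\<theta> 0) ?Y \<subseteq># S"
      using pre unfolding 3 by (rule subset_mset.order_trans[rotated]) simp
    show "S' = S - consumed \<phi> i (\<theta> 0) ?Y + created \<phi> i (\<theta> 0) ?Y" using S' unfolding 1 2 .
  qed
qed

text \<open>The rule variable \<open>vr x\<close> belongs to the formula variable \<open>x\<close>
  alone, so the options of the block can be picked independently and every assignment on offer is a
  possible update.\<close>

lemma update_ruleI:
  assumes "(now_atom, t) \<in># S" "(phase i, t) \<in># S" "(fuel i, t) \<in># S"
    and "\<And>x. x \<in> set (blocks \<phi> ! (2 * i + 1)) \<Longrightarrow> (opt (cst x) (tv (\<gamma> x)), t) \<in># S"
    and "distinct (blocks \<phi> ! (2 * i + 1))"
  shows "apply_rule sig (update_rule \<phi> i) S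
    (S - consumed \<phi> i t (\<lambda>x. tv (\<gamma> x)) + created \<phi> i t (\<lambda>x. tv (\<gamma> x)))"
proof -
  let ?\<sigma> = "\<lambda>(s :: nat, x). tv (\<gamma> x)"
  have "mset ((now_atom, t) # (phase i, t) # (fuel i, t) #
      map (\<lambda>x. (opt (cst x) (tv (\<gamma> x)), t)) (blocks \<phi> ! (2 * i + 1))) \<subseteq># S"
    by (rule mset_subset_distinct) (use assms in \<open>auto simp: distinct_map inj_on_def\<close>)
  moreover have "fresh_vars (update_rule \<phi> i) = {}"
    by (auto simp: update_rule_def fresh_vars_def rule_pre_def)
  ultimately show ?thesis
    unfolding apply_rule_def
    by (intro exI[of _ ?\<sigma>] exI[of _ "\<lambda>_. t"])
      (simp add: ground_subst_sig update_rule_def rule_pre_def pats_subst_def fresh_subst_def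
        consumed_def created_def comp_def)
qed

lemma matches_specI:
  assumes "p \<in> set sp" "ground_subst Sg \<sigma>" "pats_subst \<sigma> \<theta> (fst p) \<subseteq># S" "snd p = []"
  shows "matches_spec Sg sp S"
  unfolding matches_spec_def using assms by (intro bexI[of _ p]) (auto simp: split_beta)

lemma goal_cases:
  assumes "goal_config sig (qbf_scenario n \<phi>) S"
  obtains (stage) i Y t t' where "i < n" "(now_atom, t) \<in># S" "(phase i, t) \<in># S"
      "\<And>x. x \<in> set (blocks \<phi> ! (2 * i)) \<Longrightarrow> (val (cst x) (Y x), t') \<in># S"
    | (final) t t' where "(now_atom, t) \<in># S" "(phase n, t) \<in># S"
      "\<And>c. c \<in> set (matrix \<phi>) \<Longrightarrow> (sat (map cst (clause_nums c)), t') \<in># S"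
proof -
  obtain p \<sigma> \<theta> where p: "p \<in> set (goal_spec (qbf_scenario n \<phi>))" and sub: "pats_subst \<sigma> \<theta> (fst p) \<subseteq># S"
    using assms unfolding goal_config_def matches_spec_def by force
  have mem: "(atom_subst \<sigma> F, \<theta> T) \<in># S" if "(F, T) \<in> set (fst p)" for F T
    using sub that by (force simp: pats_subst_def elim!: mset_subset_eqD)
  from p consider i where "i < n" "p = stage_goal \<phi> i" | "p = final_goal n \<phi>" by auto
  then show ?thesis
  proof cases
    case 1
    show ?thesis
    proof (rule stage[of i "\<theta> 0" "\<lambda>x. \<sigma> (0, x)" "\<theta> 1"])
      show "i < n" by fact
      show "(now_atom, \<theta> 0) \<in># S" using mem[of now_atom 0] by (simp add: 1 stage_goal_def)
      show "(phase i, \<theta> 0) \<in># S" using mem[of "phase i" 0] by (simp add: 1 stage_goal_def)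
      show "(val (cst x) (\<sigma> (0, x)), \<theta> 1) \<in># S" if "x \<in> set (blocks \<phi> ! (2 * i))" for x
        using mem[of "val (cst x) (vr x)" 1] that by (simp add: 1 stage_goal_def)
    qed
  next
    case 2
    show ?thesis
    proof (rule final[of "\<theta> 0" "\<theta> 1"])
      show "(now_atom, \<theta> 0) \<in># S" using mem[of now_atom 0] by (simp add: 2 final_goal_def)
      show "(phase n, \<theta> 0) \<in># S" using mem[of "phase n" 0] by (simp add: 2 final_goal_def)
      show "(sat (map cst (clause_nums c)), \<theta> 1) \<in># S" if "c \<in> set (matrix \<phi>)" for c
        using mem[of "sat (map cst (clause_nums c))" 1] that by (auto simp: 2 final_goal_def comp_def)
    qed
  qed
qed

lemma stage_goalI:
  assumes "i < n" "(now_atom, 0) \<in># S" "(phase i, 0) \<in># S" "distinct (blocks \<phi> ! (2 * i))"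
    and "\<And>x. x \<in> set (blocks \<phi> ! (2 * i)) \<Longrightarrow> (val (cst x) (tv (\<alpha> x)), 1) \<in># S"
  shows "goal_config sig (qbf_scenario n \<phi>) S"
proof -
  \<comment> \<open>Time variables 0 and 1 have to denote the times 0 and 1, so the identity serves
    as \<open>\<theta>\<close>.\<close>
  let ?\<sigma> = "\<lambda>(s :: nat, x). tv (\<alpha> x)" and ?\<theta> = "\<lambda>T::nat. T"
  have "mset ((now_atom, 0) # (phase i, 0) #
      map (\<lambda>x. (val (cst x) (tv (\<alpha> x)), 1)) (blocks \<phi> ! (2 * i))) \<subseteq># S"
    by (rule mset_subset_distinct) (use assms in \<open>auto simp: distinct_map inj_on_def\<close>)
  then have "pats_subst ?\<sigma> ?\<theta> (fst (stage_goal \<phi> i)) \<subseteq># S"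
    by (simp add: stage_goal_def pats_subst_def comp_def)
  moreover have "snd (stage_goal \<phi> i) = []" by (simp add: stage_goal_def)
  moreover have "ground_subst sig ?\<sigma>" by (rule ground_subst_sig) simp
  moreover have "stage_goal \<phi> i \<in> set (goal_spec (qbf_scenario n \<phi>))" using assms(1) by simp
  ultimately show ?thesis
    unfolding goal_config_def by (blast intro: matches_specI)
qed

lemma final_goalI:
  assumes "{#(now_atom, 0), (phase n, 0)#} + mset (map (\<lambda>c. (sat (map cst (clause_nums c)), 1)) (matrix \<phi>)) \<subseteq># S"
  shows "goal_config sig (qbf_scenario n \<phi>) S"
proof -
  let ?\<sigma> = "\<lambda>_. cst 0" and ?\<theta> = "\<lambda>T::nat. T"
  have "pats_subst ?\<sigma> ?\<theta> (fst (final_goal n \<phi>)) \<subseteq># S"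
    using assms by (simp add: final_goal_def pats_subst_def comp_def)
  moreover have "snd (final_goal n \<phi>) = []" by (simp add: final_goal_def)
  moreover have "ground_subst sig ?\<sigma>" by (rule ground_subst_sig) simp
  moreover have "final_goal n \<phi> \<in> set (goal_spec (qbf_scenario n \<phi>))" by simp
  ultimately show ?thesis
    unfolding goal_config_def by (blast intro: matches_specI)
qed

lemma compliant_scen: "compliant sig (qbf_scenario n \<phi>) \<tau>"
  by (simp add: compliant_def critical_config_def matches_spec_def)

section \<open>An invariant of all reachable configurations\<close>

text \<open>
  Rules never increase this number, except that an update increases it from 0 for the variables of its
  block; this is why a variable has at most one value.
\<close>

definition cell :: "nat \<Rightarrow> config \<Rightarrow> nat" where
  "cell x S = size {#f \<in># S. fst f = unset (cst x) \<or> (\<exists>y. fst f = val (cst x) y)#}"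

text \<open>What ticks and system rules preserve throughout phase \<open>i\<close>. The phase keeps
  the stamp 0 even after ticks, so a goal, which equates this stamp with the global time, certifies
  that the time is 0. Fuel and both options are intact for all universal blocks to come, so every
  later choice stays possible. A mark \<open>sat\<close> always has a witnessing value, since no
  rule consumes values.\<close>

definition good :: "nat \<Rightarrow> qbf \<Rightarrow> nat \<Rightarrow> config \<Rightarrow> bool" where
  "good n \<phi> i S \<longleftrightarrow>
     (\<exists>t. {#f \<in># S. fst f = now_atom#} = {#(now_atom, t)#}) \<and>
     {#f \<in># S. atom_pred (fst f) = Pred 0#} = {#(phase i, 0)#} \<and>
     (\<forall>j. i \<le> j \<and> j < n \<longrightarrow> (fuel j, 0) \<in># S) \<and>
     (\<forall>j x b. i \<le> j \<and> j < n \<and> x \<in> set (blocks \<phi> ! (2 * j + 1)) \<longrightarrow> (opt (cst x) (tv b), 0) \<in># S) \<and>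
     (\<forall>x y t. (opt x y, t) \<in># S \<longrightarrow> (\<exists>b. y = tv b)) \<and>
     (\<forall>x. cell x S \<le> 1) \<and>
     (\<forall>j x. i \<le> j \<and> j < n \<and> x \<in> set (blocks \<phi> ! (2 * j + 1)) \<longrightarrow> cell x S = 0) \<and>
     (\<forall>ts t. (sat ts, t) \<in># S \<longrightarrow>
        (\<exists>j<3. \<exists>t'. (val (ts ! (2 * j + 1)) (ts ! (2 * j)), t') \<in># S)) \<and>
     (\<forall>x y t. (val x y, t) \<in># S \<longrightarrow> (\<exists>b. y = tv b))"

lemma goodD:
  assumes "good n \<phi> i S"
  shows "\<exists>t. {#f \<in># S. fst f = now_atom#} = {#(now_atom, t)#}"
    and "{#f \<in># S. atom_pred (fst f) = Pred 0#} = {#(phase i, 0)#}"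
    and "i \<le> j \<Longrightarrow> j < n \<Longrightarrow> (fuel j, 0) \<in># S"
    and "i \<le> j \<Longrightarrow> j < n \<Longrightarrow> x \<in> set (blocks \<phi> ! (2 * j + 1)) \<Longrightarrow> (opt (cst x) (tv b), 0) \<in># S"
    and "(opt y z, t) \<in># S \<Longrightarrow> \<exists>b. z = tv b"
    and "cell x S \<le> 1"
    and "i \<le> j \<Longrightarrow> j < n \<Longrightarrow> x \<in> set (blocks \<phi> ! (2 * j + 1)) \<Longrightarrow> cell x S = 0"
    and "(sat ts, t) \<in># S \<Longrightarrow> \<exists>j<3. \<exists>t'. (val (ts ! (2 * j + 1)) (ts ! (2 * j)), t') \<in># S"
    and "(val y z, t) \<in># S \<Longrightarrow> \<exists>b. z = tv b"
  using assms unfolding good_def by blast+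

lemma filter_exchange:
  "exchange a b S S' \<Longrightarrow> filter_mset P S' =
     (if P a then filter_mset P S - {#a#} else filter_mset P S) + (if P b then {#b#} else {#})"
  by (auto simp: exchange_def)

lemma size_filter_exchange:
  assumes "exchange a b S S'"
  shows "size (filter_mset P S') + of_bool (P a) = size (filter_mset P S) + of_bool (P b)"
proof -
  obtain R where "S = add_mset a R" using assms by (auto simp: exchange_def dest: multi_member_split)
  then show ?thesis using assms by (simp add: exchange_def)
qed

lemma in_exchange: "exchange a b S S' \<Longrightarrow> f \<in># S \<Longrightarrow> f \<noteq> a \<Longrightarrow> f \<in># S'"
  by (auto simp: exchange_def in_diff_count)

lemma exchange_in: "exchange a b S S' \<Longrightarrow> f \<in># S' \<Longrightarrow> f = b \<or> f \<in># S"
  by (auto simp: exchange_def dest: in_diffD)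

lemma good_now_unique: "good n \<phi> i S \<Longrightarrow> (now_atom, t) \<in># S \<Longrightarrow> (now_atom, t') \<in># S \<Longrightarrow> t = t'"
proof -
  assume S: "good n \<phi> i S" "(now_atom, t) \<in># S" "(now_atom, t') \<in># S"
  then obtain u where "{#f \<in># S. fst f = now_atom#} = {#(now_atom, u)#}" by (auto simp: good_def)
  then have "f \<in># S \<Longrightarrow> fst f = now_atom \<Longrightarrow> f = (now_atom, u)" for f
    by (metis (mono_tags) mem_Collect_eq set_mset_filter singletonD set_mset_single)
  with S show ?thesis by (metis fst_conv snd_conv)
qed

lemma good_time: "good n \<phi> i S \<Longrightarrow> (now_atom, t) \<in># S \<Longrightarrow> global_time S = t"
  unfolding global_time_def using good_now_unique by blast

lemma good_phase: "good n \<phi> i S \<Longrightarrow> (phase j, t) \<in># S \<longleftrightarrow> j = i \<and> t = 0"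
proof -
  assume "good n \<phi> i S"
  then have *: "{#f \<in># S. atom_pred (fst f) = Pred 0#} = {#(phase i, 0)#}" by (simp add: good_def)
  have "(phase j, t) \<in># S \<longleftrightarrow> (phase j, t) \<in># {#f \<in># S. atom_pred (fst f) = Pred 0#}" by simp
  also have "\<dots> \<longleftrightarrow> j = i \<and> t = 0" unfolding * by auto
  finally show ?thesis .
qed

lemma good_val_unique:
  assumes "good n \<phi> i S" "(val (cst x) y, t) \<in># S" "(val (cst x) y', t') \<in># S"
  shows "y = y'"
proof (rule ccontr)
  assume ne: "y \<noteq> y'"
  let ?F = "{#f \<in># S. fst f = unset (cst x) \<or> (\<exists>y. fst f = val (cst x) y)#}"
  have "mset [(val (cst x) y, t), (val (cst x) y', t')] \<subseteq># ?F"
    by (rule mset_subset_distinct) (use assms ne in auto)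
  then have "size (mset [(val (cst x) y, t), (val (cst x) y', t')]) \<le> size ?F"
    by (rule size_mset_mono)
  moreover have "size ?F \<le> 1" using assms(1) by (auto simp: good_def cell_def)
  ultimately show False by simp
qed

text \<open>The assumption \<open>cell\<close> lets a token or value of \<open>x\<close> appear only
  in return for the token of \<open>x\<close>; hence the number of cells of a variable cannot
  grow.\<close>

lemma good_exchange:
  assumes S: "good n \<phi> i S" and ex: "exchange a b S S'"
    and now: "fst a = now_atom \<longleftrightarrow> fst b = now_atom"
    and phase: "atom_pred (fst a) \<noteq> Pred 0" "atom_pred (fst b) \<noteq> Pred 0"
    and fuel: "atom_pred (fst a) \<noteq> Pred 2"
    and opt: "atom_pred (fst a) \<noteq> Pred 4" "atom_pred (fst b) \<noteq> Pred 4"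
    and val: "atom_pred (fst a) \<noteq> Pred 5"
    and cell: "\<And>x. fst b = unset (cst x) \<or> (\<exists>y. fst b = val (cst x) y) \<Longrightarrow> fst a = unset (cst x)"
    and sat: "\<And>ts t. b = (sat ts, t) \<Longrightarrow> \<exists>j<3. \<exists>t'. (val (ts ! (2 * j + 1)) (ts ! (2 * j)), t') \<in># S"
    and bool: "\<And>x y t. b = (val x y, t) \<Longrightarrow> \<exists>b. y = tv b"
  shows "good n \<phi> i S'"
proof -
  note S = goodD[OF S]
  have a: "a \<in># S" using ex by (simp add: exchange_def)
  have keep: "f \<in># S'" if "f \<in># S" "f \<noteq> a" for f by (rule in_exchange[OF ex that])
  have cell_le: "cell x S' \<le> cell x S" for x
  proof -
    let ?P = "\<lambda>f. fst f = unset (cst x) \<or> (\<exists>y. fst f = val (cst x) y)"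
    have "?P b \<longrightarrow> ?P a" using cell by blast
    with size_filter_exchange[OF ex, of ?P] show ?thesis
      unfolding cell_def by (cases "?P a"; cases "?P b") (simp_all only: of_bool_eq)
  qed
  have "\<exists>t. {#f \<in># S'. fst f = now_atom#} = {#(now_atom, t)#}"
  proof -
    obtain t where t: "{#f \<in># S. fst f = now_atom#} = {#(now_atom, t)#}" using S(1) by blast
    show ?thesis
    proof (cases "fst a = now_atom")
      case True
      then have "a \<in># {#f \<in># S. fst f = now_atom#}" using a by simp
      then have "a = (now_atom, t)" unfolding t by simp
      then show ?thesis using now True unfolding filter_exchange[OF ex] t by (cases b) auto
    next
      case False
      then show ?thesis using now unfolding filter_exchange[OF ex] t by auto
    qed
  qed
  moreover have "{#f \<in># S'. atom_pred (fst f) = Pred 0#} = {#(phase i, 0)#}"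
    using S(2) phase unfolding filter_exchange[OF ex] by simp
  moreover have "(fuel j, 0) \<in># S'" if "i \<le> j" "j < n" for j
    by (rule keep) (use S(3) that fuel in auto)
  moreover have "(opt (cst x) (tv b), 0) \<in># S'" if "i \<le> j" "j < n" "x \<in> set (blocks \<phi> ! (2 * j + 1))" for j x b
    by (rule keep) (use S(4) that opt in auto)
  moreover have "\<exists>b. y = tv b" if "(opt x y, t) \<in># S'" for x y t
  proof -
    have "(opt x y, t) \<noteq> b" using opt(2) by auto
    with exchange_in[OF ex that] have "(opt x y, t) \<in># S" by blast
    then show ?thesis by (rule S(5))
  qed
  moreover have "cell x S' \<le> 1" for x
    using cell_le[of x] S(6)[of x] by linarith
  moreover have "cell x S' = 0" if "i \<le> j" "j < n" "x \<in> set (blocks \<phi> ! (2 * j + 1))" for j x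
    using cell_le[of x] S(7)[OF that] by simp
  moreover have "\<exists>j<3. \<exists>t'. (val (ts ! (2 * j + 1)) (ts ! (2 * j)), t') \<in># S'" if "(sat ts, t) \<in># S'" for ts t
  proof -
    have "\<exists>j<3. \<exists>t'. (val (ts ! (2 * j + 1)) (ts ! (2 * j)), t') \<in># S"
      using exchange_in[OF ex that] sat[of ts t] S(8) by auto
    moreover have "(val y z, t') \<in># S'" if "(val y z, t') \<in># S" for y z t'
      by (rule keep[OF that]) (use val in auto)
    ultimately show ?thesis by blast
  qed
  moreover have "\<exists>b. y = tv b" if "(val x y, t) \<in># S'" for x y t
    using exchange_in[OF ex that] bool[of x y t] S(9)[of x y t] by blast
  ultimately show ?thesis unfolding good_def by blast
qed

lemma good_sys_step:
  assumes S: "good n \<phi> i S" and step: "step sig (set sys_rules) \<alpha> S S'"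
  shows "good n \<phi> i S' \<and> (\<forall>x y t. (val x y, t) \<in># S \<longrightarrow> (val x y, t) \<in># S')"
  using step
proof (cases rule: sys_step_cases)
  case (tick t)
  then show ?thesis using in_exchange[OF tick(2)] by (intro conjI good_exchange[OF S tick(2)]) auto
next
  case (set x t b)
  then show ?thesis using in_exchange[OF set] by (intro conjI good_exchange[OF S set]) auto
next
  case (check ts t j t')
  then show ?thesis using in_exchange[OF check(1)] by (intro conjI good_exchange[OF S check(1)]) auto
qed

lemma good_linked:
  assumes "good n \<phi> i S" "linked sig (set sys_rules) S ss"
  shows "good n \<phi> i (last (S # map snd ss)) \<and>
    (\<forall>x y t. (val x y, t) \<in># S \<longrightarrow> (val x y, t) \<in># last (S # map snd ss))"
  using assms
proof (induction ss arbitrary: S)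
  case (Cons s ss)
  obtain \<alpha> S' where s: "s = (\<alpha>, S')" by (cases s)
  with Cons.prems have step: "step sig (set sys_rules) \<alpha> S S'" and l: "linked sig (set sys_rules) S' ss" by auto
  from good_sys_step[OF Cons.prems(1) step] Cons.IH[OF _ l] show ?case by (simp add: s)
qed simp

lemma filter_image_none: "(\<And>x. \<not> P (f x)) \<Longrightarrow> filter_mset P (image_mset f M) = {#}"
  by (induction M) simp_all

lemma in_diff_notin: "a \<in># S \<Longrightarrow> a \<notin># A \<Longrightarrow> a \<in># S - A"
  by (simp add: in_diff_count not_in_iff)

lemma filter_eq_distinct: "distinct xs \<Longrightarrow> filter (\<lambda>y. y = x) xs = (if x \<in> set xs then [x] else [])"
  by (induction xs) auto

section \<open>Disjoint quantifier blocks, updates and the initial configuration\<close>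

locale game =
  fixes n :: nat and \<phi> :: qbf
  assumes formula: "sigma_formula (2 * n + 1) \<phi>"
begin

abbreviation "bl j \<equiv> blocks \<phi> ! j"

lemma length_blocks: "length (blocks \<phi>) = 2 * n + 1"
  using formula by (simp add: sigma_formula_def)

lemma distinct_bl: "j \<le> 2 * n \<Longrightarrow> distinct (bl j)"
  using formula by (auto simp: sigma_formula_def distinct_concat_iff)

lemma bl_unique:
  assumes "i \<le> 2 * n" "j \<le> 2 * n" "x \<in> set (bl i)" "x \<in> set (bl j)"
  shows "i = j"
proof -
  have dist: "distinct (concat (blocks \<phi>))" using formula by (simp add: sigma_formula_def)
  have aux: "x \<notin> set (bl j)" if "i < j" "j \<le> 2 * n" "x \<in> set (bl i)" for i j
  proof -
    have "concat (blocks \<phi>) = concat (take j (blocks \<phi>)) @ concat (drop j (blocks \<phi>))"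
      by (metis append_take_drop_id concat_append)
    with dist have "set (concat (take j (blocks \<phi>))) \<inter> set (concat (drop j (blocks \<phi>))) = {}"
      by (metis distinct_append)
    moreover have "bl i \<in> set (take j (blocks \<phi>))"
      using that length_blocks by (auto simp: in_set_conv_nth intro!: exI[of _ i])
    moreover have "bl j \<in> set (drop j (blocks \<phi>))"
      using that length_blocks by (auto simp: in_set_conv_nth intro!: exI[of _ 0])
    ultimately show ?thesis using that(3) by auto
  qed
  show ?thesis using assms aux by (metis nat_neq_iff)
qed

text \<open>The unique phase fact determines which update rule can fire and with which stamp, so the
  opponent can only play block \<open>2 * i + 1\<close>, at time 0. Its variables had no cell so far
  and get exactly one; later blocks are disjoint from it and keep their options.\<close>

lemma good_update:
  assumes S: "good n \<phi> i S" and i: "i < n" and sub: "consumed \<phi> j t Y \<subseteq># S"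
    and S': "S' = S - consumed \<phi> j t Y + created \<phi> j t Y"
  shows "j = i \<and> t = 0 \<and> good n \<phi> (Suc i) S' \<and> (\<forall>x y t. (val x y, t) \<in># S \<longrightarrow> (val x y, t) \<in># S')"
proof -
  have "(phase j, t) \<in># S" using sub by (rule mset_subset_eqD) (simp add: consumed_def)
  with S have j: "j = i" and t: "t = 0" by (simp_all add: good_phase)
  note S = goodD[OF S]
  let ?A = "consumed \<phi> i 0 Y" and ?B = "created \<phi> i 0 Y"
  have keep: "f \<in># S'" if "f \<in># S" "f \<notin># ?A" for f
    using in_diff_notin[OF that] by (simp add: S' j t)
  have new: "f \<in># S \<or> f \<in># ?B" if "f \<in># S'" for f
    using that by (auto simp: S' j t dest: in_diffD)
  have filter: "filter_mset P S' = filter_mset P S - filter_mset P ?A + filter_mset P ?B" for P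
    by (simp add: S' j t)
  have cell: "cell x S' = cell x S + of_bool (x \<in> set (bl (2 * i + 1)))" for x
  proof -
    let ?P = "\<lambda>f :: atom \<times> nat. fst f = unset (cst x) \<or> (\<exists>y. fst f = val (cst x) y)"
    have A: "filter_mset ?P ?A = {#}"
      by (simp add: consumed_def filter_image_none)
    have B: "filter_mset ?P ?B = mset (map (\<lambda>x. (val (cst x) (Y x), 1)) (filter (\<lambda>y. y = x) (bl (2 * i + 1))))"
      unfolding created_def by (simp add: filter_map comp_def flip: mset_filter mset_map)
    show ?thesis
      using distinct_bl[of "2 * i + 1"] i unfolding cell_def filter A B by (simp add: filter_eq_distinct)
  qed
  have later: "x \<notin> set (bl (2 * i + 1))" if "Suc i \<le> m" "m < n" "x \<in> set (bl (2 * m + 1))" for m x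
    using bl_unique[of "2 * i + 1" "2 * m + 1" x] that by auto
  have "\<exists>t. {#f \<in># S'. fst f = now_atom#} = {#(now_atom, t)#}"
  proof -
    have A: "{#f \<in># ?A. fst f = now_atom#} = {#}" and B: "{#f \<in># ?B. fst f = now_atom#} = {#}"
      by (simp_all add: consumed_def created_def filter_image_none)
    show ?thesis using S(1) unfolding filter A B by simp
  qed
  moreover have "{#f \<in># S'. atom_pred (fst f) = Pred 0#} = {#(phase (Suc i), 0)#}"
  proof -
    have A: "{#f \<in># ?A. atom_pred (fst f) = Pred 0#} = {#(phase i, 0)#}"
      and B: "{#f \<in># ?B. atom_pred (fst f) = Pred 0#} = {#(phase (Suc i), 0)#}"
      by (simp_all add: consumed_def created_def filter_image_none)
    show ?thesis using S(2) unfolding filter A B by simp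
  qed
  moreover have "(fuel m, 0) \<in># S'" if "Suc i \<le> m" "m < n" for m
    by (rule keep) (use S(3) that in \<open>auto simp: consumed_def\<close>)
  moreover have "(opt (cst x) (tv b), 0) \<in># S'" if "Suc i \<le> m" "m < n" "x \<in> set (bl (2 * m + 1))" for m x b
    by (rule keep) (use S(4)[of m x b] that later[OF that] in \<open>auto simp: consumed_def\<close>)
  moreover have "\<exists>b. y = tv b" if "(opt x y, t) \<in># S'" for x y t
  proof -
    have "(opt x y, t) \<in># S" using new[OF that] by (auto simp: created_def)
    then show ?thesis by (rule S(5))
  qed
  moreover have "cell x S' \<le> 1" for x
    using S(6)[of x] S(7)[of i x] i by (simp add: cell)
  moreover have "cell x S' = 0" if "Suc i \<le> m" "m < n" "x \<in> set (bl (2 * m + 1))" for m x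
    using S(7)[of m x] that later[OF that] by (simp add: cell)
  moreover have val: "(val x y, t) \<in># S'" if "(val x y, t) \<in># S" for x y t
    by (rule keep[OF that]) (auto simp: consumed_def)
  moreover have "\<exists>j<3. \<exists>t'. (val (ts ! (2 * j + 1)) (ts ! (2 * j)), t') \<in># S'" if "(sat ts, t) \<in># S'" for ts t
  proof -
    have "(sat ts, t) \<in># S" using new[OF that] by (auto simp: created_def)
    from S(8)[OF this] have "\<exists>j<3. \<exists>t'. (val (ts ! (2 * j + 1)) (ts ! (2 * j)), t') \<in># S" .
    then show ?thesis using val by blast
  qed
  moreover have "\<exists>b. y = tv b" if v: "(val x y, t') \<in># S'" for x y t'
  proof -
    \<comment> \<open>The chosen values come from consumed options, which name truth values only:
      the opponent is confined to Boolean choices.\<close>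
    have opt: "\<exists>b. Y x = tv b" if "x \<in> set (bl (2 * i + 1))" for x
    proof -
      have "(opt (cst x) (Y x), t) \<in># consumed \<phi> j t Y" using that by (simp add: consumed_def j)
      with sub have "(opt (cst x) (Y x), t) \<in># S" by (rule mset_subset_eqD)
      then show ?thesis by (rule S(5))
    qed
    consider "(val x y, t') \<in># S" | "(val x y, t') \<in># ?B" using new[OF v] by blast
    then show ?thesis
    proof cases
      case 1
      then show ?thesis by (rule S(9))
    next
      case 2
      then obtain z where "z \<in> set (bl (2 * i + 1))" "y = Y z" by (auto simp: created_def)
      then show ?thesis using opt by simp
    qed
  qed
  ultimately show ?thesis using j t unfolding good_def by blast
qed

lemma sel_iff: "x \<in> set (selected_vars P \<phi>) \<longleftrightarrow> (\<exists>j\<le>2 * n. P j \<and> x \<in> set (bl j))"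
proof -
  have "set [0..<length (blocks \<phi>)] = {..2 * n}" by (auto simp: length_blocks)
  then show ?thesis unfolding selected_vars_def set_concat set_map by (auto split: if_splits)
qed

lemma distinct_selected: "distinct (selected_vars P \<phi>)"
proof -
  have "distinct (concat (map (\<lambda>j. if P j then bl j else []) js))"
    if "distinct js" "set js \<subseteq> {..2 * n}" for js
    using that
  proof (induction js)
    case (Cons j js)
    have "set (bl j) \<inter> set (concat (map (\<lambda>j. if P j then bl j else []) js)) = {}"
      using Cons.prems bl_unique[of j] by (fastforce split: if_splits)
    then show ?case using Cons distinct_bl by auto
  qed simp
  moreover have "set [0..<length (blocks \<phi>)] \<subseteq> {..2 * n}" by (auto simp: length_blocks)
  moreover have "distinct [0..<length (blocks \<phi>)]" by simp
  ultimately show ?thesis unfolding selected_vars_def by blast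
qed

lemma good_start: "good n \<phi> 0 (mset (start n \<phi>))"
proof -
  have cell: "cell x (mset (start n \<phi>)) = of_bool (x \<in> set (selected_vars even \<phi>))" for x
  proof -
    let ?P = "\<lambda>f :: atom \<times> nat. fst f = unset (cst x) \<or> (\<exists>y. fst f = val (cst x) y)"
    have "filter ?P (start n \<phi>) =
        map (\<lambda>x. (unset (cst x), 0)) (filter (\<lambda>y. y = x) (selected_vars even \<phi>))"
      by (simp add: start_def filter_map comp_def filter_concat filter_empty_conv)
    then show ?thesis
      using distinct_selected by (simp add: cell_def filter_eq_distinct flip: mset_filter)
  qed
  have "filter (\<lambda>f. fst f = now_atom) (start n \<phi>) = [(now_atom, 0)]"
    "filter (\<lambda>f. atom_pred (fst f) = Pred 0) (start n \<phi>) = [(phase 0, 0)]"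
    by (auto simp: start_def filter_empty_conv filter_concat)
  then have "{#f \<in># mset (start n \<phi>). fst f = now_atom#} = {#(now_atom, 0)#}"
    "{#f \<in># mset (start n \<phi>). atom_pred (fst f) = Pred 0#} = {#(phase 0, 0)#}"
    by (simp_all flip: mset_filter)
  moreover have "cell x (mset (start n \<phi>)) \<le> 1" for x by (simp add: cell)
  moreover have "cell x (mset (start n \<phi>)) = 0" if "j < n" "x \<in> set (bl (2 * j + 1))" for j x
  proof -
    have "x \<notin> set (selected_vars even \<phi>)"
      using that bl_unique[of "2 * j + 1" _ x] unfolding sel_iff by fastforce
    then show ?thesis by (simp add: cell)
  qed
  moreover have "(opt (cst x) (tv b), 0) \<in> set (start n \<phi>)" if "j < n" "x \<in> set (bl (2 * j + 1))" for j x b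
  proof -
    have "x \<in> set (selected_vars odd \<phi>)" using that by (auto simp: sel_iff intro!: exI[of _ "2 * j + 1"])
    then show ?thesis by (cases b) (auto simp: start_def)
  qed
  moreover have "\<exists>b. y = tv b" if "(opt x y, t) \<in> set (start n \<phi>)" for x y t
  proof -
    have "y = tv False \<or> y = tv True" using that by (auto simp: start_def)
    then show ?thesis by blast
  qed
  moreover have "(fuel j, 0) \<in> set (start n \<phi>)" if "j < n" for j
    using that by (auto simp: start_def)
  moreover have "(sat ts, t) \<notin> set (start n \<phi>)" for ts t by (auto simp: start_def)
  moreover have "(val x y, t) \<notin> set (start n \<phi>)" for x y t by (auto simp: start_def)
  ultimately show ?thesis unfolding good_def set_mset_mset by blast
qed

end

section \<open>Resilience and truth\<close>

lemma ex_less_3: "(\<exists>j<3. P j) \<longleftrightarrow> P 0 \<or> P 1 \<or> P (2 :: nat)"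
  by (auto simp: numeral_3_eq_3 numeral_2_eq_2 less_Suc_eq)

lemma length_clause_nums [simp]: "length (clause_nums c) = 6"
  by (auto simp: clause_nums_def split: prod.splits)

lemma clause_lits_iff:
  "(s, v) \<in> clause_lits c \<longleftrightarrow> (\<exists>j<3. clause_nums c ! (2 * j) = of_bool s \<and> clause_nums c ! (2 * j + 1) = v)"
proof -
  obtain s1 v1 s2 v2 s3 v3 where "c = ((s1, v1), (s2, v2), (s3, v3))"
    by (metis prod.exhaust)
  then show ?thesis unfolding ex_less_3 by (auto simp: clause_nums_def of_bool_eq_iff)
qed

lemma clause_nums_sign:
  assumes "j < 3"
  shows "\<exists>s. clause_nums c ! (2 * j) = of_bool s"
proof -
  obtain s1 v1 s2 v2 s3 v3 where c: "c = ((s1, v1), (s2, v2), (s3, v3))"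
    by (metis prod.exhaust)
  have "clause_nums c ! (2 * j) = of_bool ([s1, s2, s3] ! j)"
    using assms by (auto simp: c clause_nums_def less_Suc_eq numeral_3_eq_3)
  then show ?thesis by blast
qed

text \<open>Truth of the matrix in the form tested by the check rules.\<close>

lemma matrix_true_iff:
  "matrix_true cs \<alpha> \<longleftrightarrow>
     (\<forall>c\<in>set cs. \<exists>j<3. clause_nums c ! (2 * j) = of_bool (\<alpha> (clause_nums c ! (2 * j + 1))))"
proof -
  have "(\<exists>(s, v)\<in>clause_lits c. \<alpha> v = s) \<longleftrightarrow>
      (\<exists>j<3. clause_nums c ! (2 * j) = of_bool (\<alpha> (clause_nums c ! (2 * j + 1))))" for c
    unfolding Bex_def split_paired_Ex prod.case clause_lits_iff by blast
  then show ?thesis unfolding matrix_true_def by simp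
qed

text \<open>Tick-free runs. \<open>P\<close> is imposed on every configuration entered, because an
  update may strike at any of them.\<close>

definition path :: "(config \<Rightarrow> bool) \<Rightarrow> config \<Rightarrow> (action \<times> config) list \<Rightarrow> config \<Rightarrow> bool" where
  "path P S ss T \<longleftrightarrow> linked sig (set sys_rules) S ss \<and> last (S # map snd ss) = T \<and>
     (\<forall>(\<alpha>, U)\<in>set ss. \<alpha> \<noteq> Tick \<and> P U)"

lemma linked_append:
  "linked Sg R S (ss @ ss') \<longleftrightarrow> linked Sg R S ss \<and> linked Sg R (last (S # map snd ss)) ss'"
proof (induction ss arbitrary: S)
  case (Cons s ss)
  obtain \<alpha> S' where s: "s = (\<alpha>, S')" by (cases s)
  show ?case using Cons.IH[of S'] by (simp add: s conj_assoc del: step.simps)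
qed simp

lemma path_Nil: "path P S [] S"
  by (simp add: path_def)

lemma path_append: "path P S ss T \<Longrightarrow> path P T ss' U \<Longrightarrow> path P S (ss @ ss') U"
  by (auto simp: path_def linked_append last_append split: if_splits)

lemma path_single: "step sig (set sys_rules) (Inst r) S T \<Longrightarrow> P T \<Longrightarrow> path P S [(Inst r, T)] T"
  by (simp add: path_def)

lemma path_weaken: "path P S ss T \<Longrightarrow> (\<And>U. P U \<Longrightarrow> Q U) \<Longrightarrow> path Q S ss T"
  by (auto simp: path_def)

text \<open>Without ticks the time budget is met for all \<open>a\<close> and \<open>b\<close>, and
  nothing is ever critical; only the goal is left to reach.\<close>

lemma path_resilient_0:
  assumes "path P S ss T" "goal_config sig (qbf_scenario n \<phi>) T"
  shows "resilient sig (qbf_scenario n \<phi>) 0 a b S (S, ss)"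
proof -
  have "filter (\<lambda>(\<alpha>, S). \<alpha> = Tick) ss = []"
    unfolding filter_empty_conv using assms(1) unfolding path_def by blast
  then have "num_ticks (S, ss) = 0" by (simp add: num_ticks_def)
  moreover have "trace_from sig (set (system_rules (qbf_scenario n \<phi>))) S (S, ss)"
    using assms(1) by (simp add: path_def trace_from_def)
  moreover have "last (trace_configs (S, ss)) = T"
    using assms(1) unfolding path_def trace_configs_def fst_conv snd_conv by blast
  ultimately show ?thesis
    using assms(2) compliant_scen by simp
qed

lemma subset_diff_disjoint:
  assumes "A \<subseteq># S" "set_mset A \<inter> set_mset B = {}"
  shows "A \<subseteq># S - B"
  unfolding subseteq_mset_def
proof
  fix a
  have "count A a \<le> count S a" using assms(1) by (rule mset_subset_eq_count)
  moreover have "a \<in># A \<Longrightarrow> count B a = 0" using assms(2) by (auto simp: not_in_iff)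
  ultimately show "count A a \<le> count (S - B) a" by (cases "a \<in># A") (simp_all add: not_in_iff)
qed

lemma sum_subset_disjoint:
  assumes "A \<subseteq># S" "B \<subseteq># S" "set_mset A \<inter> set_mset B = {}"
  shows "A + B \<subseteq># S"
proof -
  have "A \<subseteq># S - B" by (rule subset_diff_disjoint) fact+
  then have "A + B \<subseteq># (S - B) + B" by simp
  with assms(2) show ?thesis by simp
qed

abbreviation "todo_fact c \<equiv> (todo (map cst (clause_nums c)), 0 :: nat)"
abbreviation "sat_fact c \<equiv> (sat (map cst (clause_nums c)), 1 :: nat)"

text \<open>\<open>D\<close> collects the facts that must survive: the global time, other facts of
  the goal, and the marks made so far. Multiset inclusion is essential, as a repeated clause has one
  token, and one mark required by the goal, per occurrence.\<close>

lemma mark_path: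
  assumes "D + mset (map todo_fact cs) \<subseteq># S" "(now_atom, 0) \<in># D"
    and "\<And>c. c \<in> set cs \<Longrightarrow>
      \<exists>j<3. (val (cst (clause_nums c ! (2 * j + 1))) (cst (clause_nums c ! (2 * j))), 1) \<in># S"
  shows "\<exists>ss T. path (\<lambda>_. True) S ss T \<and> D + mset (map sat_fact cs) \<subseteq># T"
  using assms
proof (induction cs arbitrary: S D)
  case Nil
  have "path (\<lambda>_. True) S [] S" by (rule path_Nil)
  with Nil(1) show ?case by auto
next
  case (Cons c cs)
  let ?S' = "S - {#todo_fact c#} + {#sat_fact c#}"
  have now: "(now_atom, 0) \<in># S"
    using Cons.prems(1,2) by (meson mset_subset_eqD union_iff)
  have todo: "todo_fact c \<in># S" using Cons.prems(1) by (rule mset_subset_eqD) simp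
  obtain j where j: "j < 3"
    "(val (cst (clause_nums c ! (2 * j + 1))) (cst (clause_nums c ! (2 * j))), 1) \<in># S"
    using Cons.prems(3)[of c] by auto
  have step: "step sig (set sys_rules) (Inst (check_rule j)) S ?S'"
    using check_stepI[OF now todo length_clause_nums j] by simp
  obtain R where R: "S = add_mset (todo_fact c) R" using todo by (metis multi_member_split)
  have sub: "(add_mset (sat_fact c) D) + mset (map todo_fact cs) \<subseteq># ?S'"
    using Cons.prems(1) by (simp add: R)
  have "\<exists>j<3. (val (cst (clause_nums c' ! (2 * j + 1))) (cst (clause_nums c' ! (2 * j))), 1) \<in># ?S'"
    if "c' \<in> set cs" for c'
    using Cons.prems(3)[of c'] that by (auto simp: R)
  moreover have "(now_atom, 0) \<in># add_mset (sat_fact c) D" using Cons.prems(2) by simp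
  ultimately have "\<exists>ss T. path (\<lambda>_. True) ?S' ss T \<and>
      add_mset (sat_fact c) D + mset (map sat_fact cs) \<subseteq># T"
    by (intro Cons.IH[OF sub]) blast+
  then obtain ss T where path: "path (\<lambda>_. True) ?S' ss T"
    and sub: "add_mset (sat_fact c) D + mset (map sat_fact cs) \<subseteq># T"
    by blast
  have "path (\<lambda>_. True) S ([(Inst (check_rule j), ?S')] @ ss) T"
    by (rule path_append[OF path_single[OF step TrueI] path])
  moreover have "D + mset (map sat_fact (c # cs)) \<subseteq># T" using sub by simp
  ultimately show ?case by blast
qed

context game
begin

definition decided :: "nat \<Rightarrow> nat set" where
  "decided j = (\<Union>i<j. set (bl i))"

lemma decided_Suc: "decided (Suc j) = decided j \<union> set (bl j)"
  by (auto simp: decided_def less_Suc_eq)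

lemma decided_disjoint:
  assumes "j \<le> 2 * n" "x \<in> decided j"
  shows "x \<notin> set (bl j)"
proof
  assume x: "x \<in> set (bl j)"
  obtain i where i: "i < j" "x \<in> set (bl i)" using assms(2) unfolding decided_def by blast
  have "i = j" by (rule bl_unique[OF _ assms(1) i(2) x]) (use i assms in simp)
  with i show False by simp
qed

lemma override_decided:
  "j \<le> 2 * n \<Longrightarrow> x \<in> decided j \<Longrightarrow> override_on \<alpha> \<beta> (set (bl j)) x = \<alpha> x"
  using decided_disjoint by (simp add: override_on_def)

lemma drop_blocks: "j \<le> 2 * n \<Longrightarrow> drop j (blocks \<phi>) = bl j # drop (Suc j) (blocks \<phi>)"
  by (simp add: Cons_nth_drop_Suc length_blocks)

lemma matrix_vars:
  assumes "c \<in> set (matrix \<phi>)" "j < 3"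
  shows "clause_nums c ! (2 * j + 1) \<in> decided (2 * n + 1)"
proof -
  obtain s where "(s, clause_nums c ! (2 * j + 1)) \<in> clause_lits c"
    unfolding clause_lits_iff using clause_nums_sign[OF assms(2)] assms(2) by blast
  then have "clause_nums c ! (2 * j + 1) \<in> set (concat (blocks \<phi>))"
    using formula assms(1) unfolding sigma_formula_def by force
  then show ?thesis
    using length_blocks by (auto simp: decided_def in_set_conv_nth[of _ "blocks \<phi>"])
qed

definition agrees :: "nat \<Rightarrow> (nat \<Rightarrow> bool) \<Rightarrow> config \<Rightarrow> bool" where
  "agrees j \<alpha> S \<longleftrightarrow> (\<forall>x\<in>decided j. \<exists>t. (val (cst x) (tv (\<alpha> x)), t) \<in># S)"

lemma agrees_mono:
  "agrees j \<alpha> S \<Longrightarrow> \<forall>x y t. (val x y, t) \<in># S \<longrightarrow> (val x y, t) \<in># T \<Longrightarrow> agrees j \<alpha> T"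
  unfolding agrees_def by blast

lemma agrees_extend:
  assumes "agrees j \<alpha> S" "j \<le> 2 * n"
    and "\<And>x. x \<in> set (bl j) \<Longrightarrow> \<exists>t. (val (cst x) (tv (\<beta> x)), t) \<in># S"
  shows "agrees (Suc j) (override_on \<alpha> \<beta> (set (bl j))) S"
  unfolding agrees_def
proof
  fix x assume "x \<in> decided (Suc j)"
  then consider "x \<in> decided j" | "x \<in> set (bl j)" by (auto simp: decided_Suc)
  then show "\<exists>t. (val (cst x) (tv (override_on \<alpha> \<beta> (set (bl j)) x)), t) \<in># S"
    using assms by cases (simp_all only: agrees_def override_on_apply_in override_decided)
qed

text \<open>Justifies reading an assignment off a configuration by asking for the value True only:
  by uniqueness of values, a variable with value False cannot pass this test.\<close>

lemma read_val:
  assumes "good n \<phi> i S" "(val (cst x) (tv s), t) \<in># S"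
  shows "(\<exists>t. (val (cst x) (tv True), t) \<in># S) = s"
proof (cases s)
  case True
  with assms(2) show ?thesis by (simp only: simp_thms) blast
next
  case False
  then have "tv True \<noteq> tv s" by simp
  with False show ?thesis using good_val_unique[OF assms] by metis
qed

subsection \<open>Soundness\<close>

lemma resilient_goal:
  assumes "resilient sig (qbf_scenario n \<phi>) m a b S \<tau>" "good n \<phi> i S"
  defines "T \<equiv> last (trace_configs \<tau>)"
  shows "goal_config sig (qbf_scenario n \<phi>) T" "good n \<phi> i T" "T \<in> set (trace_configs \<tau>)"
    "\<forall>x y t. (val x y, t) \<in># S \<longrightarrow> (val x y, t) \<in># T"
proof -
  have "resilient sig (qbf_scenario n \<phi>) 0 a b S \<tau>" using assms(1) by (cases m) auto
  then have l: "fst \<tau> = S" "linked sig (set sys_rules) S (snd \<tau>)" and g: "goal_config sig (qbf_scenario n \<phi>) T"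
    by (auto simp: trace_from_def T_def)
  have T: "T = last (S # map snd (snd \<tau>))" by (simp only: T_def trace_configs_def l)
  show "goal_config sig (qbf_scenario n \<phi>) T" by (rule g)
  show "good n \<phi> i T" "\<forall>x y t. (val x y, t) \<in># S \<longrightarrow> (val x y, t) \<in># T"
    unfolding T using good_linked[OF assms(2) l(2)] by blast+
  show "T \<in> set (trace_configs \<tau>)" unfolding T_def by (rule last_in_set) (simp add: trace_configs_def)
qed

text \<open>Induction on the number of updates left. The last configuration of the trace supplies
  the assignment of the existential block, and each assignment of the next universal block is
  realised by an update right there; resilience then yields a trace for the induction
  hypothesis.\<close>

lemma sound:
  assumes "i + m = n" "good n \<phi> i S" "agrees (2 * i) \<alpha> S" "resilient sig (qbf_scenario n \<phi>) m a b S \<tau>"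
  shows "prefix_true True (drop (2 * i) (blocks \<phi>)) (matrix_true (matrix \<phi>)) \<alpha>"
  using assms
proof (induction m arbitrary: i S \<alpha> a \<tau>)
  case 0
  define T where "T = last (trace_configs \<tau>)"
  note T = resilient_goal[OF 0(4,2), folded T_def]
  have i: "i = n" using 0 by simp
  \<comment> \<open>A variable of the last block may never have been set and then counts as False.
    This is harmless: each marked clause has a true literal whose variable does have a
    value.\<close>
  define \<beta> where "\<beta> x \<longleftrightarrow> (\<exists>t. (val (cst x) (tv True), t) \<in># T)" for x
  have agT: "agrees (2 * n) \<alpha> T" using agrees_mono[OF 0(3) T(4)] by (simp add: i)
  have sat: "\<exists>t. (sat (map cst (clause_nums c)), t) \<in># T" if "c \<in> set (matrix \<phi>)" for c
    using T(1)
  proof (cases rule: goal_cases)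
    case (stage j Y t t')
    then show ?thesis using good_phase[OF T(2), of j t] i by simp
  next
    case (final t t')
    then show ?thesis using that by blast
  qed
  let ?\<alpha> = "override_on \<alpha> \<beta> (set (bl (2 * n)))"
  have "\<exists>j<3. clause_nums c ! (2 * j) = of_bool (?\<alpha> (clause_nums c ! (2 * j + 1)))" if c: "c \<in> set (matrix \<phi>)" for c
  proof -
    obtain j t where j: "j < 3"
      and val: "(val (map cst (clause_nums c) ! (2 * j + 1)) (map cst (clause_nums c) ! (2 * j)), t) \<in># T"
      using sat[OF c] goodD(8)[OF T(2)] by blast
    let ?v = "clause_nums c ! (2 * j + 1)"
    obtain s where s: "clause_nums c ! (2 * j) = of_bool s" using clause_nums_sign[OF j] by blast
    have val: "(val (cst ?v) (tv s), t) \<in># T" using val j by (simp add: s)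
    have "?\<alpha> ?v = s"
    proof (cases "?v \<in> set (bl (2 * n))")
      case True
      have "\<beta> ?v = s" unfolding \<beta>_def by (rule read_val[OF T(2) val])
      with True show ?thesis by simp
    next
      case False
      then have "?v \<in> decided (2 * n)" using matrix_vars[OF c j] decided_Suc[of "2 * n"] by auto
      with agT obtain t' where "(val (cst ?v) (tv (\<alpha> ?v)), t') \<in># T" unfolding agrees_def by blast
      from good_val_unique[OF T(2) this val] have "\<alpha> ?v = s" by (simp only: trm.inject of_bool_eq_iff)
      with False show ?thesis by simp
    qed
    with j s show ?thesis by blast
  qed
  then have "matrix_true (matrix \<phi>) ?\<alpha>" unfolding matrix_true_iff by blast
  then show ?case using drop_blocks[of "2 * n"] length_blocks by (auto simp: i)
next
  case (Suc m)
  define T where "T = last (trace_configs \<tau>)"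
  note T = resilient_goal[OF Suc.prems(4,2), folded T_def]
  have i: "i < n" using Suc.prems(1) by simp
  obtain Y t' where now: "(now_atom, 0) \<in># T" and Y: "\<And>x. x \<in> set (bl (2 * i)) \<Longrightarrow> (val (cst x) (Y x), t') \<in># T"
    using T(1)
  proof (cases rule: goal_cases)
    case (stage j Y t t')
    then show ?thesis using good_phase[OF T(2), of j t] that by blast
  next
    case (final t t')
    then show ?thesis using good_phase[OF T(2), of n t] i by simp
  qed
  have ph: "(phase i, 0) \<in># T" using good_phase[OF T(2), of i 0] by simp
  define \<beta> where "\<beta> x \<longleftrightarrow> (\<exists>t. (val (cst x) (tv True), t) \<in># T)" for x
  let ?\<alpha> = "override_on \<alpha> \<beta> (set (bl (2 * i)))"
  have agT: "agrees (Suc (2 * i)) ?\<alpha> T"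
  proof (rule agrees_extend)
    show "agrees (2 * i) \<alpha> T" by (rule agrees_mono[OF Suc.prems(3) T(4)])
    show "\<exists>t. (val (cst x) (tv (\<beta> x)), t) \<in># T" if "x \<in> set (bl (2 * i))" for x
    proof -
      from goodD(9)[OF T(2) Y[OF that]] obtain s where s: "Y x = tv s" by blast
      with Y[OF that] have val: "(val (cst x) (tv s), t') \<in># T" by simp
      moreover have "\<beta> x = s" unfolding \<beta>_def by (rule read_val[OF T(2) val])
      ultimately show ?thesis by blast
    qed
  qed (use i in simp)
  \<comment> \<open>For an arbitrary \<open>\<gamma>\<close>, the update picks the options named by
    \<open>\<gamma>\<close>; this is the universal quantifier.\<close>
  have "prefix_true True (drop (2 * Suc i) (blocks \<phi>)) (matrix_true (matrix \<phi>))
      (override_on ?\<alpha> \<gamma> (set (bl (2 * i + 1))))" for \<gamma>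
  proof -
    let ?Y = "\<lambda>x. tv (\<gamma> x)"
    define S' where "S' = T - consumed \<phi> i 0 ?Y + created \<phi> i 0 ?Y"
    have ap: "apply_rule sig (update_rule \<phi> i) T S'"
      unfolding S'_def
      by (rule update_ruleI[OF now ph])
        (use i goodD(3,4)[OF T(2), of i] distinct_bl[of "2 * i + 1"] in auto)
    have sub: "consumed \<phi> i 0 ?Y \<subseteq># T"
    proof (rule subset_mset.order_trans)
      show "mset ((phase i, 0) # (fuel i, 0) # map (\<lambda>x. (opt (cst x) (?Y x), 0)) (bl (2 * i + 1))) \<subseteq># T"
        by (rule mset_subset_distinct)
          (use i ph goodD(3,4)[OF T(2), of i] distinct_bl[of "2 * i + 1"] in
            \<open>auto simp: distinct_map inj_on_def\<close>)
    qed (simp add: consumed_def)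
    note S' = good_update[OF T(2) i sub S'_def]
    have good': "good n \<phi> (Suc i) S'" using S' by blast
    have "agrees (Suc (Suc (2 * i))) (override_on ?\<alpha> \<gamma> (set (bl (Suc (2 * i))))) S'"
    proof (rule agrees_extend)
      show "agrees (Suc (2 * i)) ?\<alpha> S'" using agrees_mono[OF agT] S' by blast
      show "\<exists>t. (val (cst x) (tv (\<gamma> x)), t) \<in># S'" if "x \<in> set (bl (Suc (2 * i)))" for x
      proof -
        have "(val (cst x) (tv (\<gamma> x)), 1) \<in># created \<phi> i 0 ?Y"
          using that by (auto simp: created_def split del: split_of_bool)
        then have "(val (cst x) (tv (\<gamma> x)), 1) \<in># S'" by (simp add: S'_def split del: split_of_bool)
        then show ?thesis by blast
      qed
    qed (use i in simp)
    then have ag': "agrees (2 * Suc i) (override_on ?\<alpha> \<gamma> (set (bl (2 * i + 1)))) S'" by simp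
    have "global_time T = 0" by (rule good_time[OF T(2) now])
    \<comment> \<open>By truncated subtraction the difference is 0 whatever the time of
      \<open>S\<close>, so the update is within the limit \<open>a\<close>.\<close>
    then have le: "global_time T - global_time S \<le> a" by simp
    have "update_rule \<phi> i \<in> set (update_rules (qbf_scenario n \<phi>))" using i by simp
    with Suc.prems(4) T(3) ap le obtain \<tau>' where
      \<tau>': "resilient sig (qbf_scenario n \<phi>) m (a - (global_time T - global_time S)) b S' \<tau>'"
      unfolding resilient.simps(2) by blast
    show ?thesis by (rule Suc.IH[OF _ good' ag' \<tau>']) (use Suc.prems(1) in simp)
  qed
  then have "prefix_true True (bl (2 * i) # bl (2 * i + 1) # drop (2 * Suc i) (blocks \<phi>))
      (matrix_true (matrix \<phi>)) \<alpha>"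
    by auto
  moreover have "drop (2 * i) (blocks \<phi>) = bl (2 * i) # bl (2 * i + 1) # drop (2 * Suc i) (blocks \<phi>)"
    using drop_blocks[of "2 * i"] drop_blocks[of "2 * i + 1"] i by simp
  ultimately show ?case by simp
qed

subsection \<open>Completeness\<close>

text \<open>
  The first \<open>j\<close> blocks are decided by \<open>\<alpha>\<close>; the player may still have to write down the values of
  decided existential variables if the update came early.
\<close>

definition ready :: "nat \<Rightarrow> (nat \<Rightarrow> bool) \<Rightarrow> config \<Rightarrow> bool" where
  "ready j \<alpha> S \<longleftrightarrow> (now_atom, 0) \<in># S \<and>
     (\<forall>m x. m \<le> n \<and> x \<in> set (bl (2 * m)) \<longrightarrow>
        (unset (cst x), 0) \<in># S \<or> 2 * m < j \<and> (val (cst x) (tv (\<alpha> x)), 1) \<in># S) \<and>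
     (\<forall>m x. 2 * m + 1 < j \<and> x \<in> set (bl (2 * m + 1)) \<longrightarrow> (val (cst x) (tv (\<alpha> x)), 1) \<in># S) \<and>
     mset (map todo_fact (matrix \<phi>)) \<subseteq># S"

lemma readyD:
  assumes "ready j \<alpha> S"
  shows "(now_atom, 0) \<in># S"
    and "m \<le> n \<Longrightarrow> x \<in> set (bl (2 * m)) \<Longrightarrow>
        (unset (cst x), 0) \<in># S \<or> 2 * m < j \<and> (val (cst x) (tv (\<alpha> x)), 1) \<in># S"
    and "2 * m + 1 < j \<Longrightarrow> x \<in> set (bl (2 * m + 1)) \<Longrightarrow> (val (cst x) (tv (\<alpha> x)), 1) \<in># S"
    and "mset (map todo_fact (matrix \<phi>)) \<subseteq># S"
  using assms unfolding ready_def by blast+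

lemma readyI:
  assumes "(now_atom, 0) \<in># S"
    and "\<And>m x. m \<le> n \<Longrightarrow> x \<in> set (bl (2 * m)) \<Longrightarrow>
        (unset (cst x), 0) \<in># S \<or> 2 * m < j \<and> (val (cst x) (tv (\<alpha> x)), 1) \<in># S"
    and "\<And>m x. 2 * m + 1 < j \<Longrightarrow> x \<in> set (bl (2 * m + 1)) \<Longrightarrow> (val (cst x) (tv (\<alpha> x)), 1) \<in># S"
    and "mset (map todo_fact (matrix \<phi>)) \<subseteq># S"
  shows "ready j \<alpha> S"
  using assms unfolding ready_def by blast

text \<open>The player decides a whole block without any step. This is consistent because only
  variables of earlier blocks can have values so far, and the new assignment agrees with the old one
  on them.\<close>

lemma ready_existential:
  assumes "ready (2 * i) \<alpha> S" "i \<le> n"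
  shows "ready (Suc (2 * i)) (override_on \<alpha> \<beta> (set (bl (2 * i)))) S"
proof (rule readyI)
  note R = readyD[OF assms(1)]
  have same: "override_on \<alpha> \<beta> (set (bl (2 * i))) x = \<alpha> x" if "j < 2 * i" "x \<in> set (bl j)" for j x
  proof (rule override_decided)
    show "x \<in> decided (2 * i)" using that by (auto simp: decided_def)
  qed (use assms(2) in simp)
  show "(now_atom, 0) \<in># S" by (rule R(1))
  show "(unset (cst x), 0) \<in># S \<or>
      2 * m < Suc (2 * i) \<and> (val (cst x) (tv (override_on \<alpha> \<beta> (set (bl (2 * i))) x)), 1) \<in># S"
    if x: "m \<le> n" "x \<in> set (bl (2 * m))" for m x
  proof -
    consider "(unset (cst x), 0) \<in># S" | "2 * m < 2 * i" "(val (cst x) (tv (\<alpha> x)), 1) \<in># S"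
      using R(2)[OF x] by blast
    then show ?thesis
    proof cases
      case 2
      show ?thesis unfolding same[OF 2(1) x(2)] using 2 less_SucI by blast
    qed blast
  qed
  show "(val (cst x) (tv (override_on \<alpha> \<beta> (set (bl (2 * i))) x)), 1) \<in># S"
    if "2 * m + 1 < Suc (2 * i)" "x \<in> set (bl (2 * m + 1))" for m x
  proof -
    have lt: "2 * m + 1 < 2 * i" using that(1) by presburger
    show ?thesis unfolding same[OF lt that(2)] by (rule R(3)[OF lt that(2)])
  qed
  show "mset (map todo_fact (matrix \<phi>)) \<subseteq># S" by (rule R(4))
qed

lemma ready_set:
  assumes R: "ready j \<alpha> S" and "m \<le> n" "x \<in> set (bl (2 * m))" "2 * m < j" "(unset (cst x), 0) \<in># S"
  shows "ready j \<alpha> (S - {#(unset (cst x), 0)#} + {#(val (cst x) (tv (\<alpha> x)), 1)#})" (is "ready j \<alpha> ?S")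
proof (rule readyI)
  note R = readyD[OF R]
  have keep: "f \<in># ?S" if "f \<in># S" "f \<noteq> (unset (cst x), 0)" for f
    using that by (simp add: in_diff_count)
  show "(now_atom, 0) \<in># ?S" by (rule keep[OF R(1)]) simp
  show "(unset (cst y), 0) \<in># ?S \<or> 2 * k < j \<and> (val (cst y) (tv (\<alpha> y)), 1) \<in># ?S"
    if y: "k \<le> n" "y \<in> set (bl (2 * k))" for k y
  proof (cases "y = x")
    case True
    then have "2 * k = 2 * m" using bl_unique[of "2 * k" "2 * m" x] y assms by simp
    with assms(4) have "2 * k < j" by simp
    moreover have "(val (cst x) (tv (\<alpha> x)), 1) \<in># ?S" by simp
    ultimately show ?thesis unfolding True by blast
  next
    case False
    then have "(unset (cst y), 0 :: nat) \<noteq> (unset (cst x), 0)" by simp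
    moreover have "(val (cst y) (tv (\<alpha> y)), 1 :: nat) \<noteq> (unset (cst x), 0)" by simp
    ultimately show ?thesis using R(2)[OF y] keep by blast
  qed
  show "(val (cst y) (tv (\<alpha> y)), 1) \<in># ?S" if "2 * k + 1 < j" "y \<in> set (bl (2 * k + 1))" for k y
    by (rule keep[OF R(3)[OF that]]) simp
  have "mset (map todo_fact (matrix \<phi>)) \<subseteq># S - {#(unset (cst x), 0)#}"
    by (rule subset_diff_disjoint[OF R(4)]) auto
  then show "mset (map todo_fact (matrix \<phi>)) \<subseteq># ?S"
    by (rule subset_mset.order_trans) simp
qed

text \<open>\<open>xs\<close> may contain variables of all existential blocks up to the current one,
  since early updates leave tokens of earlier blocks pending; a variable already set takes no step.
  Both invariants are recorded along the path for the updates that may strike there.\<close>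

lemma fill_path:
  assumes "good n \<phi> i S" "ready (Suc (2 * i)) \<alpha> S" "i \<le> n"
    and "\<And>x. x \<in> set xs \<Longrightarrow> \<exists>m\<le>i. x \<in> set (bl (2 * m))"
  shows "\<exists>ss T. path (\<lambda>U. good n \<phi> i U \<and> ready (Suc (2 * i)) \<alpha> U) S ss T \<and>
    good n \<phi> i T \<and> ready (Suc (2 * i)) \<alpha> T \<and> (\<forall>x\<in>set xs. (val (cst x) (tv (\<alpha> x)), 1) \<in># T)"
  using assms(4)
proof (induction xs rule: rev_induct)
  case Nil
  have "path (\<lambda>U. good n \<phi> i U \<and> ready (Suc (2 * i)) \<alpha> U) S [] S" by (rule path_Nil)
  with assms(1,2) show ?case by auto
next
  case (snoc x xs)
  let ?P = "\<lambda>U. good n \<phi> i U \<and> ready (Suc (2 * i)) \<alpha> U"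
  have "\<exists>ss T. path ?P S ss T \<and> good n \<phi> i T \<and> ready (Suc (2 * i)) \<alpha> T \<and>
      (\<forall>x\<in>set xs. (val (cst x) (tv (\<alpha> x)), 1) \<in># T)"
    by (rule snoc.IH) (use snoc.prems in simp)
  then obtain ss T where path: "path ?P S ss T" and T: "good n \<phi> i T" "ready (Suc (2 * i)) \<alpha> T"
    and vals: "\<forall>x\<in>set xs. (val (cst x) (tv (\<alpha> x)), 1) \<in># T" by blast
  obtain m where m: "m \<le> i" "x \<in> set (bl (2 * m))" using snoc.prems[of x] by auto
  with assms(3) have mn: "m \<le> n" and lt: "2 * m < Suc (2 * i)" by auto
  consider "(val (cst x) (tv (\<alpha> x)), 1) \<in># T" | "(unset (cst x), 0) \<in># T"
    using readyD(2)[OF T(2) mn m(2)] by blast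
  then show ?case
  proof cases
    case 1
    with vals have "\<forall>x\<in>set (xs @ [x]). (val (cst x) (tv (\<alpha> x)), 1) \<in># T"
      unfolding set_append list.set by blast
    with path T show ?thesis by blast
  next
    case 2
    let ?T = "T - {#(unset (cst x), 0)#} + {#(val (cst x) (tv (\<alpha> x)), 1)#}"
    have step: "step sig (set sys_rules) (Inst (set_rule (\<alpha> x))) T ?T"
      using set_stepI[OF readyD(1)[OF T(2)] 2, of "\<alpha> x"] unfolding add_0 .
    note good' = good_sys_step[OF T(1) step]
    have ready': "ready (Suc (2 * i)) \<alpha> ?T" by (rule ready_set[OF T(2) mn m(2) lt 2])
    have "path ?P S (ss @ [(Inst (set_rule (\<alpha> x)), ?T)]) ?T"
      by (rule path_append[OF path path_single[OF step]]) (use good' ready' in blast)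
    moreover have "(val (cst x) (tv (\<alpha> x)), 1) \<in># ?T" by simp
    then have "\<forall>x\<in>set (xs @ [x]). (val (cst x) (tv (\<alpha> x)), 1) \<in># ?T"
      unfolding set_append list.set using vals good' by blast
    ultimately show ?thesis using good' ready' by blast
  qed
qed

text \<open>The assignment \<open>\<gamma>\<close> is read off the consumed options. Block
  \<open>2 * i\<close> need not be completely written at \<open>T\<close>: an update does not
  consume pending tokens, and \<open>ready\<close> admits them for decided variables.\<close>

lemma ready_update:
  assumes T: "ready (Suc (2 * i)) \<alpha> T" "good n \<phi> i T" and i: "i < n"
    and sub: "consumed \<phi> i 0 Y \<subseteq># T"
  shows "\<exists>\<gamma>. ready (2 * Suc i) (override_on \<alpha> \<gamma> (set (bl (2 * i + 1))))
    (T - consumed \<phi> i 0 Y + created \<phi> i 0 Y)"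
proof (rule exI[of _ "\<lambda>x. Y x = tv True"])
  let ?S = "T - consumed \<phi> i 0 Y + created \<phi> i 0 Y"
  let ?\<gamma> = "\<lambda>x. Y x = tv True"
  let ?\<alpha> = "override_on \<alpha> ?\<gamma> (set (bl (2 * i + 1)))"
  note R = readyD[OF T(1)]
  have keep: "f \<in># ?S" if "f \<in># T" "f \<notin># consumed \<phi> i 0 Y" for f
    using in_diff_notin[OF that] by simp
  have val: "(val y z, t) \<in># ?S" if "(val y z, t) \<in># T" for y z t
    by (rule keep[OF that]) (auto simp: consumed_def)
  have Y: "Y x = tv (?\<gamma> x)" if "x \<in> set (bl (2 * i + 1))" for x
  proof -
    have "(opt (cst x) (Y x), 0) \<in># T" using sub by (rule mset_subset_eqD) (use that in \<open>simp add: consumed_def\<close>)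
    from goodD(5)[OF T(2) this] show ?thesis by auto
  qed
  have same: "?\<alpha> x = \<alpha> x" if "j < Suc (2 * i)" "x \<in> set (bl j)" for j x
  proof (rule override_decided)
    show "x \<in> decided (2 * i + 1)" using that by (auto simp: decided_def)
  qed (use i in simp)
  show "ready (2 * Suc i) ?\<alpha> ?S"
  proof (rule readyI)
    show "(now_atom, 0) \<in># ?S" by (rule keep[OF R(1)]) (auto simp: consumed_def)
    show "(unset (cst x), 0) \<in># ?S \<or> 2 * m < 2 * Suc i \<and> (val (cst x) (tv (?\<alpha> x)), 1) \<in># ?S"
      if x: "m \<le> n" "x \<in> set (bl (2 * m))" for m x
    proof -
      consider "(unset (cst x), 0) \<in># T" | "2 * m < Suc (2 * i)" "(val (cst x) (tv (\<alpha> x)), 1) \<in># T"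
        using R(2)[OF x] by blast
      then show ?thesis
      proof cases
        case 1
        have "(unset (cst x), 0) \<in># ?S" by (rule keep[OF 1]) (auto simp: consumed_def)
        then show ?thesis by blast
      next
        case 2
        then have "2 * m < 2 * Suc i" by simp
        then show ?thesis unfolding same[OF 2(1) x(2)] using val[OF 2(2)] by blast
      qed
    qed
    show "(val (cst x) (tv (?\<alpha> x)), 1) \<in># ?S" if x: "2 * m + 1 < 2 * Suc i" "x \<in> set (bl (2 * m + 1))" for m x
    proof (cases "m = i")
      case True
      with x(2) have xi: "x \<in> set (bl (2 * i + 1))" by simp
      then have "(val (cst x) (Y x), 1) \<in># created \<phi> i 0 Y" by (simp add: created_def)
      then have "(val (cst x) (Y x), 1) \<in># ?S" by simp
      then show ?thesis unfolding override_on_apply_in[OF xi] Y[OF xi, symmetric] .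
    next
      case False
      with x have lt: "2 * m + 1 < Suc (2 * i)" by simp
      show ?thesis unfolding same[OF lt x(2)] by (rule val[OF R(3)[OF lt x(2)]])
    qed
    have "mset (map todo_fact (matrix \<phi>)) \<subseteq># T - consumed \<phi> i 0 Y"
      by (rule subset_diff_disjoint[OF R(4)]) (auto simp: consumed_def)
    then show "mset (map todo_fact (matrix \<phi>)) \<subseteq># ?S"
      by (rule subset_mset.order_trans) simp
  qed
qed

text \<open>A winning existential assignment is fixed first and then written down. At whichever
  configuration of the resulting trace an update strikes, \<open>ready_update\<close> leads to the
  situation of the next phase.\<close>

lemma complete:
  assumes "i + m = n" "good n \<phi> i S" "ready (2 * i) \<alpha> S"
    and "prefix_true True (drop (2 * i) (blocks \<phi>)) (matrix_true (matrix \<phi>)) \<alpha>"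
  shows "\<exists>\<tau>. resilient sig (qbf_scenario n \<phi>) m a b S \<tau>"
  using assms
proof (induction m arbitrary: i S \<alpha>)
  case 0
  have i: "i = n" using 0(1) by simp
  have "drop (2 * n) (blocks \<phi>) = [bl (2 * n)]" using drop_blocks[of "2 * n"] length_blocks by simp
  with 0(4) obtain \<beta> where M: "matrix_true (matrix \<phi>) (override_on \<alpha> \<beta> (set (bl (2 * n))))" by (auto simp: i)
  let ?\<alpha> = "override_on \<alpha> \<beta> (set (bl (2 * n)))"
  \<comment> \<open>All existential blocks and not just the last one: tokens of earlier blocks may
    still be pending, and the clauses may depend on their values.\<close>
  let ?xs = "concat (map (\<lambda>m. bl (2 * m)) [0..<Suc n])"
  have "good n \<phi> n S" "ready (Suc (2 * n)) ?\<alpha> S" using 0(2) ready_existential[OF 0(3)] by (simp_all add: i)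
  moreover have "\<exists>m\<le>n. x \<in> set (bl (2 * m))" if "x \<in> set ?xs" for x
    using that by (auto simp: less_Suc_eq_le simp del: upt_Suc)
  ultimately have "\<exists>ss T. path (\<lambda>U. good n \<phi> n U \<and> ready (Suc (2 * n)) ?\<alpha> U) S ss T \<and>
      good n \<phi> n T \<and> ready (Suc (2 * n)) ?\<alpha> T \<and> (\<forall>x\<in>set ?xs. (val (cst x) (tv (?\<alpha> x)), 1) \<in># T)"
    by (intro fill_path order_refl)
  then obtain ss T where
    path: "path (\<lambda>U. good n \<phi> n U \<and> ready (Suc (2 * n)) ?\<alpha> U) S ss T"
    and T: "good n \<phi> n T" "ready (Suc (2 * n)) ?\<alpha> T"
    and vals: "\<forall>x\<in>set ?xs. (val (cst x) (tv (?\<alpha> x)), 1) \<in># T"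
    by blast
  have all: "(val (cst x) (tv (?\<alpha> x)), 1) \<in># T" if x: "x \<in> decided (2 * n + 1)" for x
  proof -
    obtain j where j: "j < 2 * n + 1" "x \<in> set (bl j)" using x unfolding decided_def by blast
    show ?thesis
    proof (cases "even j")
      case True
      then obtain m where "j = 2 * m" by blast
      with j have "x \<in> set ?xs" by (auto simp del: upt_Suc)
      with vals show ?thesis by blast
    next
      case False
      then obtain m where "j = 2 * m + 1" by (elim oddE)
      with j readyD(3)[OF T(2), of m x] show ?thesis by simp
    qed
  qed
  have "\<exists>ss T'. path (\<lambda>_. True) T ss T' \<and>
      {#(now_atom, 0), (phase n, 0)#} + mset (map sat_fact (matrix \<phi>)) \<subseteq># T'"
  proof (rule mark_path)
    have "mset [(now_atom, 0), (phase n, 0)] \<subseteq># T"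
      by (rule mset_subset_distinct) (use readyD(1)[OF T(2)] good_phase[OF T(1), of n 0] in auto)
    then show "{#(now_atom, 0), (phase n, 0)#} + mset (map todo_fact (matrix \<phi>)) \<subseteq># T"
      by (intro sum_subset_disjoint readyD(4)[OF T(2)]) auto
    show "\<exists>j<3. (val (cst (clause_nums c ! (2 * j + 1))) (cst (clause_nums c ! (2 * j))), 1) \<in># T"
      if c: "c \<in> set (matrix \<phi>)" for c
    proof -
      obtain j where j: "j < 3" "clause_nums c ! (2 * j) = of_bool (?\<alpha> (clause_nums c ! (2 * j + 1)))"
        using M[unfolded matrix_true_iff] c by blast
      show ?thesis
        by (rule exI[of _ j]) (unfold j(2), rule conjI[OF j(1) all[OF matrix_vars[OF c j(1)]]])
    qed
  qed simp
  then obtain ss' T' where path': "path (\<lambda>_. True) T ss' T'"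
    and T': "{#(now_atom, 0), (phase n, 0)#} + mset (map sat_fact (matrix \<phi>)) \<subseteq># T'" by blast
  have "path (\<lambda>_. True) S (ss @ ss') T'" by (rule path_append[OF path_weaken[OF path] path']) simp
  then have "resilient sig (qbf_scenario n \<phi>) 0 a b S (S, ss @ ss')" by (rule path_resilient_0[OF _ final_goalI[OF T']])
  then show ?case by blast
next
  case (Suc m)
  have i: "i < n" using Suc.prems(1) by simp
  have "drop (2 * i) (blocks \<phi>) = bl (2 * i) # bl (2 * i + 1) # drop (2 * Suc i) (blocks \<phi>)"
    using drop_blocks[of "2 * i"] drop_blocks[of "2 * i + 1"] i by simp
  with Suc.prems(4) obtain \<beta> where
    \<beta>: "\<And>\<gamma>. prefix_true True (drop (2 * Suc i) (blocks \<phi>)) (matrix_true (matrix \<phi>))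
      (override_on (override_on \<alpha> \<beta> (set (bl (2 * i)))) \<gamma> (set (bl (2 * i + 1))))"
    by auto
  let ?\<alpha> = "override_on \<alpha> \<beta> (set (bl (2 * i)))"
  let ?P = "\<lambda>U. good n \<phi> i U \<and> ready (Suc (2 * i)) ?\<alpha> U"
  have S: "ready (Suc (2 * i)) ?\<alpha> S" using ready_existential[OF Suc.prems(3)] i by simp
  \<comment> \<open>The goal of phase \<open>i\<close> looks at block \<open>2 * i\<close> only, so
    pending tokens of earlier blocks can wait until the final phase.\<close>
  have "\<exists>ss T. path ?P S ss T \<and> good n \<phi> i T \<and> ready (Suc (2 * i)) ?\<alpha> T \<and>
      (\<forall>x\<in>set (bl (2 * i)). (val (cst x) (tv (?\<alpha> x)), 1) \<in># T)"
    by (rule fill_path[OF Suc.prems(2) S]) (use i in auto)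
  then obtain ss T where path: "path ?P S ss T"
    and T: "good n \<phi> i T" "ready (Suc (2 * i)) ?\<alpha> T"
    and vals: "\<And>x. x \<in> set (bl (2 * i)) \<Longrightarrow> (val (cst x) (tv (?\<alpha> x)), 1) \<in># T" by blast
  have "goal_config sig (qbf_scenario n \<phi>) T"
    by (rule stage_goalI[OF i readyD(1)[OF T(2)] _ _ vals])
      (use i good_phase[OF T(1), of i 0] distinct_bl[of "2 * i"] in auto)
  from path_resilient_0[OF path this] have "resilient sig (qbf_scenario n \<phi>) 0 a b S (S, ss)" .
  moreover have "\<exists>\<tau>'. resilient sig (qbf_scenario n \<phi>) m (a - (global_time U - global_time S)) b S' \<tau>'"
    if r: "r \<in> set (update_rules (qbf_scenario n \<phi>))" and U: "U \<in> set (trace_configs (S, ss))"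
      and ap: "apply_rule sig r U S'" for r U S'
  proof -
    obtain j where r: "r = update_rule \<phi> j" using r by auto
    have PU: "good n \<phi> i U" "ready (Suc (2 * i)) ?\<alpha> U"
      using U path S Suc.prems(2) by (auto simp: path_def trace_configs_def)
    from ap[unfolded r] obtain t Y where sub: "consumed \<phi> j t Y \<subseteq># U"
      and S': "S' = U - consumed \<phi> j t Y + created \<phi> j t Y" by (rule update_cases)
    note upd = good_update[OF PU(1) i sub S']
    then have jt: "j = i" "t = 0" by auto
    from ready_update[OF PU(2,1) i sub[unfolded jt]] obtain \<gamma> where
      "ready (2 * Suc i) (override_on ?\<alpha> \<gamma> (set (bl (2 * i + 1)))) S'" unfolding S' jt by blast
    from Suc.IH[OF _ _ this \<beta>[of \<gamma>]] upd Suc.prems(1) have "\<exists>\<tau>'. resilient sig (qbf_scenario n \<phi>) m a b S' \<tau>'" by simp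
    moreover have "global_time U = 0" "global_time S = 0"
      using good_time[OF PU(1) readyD(1)[OF PU(2)]] good_time[OF Suc.prems(2) readyD(1)[OF S]] by auto
    ultimately show ?thesis by simp
  qed
  ultimately have "resilient sig (qbf_scenario n \<phi>) (Suc m) a b S (S, ss)" unfolding resilient.simps(2) by blast
  then show ?case by blast
qed

lemma ready_start: "ready 0 \<alpha> (mset (start n \<phi>))"
proof (rule readyI)
  show "(now_atom, 0) \<in># mset (start n \<phi>)" by (simp add: start_def)
  show "(unset (cst x), 0) \<in># mset (start n \<phi>) \<or> 2 * m < 0 \<and> (val (cst x) (tv (\<alpha> x)), 1) \<in># mset (start n \<phi>)"
    if "m \<le> n" "x \<in> set (bl (2 * m))" for m x
  proof -
    have "x \<in> set (selected_vars even \<phi>)" unfolding sel_iff using that by (intro exI[of _ "2 * m"]) simp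
    then have "(unset (cst x), 0) \<in># mset (start n \<phi>)" by (auto simp: start_def)
    then show ?thesis by blast
  qed
  show "mset (map todo_fact (matrix \<phi>)) \<subseteq># mset (start n \<phi>)"
    by (simp add: start_def)
qed simp

theorem resilience_iff_true: "\<phi> \<in> Sigma_SAT (2 * n + 1) \<longleftrightarrow> qbf_scenario n \<phi> \<in> resilience_problem sig n a b"
proof -
  have "planning_scenario sig (qbf_scenario n \<phi>)"
    using progressing_scen by (simp add: progressing_scenario_def)
  moreover have "qbf_true \<phi>" if "resilient sig (qbf_scenario n \<phi>) n a b (mset (start n \<phi>)) \<tau>" for \<tau>
    using sound[OF _ good_start _ that, of "\<lambda>_. False"] by (simp add: qbf_true_def agrees_def decided_def)
  moreover have "\<exists>\<tau>. resilient sig (qbf_scenario n \<phi>) n a b (mset (start n \<phi>)) \<tau>" if "qbf_true \<phi>"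
    using complete[OF _ good_start, of n "\<lambda>_. False" a b] ready_start that by (simp add: qbf_true_def)
  ultimately show ?thesis
    using formula by (auto simp: Sigma_SAT_def resilience_problem_def)
qed

end

section \<open>Computing the scenario\<close>

text \<open>The opening brackets are those of the timed fact, the atom and the argument list; the
  number 1 tags a predicate other than \<open>Time\<close>. The encoding is cut around the arguments
  because copied numbers have to go there.\<close>

definition fact_begin :: "nat \<Rightarrow> nat list" where
  "fact_begin q = [4, 4] @ serialize (Num 1) @ serialize (Num q) @ [4]"

definition fact_end :: "nat \<Rightarrow> nat list" where
  "fact_end t = [5, 5] @ serialize (Num t) @ [5]"

definition cst_items :: "item list" where
  "cst_items = map Sym ([4] @ serialize (Num 1) @ serialize (Num 0)) @ [Copy] @ map Sym [3, 5]"

text \<open>A formula variable turns into the rule variable with the same number, so copying is all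
  it takes to print it.\<close>

definition var_items :: "item list" where
  "var_items = map Sym ([4] @ serialize (Num 0) @ serialize (Num 0)) @ [Copy] @ map Sym [3, 5]"

definition unset_items :: "item list" where
  "unset_items = map Sym (fact_begin 3) @ cst_items @ map Sym (fact_end 0)"

definition opt_const_items :: "bool \<Rightarrow> item list" where
  "opt_const_items b = map Sym (fact_begin 4) @ cst_items @
     map Sym (serialize (sexp_trm (tv b)) @ fact_end 0)"

definition opt_items :: "item list" where
  "opt_items = map Sym (fact_begin 4) @ cst_items @ var_items @ map Sym (fact_end 0)"

definition val_items :: "item list" where
  "val_items = map Sym (fact_begin 5) @ cst_items @ var_items @ map Sym (fact_end 1)"

lemma serialize_timed:
  "serialize (sexp_timed (Atom (Pred q) ts, t)) =
     fact_begin q @ concat (map (\<lambda>t. serialize (sexp_trm t)) ts) @ fact_end t"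
  by (simp add: fact_begin_def fact_end_def sexp_list_def comp_def)

lemma expand_cst: "expand (binary x) cst_items = serialize (sexp_trm (cst x))"
  by (simp add: cst_items_def expand_append expand_Sym)

lemma expand_var: "expand (binary x) var_items = serialize (sexp_trm (vr x))"
  by (simp add: var_items_def expand_append expand_Sym)

lemma expand_facts:
  "expand (binary x) unset_items = serialize (sexp_timed (unset (cst x), 0))"
  "expand (binary x) (opt_const_items b) = serialize (sexp_timed (opt (cst x) (tv b), 0))"
  "expand (binary x) opt_items = serialize (sexp_timed (opt (cst x) (vr x), 0))"
  "expand (binary x) val_items = serialize (sexp_timed (val (cst x) (vr x), 1))"
  unfolding unset_items_def opt_const_items_def opt_items_def val_items_def
    expand_append expand_Sym expand_cst expand_var serialize_timed by simp_all

definition var_pass :: "nat list \<Rightarrow> (nat \<Rightarrow> item list) \<Rightarrow> nat list \<Rightarrow> pass" where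
  "var_pass u f v = \<lparr>pass_begin = u, on_var = f, clause_begin = [], on_arg = [], clause_end = [], pass_end = v\<rparr>"

text \<open>\<open>cst_items\<close> fits signs as well as variables, since both become
  constants.\<close>

definition clause_pass :: "nat list \<Rightarrow> (nat \<Rightarrow> item list) \<Rightarrow> nat \<Rightarrow> nat \<Rightarrow> nat list \<Rightarrow> pass" where
  "clause_pass u f q t v = \<lparr>pass_begin = u, on_var = f, clause_begin = fact_begin q,
     on_arg = cst_items, clause_end = fact_end t, pass_end = v\<rparr>"

lemma blocks_out_eq:
  "blocks_out P j bs =
     concat (map (\<lambda>i. concat (map (\<lambda>v. expand (binary v) (on_var P (j + i))) (bs ! i))) [0..<length bs])"
proof (induction bs arbitrary: j)
  case (Cons vs bs)
  have "[0..<length (vs # bs)] = 0 # map Suc [0..<length bs]"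
    by (simp add: map_Suc_upt upt_conv_Cons del: upt_Suc)
  then show ?case by (simp add: Cons.IH comp_def del: upt_Suc)
qed simp

lemma var_pass_out: "pass_out (var_pass u f v) \<phi> = u @
    concat (map (\<lambda>i. concat (map (\<lambda>x. expand (binary x) (f i)) (blocks \<phi> ! i))) [0..<length (blocks \<phi>)]) @ v"
  by (simp add: pass_out_def var_pass_def blocks_out_eq clause_out_def map_replicate_const comp_def)

lemma clause_pass_out: "pass_out (clause_pass u f q t v) \<phi> = u @
    concat (map (\<lambda>i. concat (map (\<lambda>x. expand (binary x) (f i)) (blocks \<phi> ! i))) [0..<length (blocks \<phi>)]) @
    concat (map (\<lambda>c. serialize (sexp_timed (Atom (Pred q) (map cst (clause_nums c)), t))) (matrix \<phi>)) @ v"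
proof -
  have "clause_out (clause_pass u f q t v) c = serialize (sexp_timed (Atom (Pred q) (map cst (clause_nums c)), t))" for c
    unfolding serialize_timed by (simp add: clause_out_def clause_pass_def expand_cst comp_def del: sexp_trm.simps)
  then have eq: "clause_out (clause_pass u f q t v) =
      (\<lambda>c. serialize (sexp_timed (Atom (Pred q) (map cst (clause_nums c)), t)))" by (rule ext)
  show ?thesis
    unfolding pass_out_def blocks_out_eq eq by (simp add: clause_pass_def del: sexp_timed.simps)
qed

lemma concat_single: "i < k \<Longrightarrow> concat (map (\<lambda>j. if j = i then g j else []) [0..<k]) = g i"
  by (induction k) (auto simp: less_Suc_eq concat_eq_Nil_conv)

text \<open>The control can single out a block because the number of blocks is fixed and the block
  index is part of its state.\<close>

definition block_items :: "nat \<Rightarrow> item list \<Rightarrow> nat \<Rightarrow> item list" where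
  "block_items i r = (\<lambda>j. if j = i then r else [])"

lemma block_pass_out:
  assumes "i < length (blocks \<phi>)"
  shows "pass_out (var_pass u (block_items i r) v) \<phi> =
    u @ concat (map (\<lambda>x. expand (binary x) r) (blocks \<phi> ! i)) @ v"
proof -
  have "(\<lambda>j. concat (map (\<lambda>x. expand (binary x) (block_items i r j)) (blocks \<phi> ! j))) =
      (\<lambda>j. if j = i then concat (map (\<lambda>x. expand (binary x) r) (blocks \<phi> ! j)) else [])"
    by (auto simp: block_items_def concat_eq_Nil_conv)
  then show ?thesis unfolding var_pass_out using concat_single[OF assms] by simp
qed

definition parity_items :: "(nat \<Rightarrow> bool) \<Rightarrow> item list \<Rightarrow> nat \<Rightarrow> item list" where
  "parity_items P r = (\<lambda>j. if P j then r else [])"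

lemma parity_items_out:
  "concat (map (\<lambda>i. concat (map (\<lambda>x. expand (binary x) (parity_items P r i)) (blocks \<phi> ! i))) [0..<length (blocks \<phi>)]) =
   concat (map (\<lambda>x. expand (binary x) r) (selected_vars P \<phi>))"
proof -
  have eq: "concat (map (\<lambda>x. expand (binary x) (parity_items P r i)) (blocks \<phi> ! i)) =
      concat (map (\<lambda>x. expand (binary x) r) (if P i then blocks \<phi> ! i else []))" for i
    by (auto simp: parity_items_def concat_eq_Nil_conv)
  have flat: "concat (map g (concat xss)) = concat (map (\<lambda>xs. concat (map g xs)) xss)"
    for g :: "nat \<Rightarrow> nat list" and xss
    by (induction xss) simp_all
  show ?thesis unfolding selected_vars_def eq flat by (simp add: comp_def)
qed

definition now_phase :: "nat \<Rightarrow> nat list" where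
  "now_phase i = serialize (sexp_timed (now_atom, 0)) @ serialize (sexp_timed (phase i, 0))"

text \<open>The final text closes the pattern list, adds the empty list of constraints and closes
  the pair.\<close>

definition goal_pass :: "nat \<Rightarrow> pass" where
  "goal_pass i = var_pass ([4, 4] @ now_phase i) (block_items (2 * i) val_items) [5, 4, 5, 5]"

definition final_pass :: "nat \<Rightarrow> pass" where
  "final_pass n = clause_pass ([4, 4] @ now_phase n) (\<lambda>_. []) 7 1 [5, 4, 5, 5]"

text \<open>An update rule takes two passes because it lists its block twice, with the guard in
  between. In \<open>[4, 5, 4]\<close> the empty side condition is followed by the bracket that
  opens the consumed facts.\<close>

definition consumed_pass :: "nat \<Rightarrow> pass" where
  "consumed_pass i = var_pass
     ([4] @ serialize (Num 0) @ [4, 5, 4] @ serialize (sexp_timed (phase i, 0)) @ serialize (sexp_timed (fuel i, 0)))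
     (block_items (2 * i + 1) opt_items)
     ([5] @ serialize (sexp_list sexp_constraint [not_before 0 0]))"

definition created_pass :: "nat \<Rightarrow> pass" where
  "created_pass i = var_pass
     ([4] @ serialize (sexp_timed (phase (i + 1), 0)) @ serialize (sexp_timed (fuel i, 1)))
     (block_items (2 * i + 1) val_items) [5, 5]"

text \<open>\<open>3 * n + 5\<close> passes. Those without items print only constant text: the
  system rules, the empty critical specification and the brackets between the components. Options
  and clauses share the last pass, as the prefix is read before the matrix.\<close>

definition passes :: "nat \<Rightarrow> pass list" where
  "passes n = [var_pass ([4] @ serialize (sexp_list sexp_rule sys_rules) @ [4]) (\<lambda>_. []) []] @
     map goal_pass [0..<n] @
     [final_pass n, var_pass ([5] @ serialize (sexp_spec []) @ [4]) (\<lambda>_. []) []] @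
     concat (map (\<lambda>i. [consumed_pass i, created_pass i]) [0..<n]) @
     [var_pass ([5, 4] @ now_phase 0 @ concat (map (\<lambda>i. serialize (sexp_timed (fuel i, 0))) [0..<n]))
        (parity_items even unset_items) [],
      clause_pass [] (parity_items odd (opt_const_items False @ opt_const_items True)) 6 0 [5, 5]]"

abbreviation "pair_sexp \<equiv> \<lambda>(ps, cs). Lst [sexp_list sexp_timed ps, sexp_list sexp_constraint cs]"

lemma goal_pass_out:
  assumes "length (blocks \<phi>) = 2 * n + 1" "i < n"
  shows "pass_out (goal_pass i) \<phi> = serialize (pair_sexp (stage_goal \<phi> i))"
  using assms unfolding goal_pass_def
  by (subst block_pass_out)
    (simp_all add: stage_goal_def now_phase_def sexp_list_def comp_def expand_facts del: sexp_timed.simps)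

lemma final_pass_out: "pass_out (final_pass n) \<phi> = serialize (pair_sexp (final_goal n \<phi>))"
  unfolding final_pass_def clause_pass_out
  by (simp add: final_goal_def now_phase_def sexp_list_def comp_def map_replicate_const del: sexp_timed.simps)

lemma update_pass_out:
  assumes "length (blocks \<phi>) = 2 * n + 1" "i < n"
  shows "pass_out (consumed_pass i) \<phi> @ pass_out (created_pass i) \<phi> = serialize (sexp_rule (update_rule \<phi> i))"
proof -
  have i: "2 * i + 1 < length (blocks \<phi>)" using assms by simp
  show ?thesis unfolding consumed_pass_def created_pass_def block_pass_out[OF i]
    by (simp add: update_rule_def sexp_rule_def sexp_list_def comp_def expand_facts
        del: sexp_timed.simps sexp_constraint.simps)
qed

lemma passes_out:
  assumes "length (blocks \<phi>) = 2 * n + 1"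
  shows "concat (map (\<lambda>P. pass_out P \<phi>) (passes n)) = enc_scenario (qbf_scenario n \<phi>)"
proof -
  have goals: "concat (map (\<lambda>i. pass_out (goal_pass i) \<phi>) [0..<n]) =
      concat (map (\<lambda>i. serialize (pair_sexp (stage_goal \<phi> i))) [0..<n])"
    using goal_pass_out[OF assms] by (intro arg_cong[of _ _ concat] map_cong) auto
  have upd: "concat (map (\<lambda>i. pass_out (consumed_pass i) \<phi> @ pass_out (created_pass i) \<phi>) [0..<n]) =
      concat (map (\<lambda>i. serialize (sexp_rule (update_rule \<phi> i))) [0..<n])"
    using update_pass_out[OF assms] by (intro arg_cong[of _ _ concat] map_cong) auto
  have upd': "concat (map (\<lambda>P. pass_out P \<phi>) (concat (map (\<lambda>i. [consumed_pass i, created_pass i]) [0..<n]))) =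
      concat (map (\<lambda>i. pass_out (consumed_pass i) \<phi> @ pass_out (created_pass i) \<phi>) [0..<n])"
    by (induction n) auto
  have opts: "concat (map (\<lambda>x. expand (binary x) (opt_const_items False @ opt_const_items True)) xs) =
      concat (map (\<lambda>p. serialize (sexp_timed p))
        (concat (map (\<lambda>x. [(opt (cst x) (tv False), 0), (opt (cst x) (tv True), 0)]) xs)))" for xs
    by (induction xs) (simp_all add: expand_append expand_facts del: sexp_timed.simps)
  have "concat (map (\<lambda>P. pass_out P \<phi>) (passes n)) =
      ([4] @ serialize (sexp_list sexp_rule sys_rules) @ [4]) @
      concat (map (\<lambda>i. serialize (pair_sexp (stage_goal \<phi> i))) [0..<n]) @
      serialize (pair_sexp (final_goal n \<phi>)) @
      ([5] @ serialize (sexp_spec []) @ [4]) @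
      concat (map (\<lambda>i. serialize (sexp_rule (update_rule \<phi> i))) [0..<n]) @
      ([5, 4] @ concat (map (\<lambda>p. serialize (sexp_timed p)) (start n \<phi>)) @ [5, 5])"
    unfolding passes_def map_append concat_append upd' upd map_map comp_def goals
    by (simp add: final_pass_out var_pass_out clause_pass_out parity_items_out opts start_def now_phase_def
        expand_facts map_replicate_const comp_def del: sexp_timed.simps)
  also have "\<dots> = enc_scenario (qbf_scenario n \<phi>)"
    by (simp add: enc_scenario_def sexp_spec_def sexp_list_def comp_def del: sexp_timed.simps)
  finally show ?thesis .
qed

section \<open>All printed symbols belong to the finite alphabet\<close>

definition ok_items :: "item list \<Rightarrow> bool" where
  "ok_items r \<longleftrightarrow> set r \<subseteq> insert Copy (Sym ` {..<6})"

definition ok_pass :: "pass \<Rightarrow> bool" where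
  "ok_pass P \<longleftrightarrow> ok_items (map Sym (pass_begin P)) \<and> (\<forall>j. ok_items (on_var P j)) \<and>
     ok_items (map Sym (clause_begin P)) \<and> ok_items (on_arg P) \<and> ok_items (map Sym (clause_end P)) \<and>
     ok_items (map Sym (pass_end P))"

lemma ok_items_simps:
  "ok_items []" "ok_items (Copy # r) \<longleftrightarrow> ok_items r" "ok_items (Sym x # r) \<longleftrightarrow> x < 6 \<and> ok_items r"
  "ok_items (r @ r') \<longleftrightarrow> ok_items r \<and> ok_items r'"
  by (auto simp: ok_items_def)

lemma ok_serialize: "ok_items (map Sym (serialize s))"
  using set_serialize[of s] by (auto simp: ok_items_def)

lemma ok_concat: "(\<And>x. x \<in> set xs \<Longrightarrow> ok_items (map Sym (f x))) \<Longrightarrow> ok_items (map Sym (concat (map f xs)))"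
  by (auto simp: ok_items_def)

lemma ok_parts:
  "ok_items (map Sym (fact_begin q))" "ok_items (map Sym (fact_end t))" "ok_items (map Sym (now_phase i))"
  "ok_items cst_items" "ok_items var_items"
  by (simp_all add: fact_begin_def fact_end_def now_phase_def cst_items_def var_items_def ok_items_simps ok_serialize
      del: serialize.simps sexp_timed.simps)

lemma ok_passes:
  assumes "P \<in> set (passes n)"
  shows "ok_pass P"
proof -
  have items: "ok_items unset_items" "ok_items (opt_const_items b)" "ok_items opt_items" "ok_items val_items" for b
    by (simp_all add: unset_items_def opt_const_items_def opt_items_def val_items_def ok_items_simps ok_parts
        ok_serialize del: serialize.simps sexp_trm.simps)
  have fuel: "ok_items (map Sym (concat (map (\<lambda>i. serialize (sexp_timed (fuel i, 0))) [0..<n])))"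
    by (rule ok_concat) (rule ok_serialize)
  show ?thesis
    using assms unfolding passes_def
    by (auto simp: ok_pass_def var_pass_def clause_pass_def goal_pass_def final_pass_def consumed_pass_def
        created_pass_def block_items_def parity_items_def ok_items_simps ok_parts ok_serialize items fuel
        simp del: serialize.simps sexp_timed.simps sexp_constraint.simps)
qed

lemma ok_machine_items:
  assumes "\<And>P. P \<in> set ps \<Longrightarrow> ok_pass P" "r \<in> pass_machine.items ps k"
  shows "ok_items r"
proof -
  interpret pass_machine ps k .
  obtain p where "p < length ps" "\<exists>d j. r \<in> {open_items p d j, close_items p d j, num_items p d j}"
    using assms(2) by (auto simp: items_def)
  with assms(1)[of "ps ! p"] show ?thesis
    by (auto simp: open_items_def close_items_def num_items_def ok_pass_def ok_items_simps)
qed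

theorem theorem2:
  fixes n a b :: nat
  assumes "a > 0"
  shows "\<exists>Sg k f. wf_signature Sg \<and>
    poly_time_reduction
      enc_qbf {\<phi>. sigma_formula (2 * n + 1) \<phi>} (Sigma_SAT (2 * n + 1))
      enc_scenario {A. planning_scenario Sg A} (resilience_problem Sg n a b) f \<and>
    (\<forall>\<phi>. sigma_formula (2 * n + 1) \<phi> \<longrightarrow>
       progressing_scenario Sg (f \<phi>) \<and> simple_scenario 1 (f \<phi>) \<and> facts_bounded Sg k (f \<phi>))"
proof (intro exI conjI allI impI)
  show "wf_signature sig" by (rule wf_sig)
  show "poly_time_reduction
      enc_qbf {\<phi>. sigma_formula (2 * n + 1) \<phi>} (Sigma_SAT (2 * n + 1))
      enc_scenario {A. planning_scenario sig A} (resilience_problem sig n a b) (qbf_scenario n)"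
    unfolding poly_time_reduction_def
  proof (intro conjI ballI)
    show "poly_time_computable enc_qbf enc_scenario {\<phi>. sigma_formula (2 * n + 1) \<phi>} (qbf_scenario n)"
    proof (rule passes_poly_time)
      show "passes n \<noteq> []" by (simp add: passes_def)
      show "set r \<subseteq> insert Copy (Sym ` {..<6})" if "r \<in> pass_machine.items (passes n) (2 * n + 1)" for r
        using ok_machine_items[OF ok_passes that] by (simp add: ok_items_def)
      show "enc_scenario (qbf_scenario n \<phi>) = concat (map (\<lambda>P. pass_out P \<phi>) (passes n))"
        if "sigma_formula (2 * n + 1) \<phi>" for \<phi>
        using passes_out that by (simp add: sigma_formula_def)
    qed simp
    fix \<phi> assume "\<phi> \<in> {\<phi>. sigma_formula (2 * n + 1) \<phi>}"
    then interpret game n \<phi> by unfold_locales simp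
    show "\<phi> \<in> Sigma_SAT (2 * n + 1) \<longleftrightarrow> qbf_scenario n \<phi> \<in> resilience_problem sig n a b"
      by (rule resilience_iff_true)
    show "qbf_scenario n \<phi> \<in> {A. planning_scenario sig A}"
      using progressing_scen by (simp add: progressing_scenario_def)
  qed
  fix \<phi>
  show "progressing_scenario sig (qbf_scenario n \<phi>)" by (rule progressing_scen)
  show "simple_scenario 1 (qbf_scenario n \<phi>)" by (rule simple_scen)
  show "facts_bounded sig 7 (qbf_scenario n \<phi>)" by (rule facts_bounded_scen)
qed

end
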